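(* Let $\varphi$ be a minimal counterexample to Vaught's conjecture, let $\lambda<\omega_1$ be a limit ordinal with $\lambda\in\mathfrak F$ and $\lambda>\mathrm{qr}(\varphi)$, and let $A\in W_\lambda$, i.e. $A\models\varphi$, $\omega_1^A=\lambda$ and $\mathrm{cSR}(A)\ge\lambda$. Then exactly one of the following holds: (I) $\mathrm{cSR}(A)=\lambda$. In this case $A\cong K_\lambda$; consequently $\omega_1^{K_\lambda}=\lambda$ and $\mathrm R(K_\lambda)=\lambda=\omega_1^{K_\lambda}$. (II) $\mathrm{cSR}(A)=\lambda+1$ and $A\notin\mathcal C_{\lambda+1}$. In this case $\mathrm{HIGH}(\lambda)\supsetneq\mathcal C_{\lambda+1}$, and $\varphi$ has at least two non-isomorphic models of $\mathrm{cSR}=\lambda+1$ (namely $A$ and $K_{\lambda+1}$); consequently $\lambda+1\notin\mathfrak F$. (III) $\mathrm{cSR}(A)=\lambda+1$ and $A\in\mathcal C_{\lambda+1}$. In this case $A\cong K_{\lambda+1}$; consequently $\omega_1^{K_{\lambda+1}}=\lambda$ and $\mathrm{cSR}(K_{\lambda+1})=\lambda+1=\omega_1^{K_{\lambda+1}}+1$.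
   Context: Structures are countable structures in a countable vocabulary; classes of models are counted up to isomorphism; ordinals are countable. $\Sigma^{\mathrm{in}}_0=\Pi^{\mathrm{in}}_0$ is the set of finitary quantifier-free formulas; for $\alpha>0$, $\Sigma^{\mathrm{in}}_\alpha$ consists of countable disjunctions of formulas $\exists\bar x\,\psi$ with $\psi\in\Pi^{\mathrm{in}}_\beta$, $\beta<\alpha$, and $\Pi^{\mathrm{in}}_\alpha$ is dual. $M\equiv_\alpha N$ means that $M,N$ satisfy the same $\Pi^{\mathrm{in}}_\alpha$ (equivalently $\Sigma^{\mathrm{in}}_\alpha$) sentences (the standard back-and-forth relation). A Scott sentence of $M$ is an $L_{\omega_1\omega}$ sentence whose countable models are exactly the copies of $M$. $\mathrm{cSR}(M)$ is the least $\alpha$ such that $M$ has a $\Pi^{\mathrm{in}}_{\alpha+1}$ Scott sentence. $\mathrm R(A)=\sup\{\rho^{\le}(\bar a)+1:\bar a\in A^{<\omega}\}$ where $\rho^{\le}(\bar a)$ is the least $\alpha$ such that for every tuple $\bar b$ of $A$, if all $\Pi^{\mathrm{in}}_\alpha$ formulas true of $\bar a$ are true of $\bar b$ then all $L_{\omega_1\omega}$ formulas true of $\bar a$ are true of $\bar b$. $\omega_1^A=\min\{\omega_1^X: X\in 2^\omega \text{ computes a copy of }A\}$. $\mathrm{qr}(S)$ is the least $\beta$ with $S\in\Pi^{\mathrm{in}}_\beta\cup\Sigma^{\mathrm{in}}_\beta$. Standing hypotheses: Vaught's conjecture fails, and $\varphi$ is a minimal counterexample: an $L_{\omega_1\omega}$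 sentence with exactly $\aleph_1$ countable models up to isomorphism, scattered (for each $\alpha<\omega_1$ there are at most countably many $\equiv_\alpha$-classes among its models), and such that for every $L_{\omega_1\omega}$ sentence $\psi$ one of $\varphi\wedge\psi$, $\varphi\wedge\neg\psi$ has only countably many models. Moreover for each $\alpha<\omega_1$ only countably many $\Sigma^{\mathrm{in}}_\alpha$-types are realized in models of $\varphi$. For each $\beta<\omega_1$ exactly one $\equiv_\beta$-class of models of $\varphi$ is uncountable; it is denoted $\mathcal C_\beta$. For $\beta\ge\mathrm{qr}(\varphi)$, the label $K_\beta$ is the unique (up to isomorphism) member of $\mathcal C_\beta$ of least $\mathrm{cSR}$ (it exists). $f(\alpha)=\min\{\beta:(\forall M\models\varphi)(M\notin\mathcal C_\alpha\Rightarrow\mathrm{cSR}(M)<\beta)\}$ and $\mathfrak F=\{\alpha<\omega_1:f(\alpha)\le\alpha\}$. $W_\lambda=\{A\models\varphi:\omega_1^A=\lambda,\ \mathrm{cSR}(A)\ge\lambda\}$; $\mathrm{HIGH}(\lambda)=\{A\models\varphi:\mathrm{cSR}(A)\ge\lambda+1\}$. *)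

theory Defs
  imports "HOL-Library.Nat_Bijection" "HOL-Library.Countable_Set_Type"
begin

section \<open>Countable ordinals\<close>

text \<open>
  The library relation \<^term>\<open>cardSuc natLeq\<close> is a well-order of minimal order type among the
  uncountable ones, that is, of order type $\omega_1$.  Its field, as a type, is the type of all
  countable ordinals; it is itself uncountable and each of its proper initial segments is
  countable.
\<close>

lemma Card_order_cardSuc_natLeq: "Card_order (cardSuc natLeq)"
  by (rule cardSuc_Card_order[OF natLeq_Card_order])

lemma Well_order_cardSuc_natLeq: "Well_order (cardSuc natLeq)"
  using Card_order_cardSuc_natLeq by (rule Card_order_wo_rel[THEN wo_rel.WELL])

typedef omega1 = "Field (cardSuc natLeq)"
proof -
  have "infinite (Field (cardSuc natLeq))"
    using natLeq_Card_order cardSuc_finite Field_natLeq infinite_UNIV_nat by metis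
  then show ?thesis by (metis ex_in_conv finite.emptyI)
qed

instantiation omega1 :: linorder
begin

definition less_eq_omega1 :: "omega1 \<Rightarrow> omega1 \<Rightarrow> bool" where
  "\<alpha> \<le> \<beta> \<longleftrightarrow> (Rep_omega1 \<alpha>, Rep_omega1 \<beta>) \<in> cardSuc natLeq"

definition less_omega1 :: "omega1 \<Rightarrow> omega1 \<Rightarrow> bool" where
  "\<alpha> < \<beta> \<longleftrightarrow> \<alpha> \<le> \<beta> \<and> \<not> \<beta> \<le> (\<alpha>::omega1)"

instance
proof
  have lin: "Linear_order (cardSuc natLeq)"
    using Well_order_cardSuc_natLeq unfolding well_order_on_def by blast
  have r: "refl_on (Field (cardSuc natLeq)) (cardSuc natLeq)"
    and t: "trans (cardSuc natLeq)" and a: "antisym (cardSuc natLeq)"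
    and tot: "total_on (Field (cardSuc natLeq)) (cardSuc natLeq)"
    using lin unfolding linear_order_on_def partial_order_on_def preorder_on_def by blast+
  fix x y z :: omega1
  show "x < y \<longleftrightarrow> x \<le> y \<and> \<not> y \<le> x" by (rule less_omega1_def)
  show "x \<le> x" unfolding less_eq_omega1_def using r Rep_omega1 by (meson refl_onD)
  show "x \<le> y \<Longrightarrow> y \<le> z \<Longrightarrow> x \<le> z" unfolding less_eq_omega1_def using t by (meson transD)
  show "x \<le> y \<Longrightarrow> y \<le> x \<Longrightarrow> x = y"
    unfolding less_eq_omega1_def using a by (metis antisymD Rep_omega1_inject)
  show "x \<le> y \<or> y \<le> x"
    unfolding less_eq_omega1_def using r tot Rep_omega1 unfolding total_on_def by (metis refl_onD)
qed

end

instance omega1 :: wellorder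
proof
  fix P :: "omega1 \<Rightarrow> bool" and a :: omega1
  assume step: "\<And>x. (\<And>y. y < x \<Longrightarrow> P y) \<Longrightarrow> P x"
  have wf: "wf (cardSuc natLeq - Id)"
    using Well_order_cardSuc_natLeq unfolding well_order_on_def by blast
  have "{(x, y). x < (y::omega1)} \<subseteq> inv_image (cardSuc natLeq - Id) Rep_omega1"
    by (auto simp: inv_image_def less_le less_eq_omega1_def Rep_omega1_inject)
  then have "wf {(x, y). x < (y::omega1)}"
    using wf wf_inv_image wf_subset by blast
  then show "P a"
    using step by (induction a rule: wf_induct_rule) auto
qed

lemma countable_below_omega1: "countable {\<beta>::omega1. \<beta> < \<alpha>}"
proof -
  let ?r = "cardSuc natLeq"
  have "(card_of (underS ?r (Rep_omega1 \<alpha>)), ?r) \<in> ordLess"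
    using card_of_underS[OF Card_order_cardSuc_natLeq Rep_omega1] .
  then have "(card_of (underS ?r (Rep_omega1 \<alpha>)), natLeq) \<in> ordLeq"
    using cardSuc_ordLeq_ordLess[OF natLeq_Card_order card_of_Card_order] by blast
  then have "countable (underS ?r (Rep_omega1 \<alpha>))"
    by (simp add: countable_card_le_natLeq)
  moreover have "Rep_omega1 ` {\<beta>. \<beta> < \<alpha>} \<subseteq> underS ?r (Rep_omega1 \<alpha>)"
    by (auto simp: underS_def less_le less_eq_omega1_def Rep_omega1_inject)
  moreover have "inj_on Rep_omega1 {\<beta>. \<beta> < \<alpha>}"
    by (simp add: inj_on_def Rep_omega1_inject)
  ultimately show ?thesis
    using countable_subset countable_image_inj_on by metis
qed

lemma uncountable_omega1: "\<not> countable (UNIV :: omega1 set)"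
proof
  assume "countable (UNIV :: omega1 set)"
  then have "countable (Field (cardSuc natLeq))"
    using type_definition.Rep_range[OF type_definition_omega1] countable_image by metis
  then have "(card_of (Field (cardSuc natLeq)), natLeq) \<in> ordLeq"
    by (simp add: countable_card_le_natLeq)
  then have "(cardSuc natLeq, natLeq) \<in> ordLeq"
    using card_of_Field_ordIso[OF Card_order_cardSuc_natLeq] ordIso_ordLeq_trans ordIso_symmetric
    by blast
  then show False
    using cardSuc_greater[OF natLeq_Card_order] not_ordLess_ordLeq by blast
qed

instantiation omega1 :: zero
begin
definition zero_omega1 :: omega1 where "(0::omega1) = (LEAST \<alpha>. True)"
instance ..
end

definition osuc :: "omega1 \<Rightarrow> omega1" where
  "osuc \<alpha> = (LEAST \<beta>. \<alpha> < \<beta>)"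

definition limit_ordinal :: "omega1 \<Rightarrow> bool" where
  "limit_ordinal \<alpha> \<longleftrightarrow> \<alpha> \<noteq> 0 \<and> (\<forall>\<beta><\<alpha>. osuc \<beta> < \<alpha>)"

text \<open>The well-order of the ordinals below a given one.\<close>

definition ordinal_rel :: "omega1 \<Rightarrow> omega1 rel" where
  "ordinal_rel \<alpha> = {(\<beta>, \<gamma>). \<beta> \<le> \<gamma> \<and> \<gamma> < \<alpha>}"


section \<open>Relative computability\<close>

text \<open>Programs for the partial recursive functions with an oracle.\<close>

datatype prog =
    Zero
  | Succ
  | Proj nat
  | Oracle
  | Comp prog "prog list"
  | PrimRec prog prog
  | Mu prog

inductive computes :: "nat set \<Rightarrow> prog \<Rightarrow> nat list \<Rightarrow> nat \<Rightarrow> bool" for X :: "nat set" where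
  "computes X Zero xs 0"
| "computes X Succ (x # xs) (Suc x)"
| "i < length xs \<Longrightarrow> computes X (Proj i) xs (xs ! i)"
| "computes X Oracle (x # xs) (if x \<in> X then 1 else 0)"
| "list_all2 (\<lambda>g y. computes X g xs y) gs ys \<Longrightarrow> computes X f ys z \<Longrightarrow>
    computes X (Comp f gs) xs z"
| "computes X f xs z \<Longrightarrow> computes X (PrimRec f g) (0 # xs) z"
| "computes X (PrimRec f g) (n # xs) y \<Longrightarrow> computes X g (n # y # xs) z \<Longrightarrow>
    computes X (PrimRec f g) (Suc n # xs) z"
| "computes X f (n # xs) 0 \<Longrightarrow> (\<And>m. m < n \<Longrightarrow> \<exists>y. y > 0 \<and> computes X f (m # xs) y) \<Longrightarrow>
    computes X (Mu f) xs n"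

definition computable_in :: "nat set \<Rightarrow> nat set \<Rightarrow> bool" where
  "computable_in X Y \<longleftrightarrow> (\<exists>p. \<forall>n. computes X p [n] (if n \<in> Y then 1 else 0))"

definition computable_ordinal :: "nat set \<Rightarrow> omega1 \<Rightarrow> bool" where
  "computable_ordinal X \<alpha> \<longleftrightarrow>
    (\<exists>R :: nat rel. computable_in X (prod_encode ` R) \<and> (R, ordinal_rel \<alpha>) \<in> ordIso)"

text \<open>$\omega_1^X$, the least ordinal that is not $X$-computable.\<close>

definition omega1_oracle :: "nat set \<Rightarrow> omega1" where
  "omega1_oracle X = (LEAST \<alpha>. \<not> computable_ordinal X \<alpha>)"


section \<open>Countable structures\<close>

text \<open>
  The symbols of a countable vocabulary are numbered by natural numbers; constants are function
  symbols of arity 0.  Countable structures are taken, up to isomorphism, with a universe that is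
  a nonempty set of natural numbers, so finite structures are included.
\<close>

record vocabulary =
  rel_syms :: "nat set"
  fun_syms :: "nat set"
  rel_arity :: "nat \<Rightarrow> nat"
  fun_arity :: "nat \<Rightarrow> nat"

record struct =
  univ :: "nat set"
  rel_of :: "nat \<Rightarrow> nat list \<Rightarrow> bool"
  fun_of :: "nat \<Rightarrow> nat list \<Rightarrow> nat"

definition tuples :: "struct \<Rightarrow> nat \<Rightarrow> nat list set" where
  "tuples A n = {a. length a = n \<and> set a \<subseteq> univ A}"

definition is_structure :: "vocabulary \<Rightarrow> struct \<Rightarrow> bool" where
  "is_structure L A \<longleftrightarrow> univ A \<noteq> {} \<and>
    (\<forall>f\<in>fun_syms L. \<forall>a\<in>tuples A (fun_arity L f). fun_of A f a \<in> univ A)"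

definition isomorphic :: "vocabulary \<Rightarrow> struct \<Rightarrow> struct \<Rightarrow> bool" where
  "isomorphic L A B \<longleftrightarrow> (\<exists>h. bij_betw h (univ A) (univ B) \<and>
    (\<forall>r\<in>rel_syms L. \<forall>a\<in>tuples A (rel_arity L r). rel_of B r (map h a) \<longleftrightarrow> rel_of A r a) \<and>
    (\<forall>f\<in>fun_syms L. \<forall>a\<in>tuples A (fun_arity L f). fun_of B f (map h a) = h (fun_of A f a)))"

definition copies :: "vocabulary \<Rightarrow> struct \<Rightarrow> struct set" where
  "copies L A = {B. is_structure L B \<and> isomorphic L A B}"

text \<open>The isomorphism types of the members of a class of structures.\<close>

definition iso_types :: "vocabulary \<Rightarrow> struct set \<Rightarrow> struct set set" where
  "iso_types L M = copies L ` M"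

text \<open>The atomic diagram, functions being represented by their graphs.\<close>

definition diagram :: "vocabulary \<Rightarrow> struct \<Rightarrow> nat set" where
  "diagram L A =
     {prod_encode (0, x) | x. x \<in> univ A} \<union>
     {prod_encode (1, prod_encode (r, list_encode a)) | r a.
        r \<in> rel_syms L \<and> a \<in> tuples A (rel_arity L r) \<and> rel_of A r a} \<union>
     {prod_encode (2, prod_encode (f, list_encode (fun_of A f a # a))) | f a.
        f \<in> fun_syms L \<and> a \<in> tuples A (fun_arity L f)}"

definition omega1_struct :: "vocabulary \<Rightarrow> struct \<Rightarrow> omega1" where
  "omega1_struct L A =
     (LEAST \<alpha>. \<exists>X. (\<exists>B\<in>copies L A. computable_in X (diagram L B)) \<and> \<alpha> = omega1_oracle X)"


section \<open>Infinitary logic\<close>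

datatype trm = Var nat | App nat "trm list"

datatype fm =
    FalseF
  | EqF trm trm
  | RelF nat "trm list"
  | NegF fm
  | AndF fm fm
  | OrF fm fm
  | ConjF "nat \<Rightarrow> fm"
  | DisjF "nat \<Rightarrow> fm"
  | AllF nat fm
  | ExF nat fm

fun vars :: "trm \<Rightarrow> nat set" where
  "vars (Var x) = {x}"
| "vars (App f ts) = (\<Union>t\<in>set ts. vars t)"

fun wf_trm :: "vocabulary \<Rightarrow> trm \<Rightarrow> bool" where
  "wf_trm L (Var x) = True"
| "wf_trm L (App f ts) = (f \<in> fun_syms L \<and> length ts = fun_arity L f \<and> (\<forall>t\<in>set ts. wf_trm L t))"

fun val :: "struct \<Rightarrow> (nat \<Rightarrow> nat) \<Rightarrow> trm \<Rightarrow> nat" where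
  "val A e (Var x) = e x"
| "val A e (App f ts) = fun_of A f (map (val A e) ts)"

primrec fvars :: "fm \<Rightarrow> nat set" where
  "fvars FalseF = {}"
| "fvars (EqF s t) = vars s \<union> vars t"
| "fvars (RelF r ts) = (\<Union>t\<in>set ts. vars t)"
| "fvars (NegF p) = fvars p"
| "fvars (AndF p q) = fvars p \<union> fvars q"
| "fvars (OrF p q) = fvars p \<union> fvars q"
| "fvars (ConjF g) = (\<Union>i. fvars (g i))"
| "fvars (DisjF g) = (\<Union>i. fvars (g i))"
| "fvars (AllF x p) = fvars p - {x}"
| "fvars (ExF x p) = fvars p - {x}"

primrec wf_fm :: "vocabulary \<Rightarrow> fm \<Rightarrow> bool" where
  "wf_fm L FalseF = True"
| "wf_fm L (EqF s t) = (wf_trm L s \<and> wf_trm L t)"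
| "wf_fm L (RelF r ts) = (r \<in> rel_syms L \<and> length ts = rel_arity L r \<and> (\<forall>t\<in>set ts. wf_trm L t))"
| "wf_fm L (NegF p) = wf_fm L p"
| "wf_fm L (AndF p q) = (wf_fm L p \<and> wf_fm L q)"
| "wf_fm L (OrF p q) = (wf_fm L p \<and> wf_fm L q)"
| "wf_fm L (ConjF g) = (\<forall>i. wf_fm L (g i))"
| "wf_fm L (DisjF g) = (\<forall>i. wf_fm L (g i))"
| "wf_fm L (AllF x p) = wf_fm L p"
| "wf_fm L (ExF x p) = wf_fm L p"

primrec sat :: "struct \<Rightarrow> (nat \<Rightarrow> nat) \<Rightarrow> fm \<Rightarrow> bool" where
  "sat A e FalseF = False"
| "sat A e (EqF s t) = (val A e s = val A e t)"
| "sat A e (RelF r ts) = rel_of A r (map (val A e) ts)"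
| "sat A e (NegF p) = (\<not> sat A e p)"
| "sat A e (AndF p q) = (sat A e p \<and> sat A e q)"
| "sat A e (OrF p q) = (sat A e p \<or> sat A e q)"
| "sat A e (ConjF g) = (\<forall>i. sat A e (g i))"
| "sat A e (DisjF g) = (\<exists>i. sat A e (g i))"
| "sat A e (AllF x p) = (\<forall>d\<in>univ A. sat A (e(x := d)) p)"
| "sat A e (ExF x p) = (\<exists>d\<in>univ A. sat A (e(x := d)) p)"

text \<open>Formulas of $L_{\omega_1\omega}$ whose free variables are among the first $n$ ones.\<close>

definition formulas :: "vocabulary \<Rightarrow> nat \<Rightarrow> fm set" where
  "formulas L n = {p. wf_fm L p \<and> fvars p \<subseteq> {..<n}}"

abbreviation sentences :: "vocabulary \<Rightarrow> fm set" where
  "sentences L \<equiv> formulas L 0"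

text \<open>
  Only used for formulas whose free variables are below the length of the tuple, so that the
  value of \<^term>\<open>nth a\<close> beyond that length is irrelevant.
\<close>

definition holds :: "struct \<Rightarrow> nat list \<Rightarrow> fm \<Rightarrow> bool" where
  "holds A a p \<longleftrightarrow> sat A (\<lambda>i. a ! i) p"

inductive qfree :: "fm \<Rightarrow> bool" where
  "qfree FalseF"
| "qfree (EqF s t)"
| "qfree (RelF r ts)"
| "qfree p \<Longrightarrow> qfree (NegF p)"
| "qfree p \<Longrightarrow> qfree q \<Longrightarrow> qfree (AndF p q)"
| "qfree p \<Longrightarrow> qfree q \<Longrightarrow> qfree (OrF p q)"

text \<open>
  Disjunctions are indexed by the natural numbers, possibly with repetitions; the empty one is
  represented by \<^term>\<open>DisjF (\<lambda>i. FalseF)\<close>, and dually.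
\<close>

inductive Sigma_in :: "omega1 \<Rightarrow> fm \<Rightarrow> bool" and Pi_in :: "omega1 \<Rightarrow> fm \<Rightarrow> bool" where
  "qfree p \<Longrightarrow> Sigma_in 0 p"
| "qfree p \<Longrightarrow> Pi_in 0 p"
| "(\<And>i. \<beta> i < \<alpha>) \<Longrightarrow> (\<And>i. Pi_in (\<beta> i) (\<psi> i)) \<Longrightarrow>
    Sigma_in \<alpha> (DisjF (\<lambda>i. foldr ExF (xs i) (\<psi> i)))"
| "(\<And>i. \<beta> i < \<alpha>) \<Longrightarrow> (\<And>i. Sigma_in (\<beta> i) (\<psi> i)) \<Longrightarrow>
    Pi_in \<alpha> (ConjF (\<lambda>i. foldr AllF (xs i) (\<psi> i)))"

definition models :: "vocabulary \<Rightarrow> fm \<Rightarrow> struct set" where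
  "models L p = {A. is_structure L A \<and> holds A [] p}"

text \<open>Membership of a sentence in one of the classes is understood up to logical equivalence.\<close>

definition qr :: "vocabulary \<Rightarrow> fm \<Rightarrow> omega1" where
  "qr L S = (LEAST \<beta>. \<exists>S'\<in>sentences L. models L S' = models L S \<and> (Pi_in \<beta> S' \<or> Sigma_in \<beta> S'))"

definition equiv_at :: "vocabulary \<Rightarrow> omega1 \<Rightarrow> struct \<Rightarrow> struct \<Rightarrow> bool" where
  "equiv_at L \<alpha> A B \<longleftrightarrow> (\<forall>p\<in>sentences L. Pi_in \<alpha> p \<longrightarrow> (holds A [] p \<longleftrightarrow> holds B [] p))"

definition scott_sentence :: "vocabulary \<Rightarrow> struct \<Rightarrow> fm \<Rightarrow> bool" where
  "scott_sentence L A S \<longleftrightarrow> S \<in> sentences L \<and> models L S = copies L A"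

definition cSR :: "vocabulary \<Rightarrow> struct \<Rightarrow> omega1" where
  "cSR L A = (LEAST \<alpha>. \<exists>S. scott_sentence L A S \<and> Pi_in (osuc \<alpha>) S)"

definition rho :: "vocabulary \<Rightarrow> struct \<Rightarrow> nat list \<Rightarrow> omega1" where
  "rho L A a = (LEAST \<alpha>. \<forall>b\<in>tuples A (length a).
     (\<forall>p\<in>formulas L (length a). Pi_in \<alpha> p \<and> holds A a p \<longrightarrow> holds A b p) \<longrightarrow>
     (\<forall>p\<in>formulas L (length a). holds A a p \<longrightarrow> holds A b p))"

definition scott_R :: "vocabulary \<Rightarrow> struct \<Rightarrow> omega1" where
  "scott_R L A = (LEAST \<beta>. \<forall>n. \<forall>a\<in>tuples A n. osuc (rho L A a) \<le> \<beta>)"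


section \<open>Minimal counterexamples to Vaught's conjecture\<close>

definition equiv_classes :: "vocabulary \<Rightarrow> fm \<Rightarrow> omega1 \<Rightarrow> struct set set" where
  "equiv_classes L \<phi> \<alpha> = (\<lambda>A. {B \<in> models L \<phi>. equiv_at L \<alpha> A B}) ` models L \<phi>"

definition scattered :: "vocabulary \<Rightarrow> fm \<Rightarrow> bool" where
  "scattered L \<phi> \<longleftrightarrow> (\<forall>\<alpha>. countable (equiv_classes L \<phi> \<alpha>))"

definition Sigma_type :: "vocabulary \<Rightarrow> omega1 \<Rightarrow> struct \<Rightarrow> nat list \<Rightarrow> fm set" where
  "Sigma_type L \<alpha> A a = {p \<in> formulas L (length a). Sigma_in \<alpha> p \<and> holds A a p}"

definition minimal_counterexample :: "vocabulary \<Rightarrow> fm \<Rightarrow> bool" where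
  "minimal_counterexample L \<phi> \<longleftrightarrow>
     \<phi> \<in> sentences L \<and>
     (card_of (iso_types L (models L \<phi>)), cardSuc natLeq) \<in> ordIso \<and>
     scattered L \<phi> \<and>
     (\<forall>\<psi>\<in>sentences L. countable (iso_types L (models L (AndF \<phi> \<psi>))) \<or>
                       countable (iso_types L (models L (AndF \<phi> (NegF \<psi>))))) \<and>
     (\<forall>\<alpha>. countable {Sigma_type L \<alpha> A a | A a n. A \<in> models L \<phi> \<and> a \<in> tuples A n})"

text \<open>The unique equivalence class that is uncountable up to isomorphism.\<close>

definition big_class :: "vocabulary \<Rightarrow> fm \<Rightarrow> omega1 \<Rightarrow> struct set" where
  "big_class L \<phi> \<beta> = (THE C. C \<in> equiv_classes L \<phi> \<beta> \<and> \<not> countable (iso_types L C))"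

text \<open>The label is determined only up to isomorphism.\<close>

definition label :: "vocabulary \<Rightarrow> fm \<Rightarrow> omega1 \<Rightarrow> struct" where
  "label L \<phi> \<beta> = (SOME K. K \<in> big_class L \<phi> \<beta> \<and> (\<forall>M\<in>big_class L \<phi> \<beta>. cSR L K \<le> cSR L M))"

definition f_bound :: "vocabulary \<Rightarrow> fm \<Rightarrow> omega1 \<Rightarrow> omega1" where
  "f_bound L \<phi> \<alpha> = (LEAST \<beta>. \<forall>M\<in>models L \<phi>. M \<notin> big_class L \<phi> \<alpha> \<longrightarrow> cSR L M < \<beta>)"

definition Fset :: "vocabulary \<Rightarrow> fm \<Rightarrow> omega1 set" where
  "Fset L \<phi> = {\<alpha>. f_bound L \<phi> \<alpha> \<le> \<alpha>}"

definition W :: "vocabulary \<Rightarrow> fm \<Rightarrow> omega1 \<Rightarrow> struct set" where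
  "W L \<phi> l = {A \<in> models L \<phi>. omega1_struct L A = l \<and> l \<le> cSR L A}"

definition HIGH :: "vocabulary \<Rightarrow> fm \<Rightarrow> omega1 \<Rightarrow> struct set" where
  "HIGH L \<phi> l = {A \<in> models L \<phi>. osuc l \<le> cSR L A}"

end

theory Submission
  imports Defs
begin

text \<open>
  Two facts carry the proof.  First, \<open>cSR(A) \<le> \<omega>\<^sub>1\<^sup>A + 1\<close>: if two tuples agree on all \<open>\<Pi>\<^sub>\<alpha>\<close> formulas,
  \<open>\<alpha> < \<omega>\<^sub>1\<^sup>X\<close>, then the \<open>X\<close>-computable tree of attempts to build an automorphism between them has
  rank at least \<open>\<omega>\<^sub>1\<^sup>X\<close>, and so its Kleene-Brouwer ordering cannot be a well-ordering; hence such
  tuples are conjugate.  Secondly, a class of pairwise \<open>\<equiv>\<^sub>\<beta>\<close> structures with countably many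
  \<open>\<Sigma>\<^sub>\<beta>\<close> types that is axiomatised by a \<open>\<Pi>\<^sub>\<beta>\<^sub>+\<^sub>1\<close> sentence has a member, obtained by forcing with
  tuples of some member, in which every type is isolated.  Such an atomic structure has a
  \<open>\<Pi>\<^sub>\<beta>\<^sub>+\<^sub>1\<close> Scott sentence, and two atomic \<open>\<equiv>\<^sub>\<beta>\<close> structures are isomorphic.  Applied to the copies of
  one structure, this gives the uniqueness of the label; applied to \<open>\<C>\<^sub>\<lambda>\<^sub>+\<^sub>1\<close>, it gives its rank.
\<close>

section \<open>Countable ordinals\<close>

text \<open>The set \<open>Fset\<close> enters through one consequence: at a level in it, every
  model whose rank reaches that level lies in the uncountable class of the level. Conversely the
  members of the class of \<open>\<alpha>\<close> have rank at least \<open>\<alpha>\<close>, since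
  a simpler Scott sentence would be shared by all of them. Forcing is tied to \<Pi> sentences one
  level above \<open>\<beta>\<close> because their conjuncts are
  \<open>\<Sigma>\<^sub>\<beta>\<close>: a witness is then subject to a formula of level below
  \<open>\<beta>\<close>, which a condition can guarantee. An uncountable class has such an axiom
  because there are only countably many other classes, each separated from it by a single sentence
  of level \<open>\<beta>\<close>. Conditions carry levels from 3 on: the search for a witness
  descends two levels and must end at a positive one, since the back step forms infinite
  conjunctions. This is the origin of \<open>osuc (osuc (osuc 0))\<close>. Names of bound variables
  would obstruct such arguments, so definability is studied through predicates of tuples, on which
  the classes of formulas have the expected closure properties.\<close>

lemma countable_imp_bounded_omega1:
  assumes "countable (S :: omega1 set)"
  shows "\<exists>\<beta>. \<forall>\<alpha>\<in>S. \<alpha> < \<beta>"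
proof (rule ccontr)
  assume "\<nexists>\<beta>. \<forall>\<alpha>\<in>S. \<alpha> < \<beta>"
  then have "\<forall>\<beta>. \<exists>\<alpha>\<in>S. \<beta> \<le> \<alpha>" by (meson not_less)
  then have "UNIV \<subseteq> (\<Union>\<alpha>\<in>S. insert \<alpha> {\<beta>. \<beta> < \<alpha>})"
    by (auto simp: le_less)
  moreover have "countable (\<Union>\<alpha>\<in>S. insert \<alpha> {\<beta>. \<beta> < \<alpha>})"
    using assms countable_below_omega1 by auto
  ultimately show False
    using uncountable_omega1 countable_subset by blast
qed

lemma less_osuc [simp]: "\<alpha> < osuc \<alpha>"
proof -
  obtain \<beta> where "\<alpha> < \<beta>" using countable_imp_bounded_omega1[of "{\<alpha>}"] by auto
  then show ?thesis unfolding osuc_def by (rule LeastI)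
qed

lemma osuc_least: "\<alpha> < \<beta> \<Longrightarrow> osuc \<alpha> \<le> \<beta>"
  unfolding osuc_def by (rule Least_le)

lemma osuc_le_iff [simp]: "osuc \<alpha> \<le> \<beta> \<longleftrightarrow> \<alpha> < \<beta>"
  using less_osuc osuc_least by (meson less_le_trans)

lemma less_osuc_iff [simp]: "\<beta> < osuc \<alpha> \<longleftrightarrow> \<beta> \<le> \<alpha>"
  using osuc_le_iff by (meson not_less)

lemma zero_le_omega1 [simp]: "(0::omega1) \<le> \<alpha>"
  unfolding zero_omega1_def by (rule Least_le) simp

lemma not_less_zero_omega1 [simp]: "\<not> \<alpha> < (0::omega1)"
  by (simp add: not_less)

lemma zero_less_iff_omega1: "0 < \<alpha> \<longleftrightarrow> \<alpha> \<noteq> (0::omega1)"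
  by (metis le_less not_less_zero_omega1 zero_le_omega1)

lemma zero_less_osuc [simp]: "0 < osuc \<alpha>"
  by (meson less_osuc le_less_trans zero_le_omega1)

lemma limit_ordinal_osuc_less: "limit_ordinal l \<Longrightarrow> \<beta> < l \<Longrightarrow> osuc \<beta> < l"
  by (simp add: limit_ordinal_def)

lemma limit_ordinal_pos: "limit_ordinal l \<Longrightarrow> 0 < l"
  by (simp add: limit_ordinal_def zero_less_iff_omega1)

section \<open>Syntax: the \<Sigma>/\<Pi> hierarchy, first as expressions, then as predicates of
  tuples\<close>

section \<open>Renaming and dualising formulas\<close>

primrec ren_trm :: "(nat \<Rightarrow> nat) \<Rightarrow> trm \<Rightarrow> trm" where
  "ren_trm g (Var x) = Var (g x)"
| "ren_trm g (App f ts) = App f (map (ren_trm g) ts)"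

primrec ren :: "(nat \<Rightarrow> nat) \<Rightarrow> fm \<Rightarrow> fm" where
  "ren g FalseF = FalseF"
| "ren g (EqF s t) = EqF (ren_trm g s) (ren_trm g t)"
| "ren g (RelF r ts) = RelF r (map (ren_trm g) ts)"
| "ren g (NegF p) = NegF (ren g p)"
| "ren g (AndF p q) = AndF (ren g p) (ren g q)"
| "ren g (OrF p q) = OrF (ren g p) (ren g q)"
| "ren g (ConjF h) = ConjF (\<lambda>i. ren g (h i))"
| "ren g (DisjF h) = DisjF (\<lambda>i. ren g (h i))"
| "ren g (AllF x p) = AllF (g x) (ren g p)"
| "ren g (ExF x p) = ExF (g x) (ren g p)"

text \<open>Negation pushed inside. At positive levels neither \<open>Sigma_in\<close> nor
  \<open>Pi_in\<close> has a rule for \<open>NegF\<close>, so prefixing it would leave the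
  hierarchy, whereas \<open>dual\<close> exchanges its two sides.\<close>

primrec dual :: "fm \<Rightarrow> fm" where
  "dual FalseF = NegF FalseF"
| "dual (EqF s t) = NegF (EqF s t)"
| "dual (RelF r ts) = NegF (RelF r ts)"
| "dual (NegF p) = p"
| "dual (AndF p q) = OrF (dual p) (dual q)"
| "dual (OrF p q) = AndF (dual p) (dual q)"
| "dual (ConjF h) = DisjF (\<lambda>i. dual (h i))"
| "dual (DisjF h) = ConjF (\<lambda>i. dual (h i))"
| "dual (AllF x p) = ExF x (dual p)"
| "dual (ExF x p) = AllF x (dual p)"

lemma val_ren: "val A e (ren_trm g t) = val A (e \<circ> g) t"
  by (induction t) (auto simp: comp_def cong: map_cong)

lemma vars_ren: "vars (ren_trm g t) = g ` vars t"
  by (induction t) auto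

lemma wf_trm_ren: "wf_trm L (ren_trm g t) = wf_trm L t"
  by (induction t) auto

lemma fun_upd_comp_inj: "inj g \<Longrightarrow> e(g x := d) \<circ> g = (e \<circ> g)(x := d)"
  by (auto simp: fun_eq_iff inj_def)

text \<open>Bound variables are renamed along with free ones, so injectivity is what excludes
  capture. For quantifier-free formulas \<open>sat_ren_qfree\<close> does without it, and this is
  the case in which two positions may be identified.\<close>

lemma sat_ren: "inj g \<Longrightarrow> sat A e (ren g p) = sat A (e \<circ> g) p"
  by (induction p arbitrary: e)
    (simp_all add: val_ren fun_upd_comp_inj comp_def[of "val A e" for A e] del: fun_upd_apply)

lemma sat_ren_qfree: "qfree p \<Longrightarrow> sat A e (ren g p) = sat A (e \<circ> g) p"
  by (induction rule: qfree.induct) (simp_all add: val_ren comp_def)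

lemma fvars_ren: "inj g \<Longrightarrow> fvars (ren g p) = g ` fvars p"
  by (induction p) (auto simp: vars_ren inj_def)

lemma fvars_ren_qfree: "qfree p \<Longrightarrow> fvars (ren g p) = g ` fvars p"
  by (induction rule: qfree.induct) (auto simp: vars_ren)

lemma wf_ren: "wf_fm L (ren g p) = wf_fm L p"
  by (induction p) (auto simp: wf_trm_ren)

lemma qfree_ren: "qfree p \<Longrightarrow> qfree (ren g p)"
  by (induction rule: qfree.induct) (auto intro: qfree.intros)

lemma ren_foldr_ExF: "ren g (foldr ExF xs p) = foldr ExF (map g xs) (ren g p)"
  by (induction xs) auto

lemma ren_foldr_AllF: "ren g (foldr AllF xs p) = foldr AllF (map g xs) (ren g p)"
  by (induction xs) auto

lemma Sigma_Pi_in_ren: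
  "Sigma_in \<alpha> p \<Longrightarrow> Sigma_in \<alpha> (ren g p)" "Pi_in \<alpha> p \<Longrightarrow> Pi_in \<alpha> (ren g p)"
proof (induction rule: Sigma_in_Pi_in.inducts)
  case (3 \<beta> \<alpha> \<psi> xs)
  show ?case unfolding ren.simps ren_foldr_ExF
    by (rule Sigma_in_Pi_in.intros(3)[where \<beta> = \<beta>]) (use 3 in auto)
next
  case (4 \<beta> \<alpha> \<psi> xs)
  show ?case unfolding ren.simps ren_foldr_AllF
    by (rule Sigma_in_Pi_in.intros(4)[where \<beta> = \<beta>]) (use 4 in auto)
qed (auto intro: Sigma_in_Pi_in.intros qfree_ren)

lemma dual_foldr_ExF: "dual (foldr ExF xs p) = foldr AllF xs (dual p)"
  by (induction xs) auto

lemma dual_foldr_AllF: "dual (foldr AllF xs p) = foldr ExF xs (dual p)"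
  by (induction xs) auto

lemma qfree_dual: "qfree p \<Longrightarrow> qfree (dual p)"
  by (induction rule: qfree.induct) (auto intro: qfree.intros)

lemma Sigma_Pi_in_dual:
  "Sigma_in \<alpha> p \<Longrightarrow> Pi_in \<alpha> (dual p)" "Pi_in \<alpha> p \<Longrightarrow> Sigma_in \<alpha> (dual p)"
proof (induction rule: Sigma_in_Pi_in.inducts)
  case (3 \<beta> \<alpha> \<psi> xs)
  show ?case unfolding dual.simps dual_foldr_ExF
    by (rule Sigma_in_Pi_in.intros(4)[where \<beta> = \<beta>]) (use 3 in auto)
next
  case (4 \<beta> \<alpha> \<psi> xs)
  show ?case unfolding dual.simps dual_foldr_AllF
    by (rule Sigma_in_Pi_in.intros(3)[where \<beta> = \<beta>]) (use 4 in auto)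
qed (auto intro: Sigma_in_Pi_in.intros qfree_dual)

lemma sat_dual: "sat A e (dual p) \<longleftrightarrow> \<not> sat A e p"
  by (induction p arbitrary: e) auto

lemma fvars_dual: "fvars (dual p) = fvars p"
  by (induction p) auto

lemma wf_dual: "wf_fm L (dual p) = wf_fm L p"
  by (induction p) auto

lemma val_cong: "(\<And>x. x \<in> vars t \<Longrightarrow> e x = e' x) \<Longrightarrow> val A e t = val A e' t"
proof (induction t)
  case (App f ts)
  have "map (val A e) ts = map (val A e') ts"
    by (rule map_cong) (use App in auto)
  then show ?case by (simp only: val.simps)
qed simp

lemma sat_cong: "(\<And>x. x \<in> fvars p \<Longrightarrow> e x = e' x) \<Longrightarrow> sat A e p = sat A e' p"
proof (induction p arbitrary: e e')
  case (EqF s t)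
  have "val A e s = val A e' s"
    by (rule val_cong) (use EqF.prems in auto)
  moreover have "val A e t = val A e' t"
    by (rule val_cong) (use EqF.prems in auto)
  ultimately show ?case by simp
next
  case (RelF r ts)
  have "map (val A e) ts = map (val A e') ts"
    by (rule map_cong[OF refl], rule val_cong) (use RelF in auto)
  then show ?case by (simp only: sat.simps)
next
  case (AllF x p)
  have "sat A (e(x := d)) p = sat A (e'(x := d)) p" for d
    by (rule AllF.IH) (use AllF.prems in auto)
  then show ?case by simp
next
  case (ExF x p)
  have "sat A (e(x := d)) p = sat A (e'(x := d)) p" for d
    by (rule ExF.IH) (use ExF.prems in auto)
  then show ?case by simp
next
  case (NegF p)
  have "sat A e p = sat A e' p"
    by (rule NegF.IH) (use NegF.prems in auto)
  then show ?case by simp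
next
  case (AndF p q)
  have "sat A e p = sat A e' p"
    by (rule AndF.IH(1)) (use AndF.prems in auto)
  moreover have "sat A e q = sat A e' q"
    by (rule AndF.IH(2)) (use AndF.prems in auto)
  ultimately show ?case by simp
next
  case (OrF p q)
  have "sat A e p = sat A e' p"
    by (rule OrF.IH(1)) (use OrF.prems in auto)
  moreover have "sat A e q = sat A e' q"
    by (rule OrF.IH(2)) (use OrF.prems in auto)
  ultimately show ?case by simp
next
  case (ConjF h)
  have "sat A e (h i) = sat A e' (h i)" for i
    by (rule ConjF.IH) (use ConjF.prems in auto)
  then show ?case by simp
next
  case (DisjF h)
  have "sat A e (h i) = sat A e' (h i)" for i
    by (rule DisjF.IH) (use DisjF.prems in auto)
  then show ?case by simp
qed simp_all

lemma fvars_foldr_ExF: "fvars (foldr ExF xs p) = fvars p - set xs"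
  by (induction xs) auto

lemma wf_foldr_ExF: "wf_fm L (foldr ExF xs p) = wf_fm L p"
  by (induction xs) auto

text \<open>A single assignment stands for the whole block. Repetitions in \<open>xs\<close> do no
  harm: the innermost quantifier decides the value, and only \<open>set xs\<close> is visible on the
  right.\<close>

lemma sat_foldr_ExF:
  "sat A e (foldr ExF xs p) \<longleftrightarrow>
    (\<exists>e'. (\<forall>x. x \<notin> set xs \<longrightarrow> e' x = e x) \<and> (\<forall>x\<in>set xs. e' x \<in> univ A) \<and> sat A e' p)"
proof (induction xs arbitrary: e)
  case Nil
  show ?case
  proof
    assume "sat A e (foldr ExF [] p)"
    then show "\<exists>e'. (\<forall>x. x \<notin> set [] \<longrightarrow> e' x = e x) \<and> (\<forall>x\<in>set []. e' x \<in> univ A) \<and> sat A e' p"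
      by (intro exI[of _ e]) simp
  next
    assume "\<exists>e'. (\<forall>x. x \<notin> set [] \<longrightarrow> e' x = e x) \<and> (\<forall>x\<in>set []. e' x \<in> univ A) \<and> sat A e' p"
    then obtain e' where "\<forall>x. e' x = e x" "sat A e' p" by auto
    then show "sat A e (foldr ExF [] p)" using sat_cong[of p e e'] by simp
  qed
next
  case (Cons y ys)
  show ?case
  proof
    assume "sat A e (foldr ExF (y # ys) p)"
    then obtain d e' where d: "d \<in> univ A" and e': "\<forall>x. x \<notin> set ys \<longrightarrow> e' x = (e(y := d)) x"
      "\<forall>x\<in>set ys. e' x \<in> univ A" "sat A e' p"
      by (auto simp: Cons.IH)
    then show "\<exists>e'. (\<forall>x. x \<notin> set (y # ys) \<longrightarrow> e' x = e x) \<and> (\<forall>x\<in>set (y # ys). e' x \<in> univ A) \<and> sat A e' p"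
      by (intro exI[of _ e']) (cases "y \<in> set ys"; auto)
  next
    assume "\<exists>e'. (\<forall>x. x \<notin> set (y # ys) \<longrightarrow> e' x = e x) \<and> (\<forall>x\<in>set (y # ys). e' x \<in> univ A) \<and> sat A e' p"
    then obtain e' where e': "\<forall>x. x \<notin> set (y # ys) \<longrightarrow> e' x = e x"
      "\<forall>x\<in>set (y # ys). e' x \<in> univ A" "sat A e' p" by blast
    have "sat A (e(y := e' y)) (foldr ExF ys p)"
      unfolding Cons.IH by (rule exI[of _ e']) (use e' in auto)
    then show "sat A e (foldr ExF (y # ys) p)" using e'(2) by auto
  qed
qed

section \<open>Definable predicates of tuples\<close>

type_synonym tuple_pred = "struct \<Rightarrow> nat list \<Rightarrow> bool"

text \<open>One formula has to work uniformly in all structures. Passing to predicates forgets the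
  names of variables: quantification becomes appending a tuple, substitution becomes selecting
  positions.\<close>

definition defS :: "vocabulary \<Rightarrow> omega1 \<Rightarrow> nat \<Rightarrow> tuple_pred \<Rightarrow> bool" where
  "defS L \<alpha> n P \<longleftrightarrow> (\<exists>p\<in>formulas L n. Sigma_in \<alpha> p \<and>
     (\<forall>A. is_structure L A \<longrightarrow> (\<forall>a\<in>tuples A n. holds A a p \<longleftrightarrow> P A a)))"

definition defP :: "vocabulary \<Rightarrow> omega1 \<Rightarrow> nat \<Rightarrow> tuple_pred \<Rightarrow> bool" where
  "defP L \<alpha> n P \<longleftrightarrow> (\<exists>p\<in>formulas L n. Pi_in \<alpha> p \<and>
     (\<forall>A. is_structure L A \<longrightarrow> (\<forall>a\<in>tuples A n. holds A a p \<longleftrightarrow> P A a)))"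

lemma defS_neg: "defS L \<alpha> n (\<lambda>A a. \<not> P A a) \<longleftrightarrow> defP L \<alpha> n P" (is "?l \<longleftrightarrow> ?r")
proof
  assume ?l
  then obtain p where "p \<in> formulas L n" "Sigma_in \<alpha> p"
    "\<forall>A. is_structure L A \<longrightarrow> (\<forall>a\<in>tuples A n. holds A a p \<longleftrightarrow> \<not> P A a)"
    unfolding defS_def by blast
  then show ?r unfolding defP_def
    by (intro bexI[of _ "dual p"])
      (auto simp: formulas_def fvars_dual wf_dual holds_def sat_dual Sigma_Pi_in_dual)
next
  assume ?r
  then obtain p where "p \<in> formulas L n" "Pi_in \<alpha> p"
    "\<forall>A. is_structure L A \<longrightarrow> (\<forall>a\<in>tuples A n. holds A a p \<longleftrightarrow> P A a)"
    unfolding defP_def by blast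
  then show ?l unfolding defS_def
    by (intro bexI[of _ "dual p"])
      (auto simp: formulas_def fvars_dual wf_dual holds_def sat_dual Sigma_Pi_in_dual)
qed

lemma defP_neg: "defP L \<alpha> n (\<lambda>A a. \<not> P A a) \<longleftrightarrow> defS L \<alpha> n P"
  using defS_neg[of L \<alpha> n "\<lambda>A a. \<not> P A a"] by simp

lemma defS_cong:
  assumes "\<And>A a. is_structure L A \<Longrightarrow> a \<in> tuples A n \<Longrightarrow> P A a \<longleftrightarrow> Q A a"
  shows "defS L \<alpha> n P \<longleftrightarrow> defS L \<alpha> n Q"
  unfolding defS_def using assms by (intro bex_cong refl conj_cong) (auto; blast)

lemma defP_cong:
  assumes "\<And>A a. is_structure L A \<Longrightarrow> a \<in> tuples A n \<Longrightarrow> P A a \<longleftrightarrow> Q A a"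
  shows "defP L \<alpha> n P \<longleftrightarrow> defP L \<alpha> n Q"
  unfolding defP_def using assms by (intro bex_cong refl conj_cong) (auto; blast)

lemma defS_congI:
  assumes "defS L \<alpha> n P" "\<And>A a. is_structure L A \<Longrightarrow> a \<in> tuples A n \<Longrightarrow> P A a \<longleftrightarrow> Q A a"
  shows "defS L \<alpha> n Q"
  using assms(1) defS_cong[of L n P Q \<alpha>, OF assms(2)] by blast

lemma defP_congI:
  assumes "defP L \<alpha> n P" "\<And>A a. is_structure L A \<Longrightarrow> a \<in> tuples A n \<Longrightarrow> P A a \<longleftrightarrow> Q A a"
  shows "defP L \<alpha> n Q"
  using assms(1) defP_cong[of L n P Q \<alpha>, OF assms(2)] by blast

lemma tuples_appendI: "a \<in> tuples A n \<Longrightarrow> c \<in> tuples A m \<Longrightarrow> a @ c \<in> tuples A (n + m)"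
  by (auto simp: tuples_def)

lemma tuples_length: "a \<in> tuples A n \<Longrightarrow> length a = n"
  by (simp add: tuples_def)

lemma tuples_nth: "a \<in> tuples A n \<Longrightarrow> i < n \<Longrightarrow> a ! i \<in> univ A"
  by (auto simp: tuples_def)

lemma tuples_map_nth:
  "a \<in> tuples A n \<Longrightarrow> (\<And>i. i \<in> set is \<Longrightarrow> i < n) \<Longrightarrow> map ((!) a) is \<in> tuples A (length is)"
  by (auto simp: tuples_def)

lemma Sigma_in_pos_cases:
  assumes "Sigma_in \<alpha> p" "0 < \<alpha>"
  obtains \<beta> xs \<psi> where "p = DisjF (\<lambda>i. foldr ExF (xs i) (\<psi> i))" "\<And>i::nat. \<beta> i < \<alpha>"
    "\<And>i. Pi_in (\<beta> i) (\<psi> i)"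
  using assms by (cases rule: Sigma_in.cases) auto

text \<open>Together with \<open>defS_compose\<close> this is the normal form used in place of
  syntax from here on. The difficulty is that a block may bind variables below \<open>n\<close> and
  may bind a variable twice; a renaming moves bound variables into the range from \<open>n\<close>
  on before the block is read as an appended tuple.\<close>

lemma defS_decompose:
  assumes "defS L \<alpha> n P" "0 < \<alpha>"
  shows "\<exists>m \<beta> Q. (\<forall>i::nat. \<beta> i < \<alpha> \<and> defP L (\<beta> i) (n + m i) (Q i)) \<and>
    (\<forall>A. is_structure L A \<longrightarrow> (\<forall>a\<in>tuples A n. P A a \<longleftrightarrow> (\<exists>i. \<exists>c\<in>tuples A (m i). Q i A (a @ c))))"
proof -
  obtain p where p: "p \<in> formulas L n" "Sigma_in \<alpha> p"
    and eq: "\<And>A a. is_structure L A \<Longrightarrow> a \<in> tuples A n \<Longrightarrow> holds A a p \<longleftrightarrow> P A a"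
    using assms(1) unfolding defS_def by blast
  obtain \<beta> xs \<psi> where pd: "p = DisjF (\<lambda>i. foldr ExF (xs i) (\<psi> i))" and \<beta>: "\<And>i::nat. \<beta> i < \<alpha>"
    and \<psi>: "\<And>i. Pi_in (\<beta> i) (\<psi> i)"
    using Sigma_in_pos_cases[OF p(2) assms(2)] by metis
  define m where "m i = Suc (sum_list (xs i))" for i
  define g where "g i x = (if x < n \<and> x \<notin> set (xs i) then x else n + x)" for i x
  have inj: "inj (g i)" for i
    by (auto simp: inj_def g_def)
  have mlt: "x < m i" if "x \<in> set (xs i)" for x i
    using that by (simp add: m_def member_le_sum_list less_Suc_eq_le)
  have fv: "fvars (\<psi> i) \<subseteq> {..<n} \<union> set (xs i)" for i
    using p(1) by (auto simp: pd formulas_def fvars_foldr_ExF)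
  have wf: "wf_fm L (\<psi> i)" for i
    using p(1) by (auto simp: pd formulas_def wf_foldr_ExF)
  have fm: "ren (g i) (\<psi> i) \<in> formulas L (n + m i)" for i
    using fv[of i] wf[of i] mlt[of _ i] by (auto simp: formulas_def wf_ren fvars_ren[OF inj] g_def)
  have main: "P A a \<longleftrightarrow> (\<exists>i. \<exists>c\<in>tuples A (m i). holds A (a @ c) (ren (g i) (\<psi> i)))"
    if A: "is_structure L A" and a: "a \<in> tuples A n" for A a
  proof -
    \<comment> \<open>Positions of the appended tuple which no quantifier binds are padded with
      \<open>u\<close>; this uses that universes are nonempty.\<close>
    obtain u where u: "u \<in> univ A" using A by (auto simp: is_structure_def)
    have len: "length a = n" using a by (simp add: tuples_def)
    have "sat A ((!) a) (foldr ExF (xs i) (\<psi> i)) \<longleftrightarrow>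
      (\<exists>c\<in>tuples A (m i). sat A ((!) (a @ c) \<circ> g i) (\<psi> i))" (is "?l \<longleftrightarrow> ?r") for i
    proof
      assume ?l
      then obtain e' where e': "\<forall>x. x \<notin> set (xs i) \<longrightarrow> e' x = a ! x"
        "\<forall>x\<in>set (xs i). e' x \<in> univ A" "sat A e' (\<psi> i)" unfolding sat_foldr_ExF by blast
      define c where "c = map (\<lambda>x. if x \<in> set (xs i) then e' x else u) [0..<m i]"
      have "c \<in> tuples A (m i)" using e'(2) u by (auto simp: c_def tuples_def)
      moreover have "sat A ((!) (a @ c) \<circ> g i) (\<psi> i)"
      proof (rule iffD1[OF sat_cong e'(3)])
        fix x assume "x \<in> fvars (\<psi> i)"
        then show "e' x = ((!) (a @ c) \<circ> g i) x"
          using fv[of i] e'(1) mlt[of x i] len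
          by (cases "x \<in> set (xs i)") (auto simp: c_def g_def nth_append)
      qed
      ultimately show ?r by blast
    next
      assume ?r
      then obtain c where c: "c \<in> tuples A (m i)" "sat A ((!) (a @ c) \<circ> g i) (\<psi> i)" by blast
      define e' where "e' x = (if x \<in> set (xs i) then c ! x else a ! x)" for x
      have "sat A e' (\<psi> i)"
      proof (rule iffD1[OF sat_cong c(2)])
        fix x assume "x \<in> fvars (\<psi> i)"
        then show "((!) (a @ c) \<circ> g i) x = e' x"
          using fv[of i] len by (auto simp: e'_def g_def nth_append)
      qed
      moreover have "\<forall>x\<in>set (xs i). e' x \<in> univ A"
        using c(1) mlt[of _ i] by (auto simp: e'_def tuples_nth)
      ultimately show ?l unfolding sat_foldr_ExF by (intro exI[of _ e']) (auto simp: e'_def)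
    qed
    then have "holds A a p \<longleftrightarrow> (\<exists>i. \<exists>c\<in>tuples A (m i). holds A (a @ c) (ren (g i) (\<psi> i)))"
      by (simp add: pd holds_def sat_ren[OF inj])
    then show ?thesis using eq[OF A a] by simp
  qed
  have dP: "defP L (\<beta> i) (n + m i) (\<lambda>A a. holds A a (ren (g i) (\<psi> i)))" for i
    unfolding defP_def by (rule bexI[OF _ fm]) (simp add: Sigma_Pi_in_ren(2)[OF \<psi>])
  show ?thesis
    by (rule exI[of _ m], rule exI[of _ \<beta>], rule exI[of _ "\<lambda>i A a. holds A a (ren (g i) (\<psi> i))"])
      (intro conjI allI impI ballI \<beta> dP main)
qed

lemma defS_compose:
  assumes Q: "\<And>i::nat. \<beta> i < \<alpha>" "\<And>i. defP L (\<beta> i) (n + m i) (Q i)"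
    and P: "\<And>A a. is_structure L A \<Longrightarrow> a \<in> tuples A n \<Longrightarrow>
      P A a \<longleftrightarrow> (\<exists>i. \<exists>c\<in>tuples A (m i). Q i A (a @ c))"
  shows "defS L \<alpha> n P"
proof -
  obtain q where q: "\<And>i. q i \<in> formulas L (n + m i)" "\<And>i. Pi_in (\<beta> i) (q i)"
    and eq: "\<And>i A a. is_structure L A \<Longrightarrow> a \<in> tuples A (n + m i) \<Longrightarrow> holds A a (q i) \<longleftrightarrow> Q i A a"
    using Q(2) unfolding defP_def by metis
  define p where "p = DisjF (\<lambda>i. foldr ExF [n..<n + m i] (q i))"
  have "Sigma_in \<alpha> p" unfolding p_def using Q(1) q(2) by (rule Sigma_in_Pi_in.intros(3))
  moreover have "p \<in> formulas L n"
    using q(1) by (force simp: p_def formulas_def fvars_foldr_ExF wf_foldr_ExF)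
  moreover have "holds A a p \<longleftrightarrow> P A a" if A: "is_structure L A" and a: "a \<in> tuples A n" for A a
  proof -
    have len: "length a = n" using a by (simp add: tuples_def)
    have "sat A ((!) a) (foldr ExF [n..<n + m i] (q i)) \<longleftrightarrow> (\<exists>c\<in>tuples A (m i). holds A (a @ c) (q i))"
      (is "?l \<longleftrightarrow> ?r") for i
    proof
      assume ?l
      then obtain e' where e': "\<forall>x. x \<notin> {n..<n + m i} \<longrightarrow> e' x = a ! x"
        "\<forall>x\<in>{n..<n + m i}. e' x \<in> univ A" "sat A e' (q i)" unfolding sat_foldr_ExF by auto
      define c where "c = map e' [n..<n + m i]"
      have "c \<in> tuples A (m i)" using e'(2) by (auto simp: c_def tuples_def)
      moreover have "sat A ((!) (a @ c)) (q i)"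
      proof (rule iffD1[OF sat_cong e'(3)])
        fix x assume "x \<in> fvars (q i)"
        then have "x < n + m i" using q(1)[of i] by (auto simp: formulas_def)
        then show "e' x = (a @ c) ! x" using len e'(1) by (auto simp: c_def nth_append)
      qed
      ultimately show ?r by (auto simp: holds_def)
    next
      assume ?r
      then obtain c where c: "c \<in> tuples A (m i)" "sat A ((!) (a @ c)) (q i)" by (auto simp: holds_def)
      define e' where "e' x = (if n \<le> x \<and> x < n + m i then c ! (x - n) else a ! x)" for x
      have "sat A e' (q i)"
      proof (rule iffD1[OF sat_cong c(2)])
        fix x assume "x \<in> fvars (q i)"
        then have "x < n + m i" using q(1)[of i] by (auto simp: formulas_def)
        then show "(a @ c) ! x = e' x" using len by (auto simp: e'_def nth_append)
      qed
      then show ?l unfolding sat_foldr_ExF using c(1)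
        by (intro exI[of _ e']) (auto simp: e'_def tuples_nth)
    qed
    then have "holds A a p \<longleftrightarrow> (\<exists>i. \<exists>c\<in>tuples A (m i). holds A (a @ c) (q i))"
      by (simp add: p_def holds_def)
    also have "\<dots> \<longleftrightarrow> (\<exists>i. \<exists>c\<in>tuples A (m i). Q i A (a @ c))"
      using eq[OF A] a by (auto simp: tuples_appendI)
    finally show ?thesis using P[OF A a] by simp
  qed
  ultimately show ?thesis unfolding defS_def by blast
qed

lemma defP_decompose:
  assumes "defP L \<alpha> n P" "0 < \<alpha>"
  shows "\<exists>m \<beta> Q. (\<forall>i::nat. \<beta> i < \<alpha> \<and> defS L (\<beta> i) (n + m i) (Q i)) \<and>
    (\<forall>A. is_structure L A \<longrightarrow> (\<forall>a\<in>tuples A n. P A a \<longleftrightarrow> (\<forall>i. \<forall>c\<in>tuples A (m i). Q i A (a @ c))))"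
proof -
  have "defS L \<alpha> n (\<lambda>A a. \<not> P A a)" using assms(1) by (simp add: defS_neg)
  from defS_decompose[OF this assms(2)] obtain m \<beta> Q where
    *: "\<forall>i::nat. \<beta> i < \<alpha> \<and> defP L (\<beta> i) (n + m i) (Q i)"
    "\<forall>A. is_structure L A \<longrightarrow> (\<forall>a\<in>tuples A n. \<not> P A a \<longleftrightarrow> (\<exists>i. \<exists>c\<in>tuples A (m i). Q i A (a @ c)))"
    by blast
  show ?thesis
    by (rule exI[of _ m], rule exI[of _ \<beta>], rule exI[of _ "\<lambda>i A a. \<not> Q i A a"])
      (use * in \<open>simp add: defS_neg; blast\<close>)
qed

lemma defP_compose:
  assumes "\<And>i::nat. \<beta> i < \<alpha>" "\<And>i. defS L (\<beta> i) (n + m i) (Q i)"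
    and "\<And>A a. is_structure L A \<Longrightarrow> a \<in> tuples A n \<Longrightarrow>
      P A a \<longleftrightarrow> (\<forall>i. \<forall>c\<in>tuples A (m i). Q i A (a @ c))"
  shows "defP L \<alpha> n P"
proof -
  have "defS L \<alpha> n (\<lambda>A a. \<not> P A a)"
    by (rule defS_compose[where \<beta> = \<beta> and m = m and Q = "\<lambda>i A a. \<not> Q i A a"])
      (use assms in \<open>auto simp: defP_neg\<close>)
  then show ?thesis by (simp add: defS_neg)
qed

lemma Sigma_in_0: "Sigma_in 0 p \<longleftrightarrow> qfree p"
  by (auto elim: Sigma_in.cases intro: Sigma_in_Pi_in.intros)

lemma Pi_in_0: "Pi_in 0 p \<longleftrightarrow> qfree p"
  by (auto elim: Pi_in.cases intro: Sigma_in_Pi_in.intros)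

lemma defP_0: "defP L 0 n P \<longleftrightarrow> defS L 0 n P"
  by (simp add: defS_def defP_def Sigma_in_0 Pi_in_0)

lemma tuples_0: "tuples A 0 = {[]}"
  by (auto simp: tuples_def)

lemma defS_of_defP: "defP L \<beta> n P \<Longrightarrow> \<beta> < \<alpha> \<Longrightarrow> defS L \<alpha> n P"
  by (rule defS_compose[where \<beta> = "\<lambda>_. \<beta>" and m = "\<lambda>_. 0" and Q = "\<lambda>_. P"]) (auto simp: tuples_0)

lemma defP_of_defS: "defS L \<beta> n P \<Longrightarrow> \<beta> < \<alpha> \<Longrightarrow> defP L \<alpha> n P"
  by (rule defP_compose[where \<beta> = "\<lambda>_. \<beta>" and m = "\<lambda>_. 0" and Q = "\<lambda>_. P"]) (auto simp: tuples_0)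

text \<open>Level 0 is separate since a quantifier-free formula has no decomposition; it is wrapped
  into a disjunction instead. At positive levels the same components serve for the larger
  level.\<close>

lemma defS_mono:
  assumes "defS L \<alpha> n P" "\<alpha> \<le> \<beta>"
  shows "defS L \<beta> n P"
proof (cases "\<alpha> = 0")
  case True
  then show ?thesis using assms defS_of_defP[of L 0 n P \<beta>]
    by (cases "\<beta> = 0") (auto simp: defP_0 zero_less_iff_omega1)
next
  case False
  then have "0 < \<alpha>" by (simp add: zero_less_iff_omega1)
  from defS_decompose[OF assms(1) this] obtain m \<gamma> Q where
    *: "\<forall>i::nat. \<gamma> i < \<alpha> \<and> defP L (\<gamma> i) (n + m i) (Q i)"
    "\<forall>A. is_structure L A \<longrightarrow> (\<forall>a\<in>tuples A n. P A a \<longleftrightarrow> (\<exists>i. \<exists>c\<in>tuples A (m i). Q i A (a @ c)))"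
    by blast
  show ?thesis
    by (rule defS_compose[where \<beta> = \<gamma> and m = m and Q = Q]) (use * assms(2) less_le_trans in blast)+
qed

lemma defP_mono: "defP L \<alpha> n P \<Longrightarrow> \<alpha> \<le> \<beta> \<Longrightarrow> defP L \<beta> n P"
  using defS_mono[of L \<alpha> n "\<lambda>A a. \<not> P A a"] by (simp add: defS_neg)

text \<open>\<open>is\<close> may repeat indices, whereas \<open>sat_ren\<close> needs an injective
  renaming. The induction on the level therefore renames syntactically at level 0 alone and treats
  quantified blocks as appended positions, which are left untouched.\<close>

lemma defS_subst:
  assumes "defS L \<alpha> k P" "length is = k" "\<And>i. i \<in> set is \<Longrightarrow> i < n"
  shows "defS L \<alpha> n (\<lambda>A a. P A (map ((!) a) is))"
  using assms
proof (induction \<alpha> arbitrary: k n P "is" rule: less_induct)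
  case (less \<alpha>)
  show ?case
  proof (cases "\<alpha> = 0")
    case True
    from less.prems obtain p where p: "p \<in> formulas L k" "qfree p"
      and eq: "\<And>A a. is_structure L A \<Longrightarrow> a \<in> tuples A k \<Longrightarrow> holds A a p \<longleftrightarrow> P A a"
      unfolding defS_def True Sigma_in_0 by blast
    let ?q = "ren ((!) is) p"
    have fv: "fvars p \<subseteq> {..<k}" using p(1) by (simp add: formulas_def)
    have "?q \<in> formulas L n"
      using p less.prems(2,3) by (auto simp: formulas_def wf_ren fvars_ren_qfree)
    moreover have "holds A a ?q \<longleftrightarrow> P A (map ((!) a) is)" if "is_structure L A" "a \<in> tuples A n" for A a
    proof -
      have "holds A a ?q \<longleftrightarrow> sat A ((!) a \<circ> (!) is) p"
        by (simp add: holds_def sat_ren_qfree[OF p(2)])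
      also have "\<dots> \<longleftrightarrow> sat A ((!) (map ((!) a) is)) p"
        by (rule sat_cong) (use fv less.prems(2) in auto)
      also have "\<dots> \<longleftrightarrow> P A (map ((!) a) is)"
        using eq[OF that(1), of "map ((!) a) is"] tuples_map_nth[OF that(2), of "is"] less.prems(2,3)
        by (simp add: holds_def)
      finally show ?thesis .
    qed
    ultimately show ?thesis using p(2)
      unfolding defS_def True Sigma_in_0 by (intro bexI[of _ ?q]) (auto simp: qfree_ren)
  next
    case False
    then have "0 < \<alpha>" by (simp add: zero_less_iff_omega1)
    from defS_decompose[OF less.prems(1) this] obtain m \<beta> Q where
      Q: "\<And>i::nat. \<beta> i < \<alpha>" "\<And>i. defP L (\<beta> i) (k + m i) (Q i)" and
      P: "\<And>A a. is_structure L A \<Longrightarrow> a \<in> tuples A k \<Longrightarrow>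
         P A a \<longleftrightarrow> (\<exists>i. \<exists>c\<in>tuples A (m i). Q i A (a @ c))"
      by metis
    show ?thesis
    proof (rule defS_compose[where \<beta> = \<beta> and m = m and
          Q = "\<lambda>j A a. Q j A (map ((!) a) (is @ [n..<n + m j]))"])
      fix j
      show "\<beta> j < \<alpha>" by fact
      have "defS L (\<beta> j) (k + m j) (\<lambda>A a. \<not> Q j A a)" using Q(2) by (simp add: defS_neg)
      from less.IH[OF Q(1) this, of "is @ [n..<n + m j]" "n + m j"]
      show "defP L (\<beta> j) (n + m j) (\<lambda>A a. Q j A (map ((!) a) (is @ [n..<n + m j])))"
        using less.prems(2,3) by (fastforce simp: defS_neg)
    next
      fix A a assume A: "is_structure L A" "a \<in> tuples A n"
      have "map ((!) (a @ c)) (is @ [n..<n + m j]) = map ((!) a) is @ c"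
        if "c \<in> tuples A (m j)" for c j
        using that A(2) less.prems(3)
        by (auto simp: tuples_def nth_append intro!: nth_equalityI)
      then show "P A (map ((!) a) is) \<longleftrightarrow>
          (\<exists>j. \<exists>c\<in>tuples A (m j). Q j A (map ((!) (a @ c)) (is @ [n..<n + m j])))"
        using P[OF A(1), of "map ((!) a) is"] tuples_map_nth[OF A(2), of "is"] less.prems(2,3)
        by (simp del: map_append cong: bex_cong)
    qed
  qed
qed

lemma defP_subst:
  assumes "defP L \<alpha> k P" "length is = k" "\<And>i. i \<in> set is \<Longrightarrow> i < n"
  shows "defP L \<alpha> n (\<lambda>A a. P A (map ((!) a) is))"
  using defS_subst[of L \<alpha> k "\<lambda>A a. \<not> P A a" "is" n] assms by (simp add: defS_neg)

text \<open>The new block merges with the existential blocks already present, so the level does not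
  rise.\<close>

lemma defS_Ex:
  assumes "defS L \<alpha> (n + m) Q" "0 < \<alpha>"
  shows "defS L \<alpha> n (\<lambda>A a. \<exists>c\<in>tuples A m. Q A (a @ c))"
proof -
  from defS_decompose[OF assms] obtain k \<beta> R where
    R: "\<forall>i::nat. \<beta> i < \<alpha> \<and> defP L (\<beta> i) (n + m + k i) (R i)"
    "\<forall>A. is_structure L A \<longrightarrow> (\<forall>a\<in>tuples A (n + m). Q A a \<longleftrightarrow> (\<exists>i. \<exists>c\<in>tuples A (k i). R i A (a @ c)))"
    by blast
  show ?thesis
  proof (rule defS_compose[where \<beta> = \<beta> and m = "\<lambda>i. m + k i" and Q = R])
    fix A a assume A: "is_structure L A" "a \<in> tuples A n"
    have split: "(\<exists>c\<in>tuples A (m + j). S c) \<longleftrightarrow> (\<exists>c\<in>tuples A m. \<exists>d\<in>tuples A j. S (c @ d))" for j S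
    proof
      assume "\<exists>c\<in>tuples A (m + j). S c"
      then obtain c where c: "c \<in> tuples A (m + j)" "S c" by blast
      then have "take m c \<in> tuples A m" "drop m c \<in> tuples A j"
        by (auto simp: tuples_def dest: in_set_takeD in_set_dropD)
      then show "\<exists>c\<in>tuples A m. \<exists>d\<in>tuples A j. S (c @ d)"
        using c(2) append_take_drop_id by metis
    qed (auto intro: tuples_appendI)
    show "(\<exists>c\<in>tuples A m. Q A (a @ c)) \<longleftrightarrow> (\<exists>i. \<exists>c\<in>tuples A (m + k i). R i A (a @ c))"
      using R(2) A tuples_appendI[OF A(2)] unfolding split by fastforce
  qed (use R(1) in \<open>auto simp: add.assoc\<close>)
qed

lemma defP_All:
  assumes "defP L \<alpha> (n + m) Q" "0 < \<alpha>"
  shows "defP L \<alpha> n (\<lambda>A a. \<forall>c\<in>tuples A m. Q A (a @ c))"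
proof -
  have "defS L \<alpha> n (\<lambda>A a. \<exists>c\<in>tuples A m. \<not> Q A (a @ c))"
    by (rule defS_Ex[where Q = "\<lambda>A a. \<not> Q A a"]) (simp_all add: defS_neg assms)
  moreover have "(\<lambda>A a. \<exists>c\<in>tuples A m. \<not> Q A (a @ c)) = (\<lambda>A a. \<not> (\<forall>c\<in>tuples A m. Q A (a @ c)))" by (simp add: fun_eq_iff)
  ultimately show ?thesis by (simp only: defS_neg)
qed

lemma defS_ex_nat:
  assumes "\<And>i::nat. defS L \<alpha> n (P i)" "0 < \<alpha>"
  shows "defS L \<alpha> n (\<lambda>A a. \<exists>i. P i A a)"
proof -
  have ex: "\<forall>i. \<exists>m \<beta> Q. (\<forall>j::nat. \<beta> j < \<alpha> \<and> defP L (\<beta> j) (n + m j) (Q j)) \<and>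
    (\<forall>A. is_structure L A \<longrightarrow> (\<forall>a\<in>tuples A n. P i A a \<longleftrightarrow> (\<exists>j. \<exists>c\<in>tuples A (m j). Q j A (a @ c))))"
    using defS_decompose assms by blast
  obtain m \<beta> Q where *: "\<forall>i. (\<forall>j::nat. \<beta> i j < \<alpha> \<and> defP L (\<beta> i j) (n + m i j) (Q i j)) \<and>
    (\<forall>A. is_structure L A \<longrightarrow> (\<forall>a\<in>tuples A n. P i A a \<longleftrightarrow> (\<exists>j. \<exists>c\<in>tuples A (m i j). Q i j A (a @ c))))"
    using ex[unfolded choice_iff] by (elim exE)
  have Q: "\<And>i j. \<beta> i j < \<alpha>" "\<And>i j. defP L (\<beta> i j) (n + m i j) (Q i j)"
    and P: "\<And>i A a. is_structure L A \<Longrightarrow> a \<in> tuples A n \<Longrightarrow>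
      P i A a \<longleftrightarrow> (\<exists>j. \<exists>c\<in>tuples A (m i j). Q i j A (a @ c))"
    using * by blast+
  show ?thesis
  proof (rule defS_compose[where \<beta> = "\<lambda>k. \<beta> (fst (prod_decode k)) (snd (prod_decode k))"
        and m = "\<lambda>k. m (fst (prod_decode k)) (snd (prod_decode k))"
        and Q = "\<lambda>k. Q (fst (prod_decode k)) (snd (prod_decode k))"])
    fix A a assume A: "is_structure L A" "a \<in> tuples A n"
    show "(\<exists>i. P i A a) \<longleftrightarrow> (\<exists>k. \<exists>c\<in>tuples A (m (fst (prod_decode k)) (snd (prod_decode k))).
            Q (fst (prod_decode k)) (snd (prod_decode k)) A (a @ c))"
      (is "?l \<longleftrightarrow> ?r")
    proof
      assume ?l
      then obtain i j c where "c \<in> tuples A (m i j)" "Q i j A (a @ c)" using P[OF A] by blast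
      then show ?r by (intro exI[of _ "prod_encode (i, j)"] bexI[of _ c]) auto
    next
      assume ?r
      then show ?l using P[OF A] by blast
    qed
  qed (rule Q)+
qed

lemma defP_all_nat:
  assumes "\<And>i::nat. defP L \<alpha> n (P i)" "0 < \<alpha>"
  shows "defP L \<alpha> n (\<lambda>A a. \<forall>i. P i A a)"
proof -
  have "defS L \<alpha> n (\<lambda>A a. \<exists>i. \<not> P i A a)"
    by (rule defS_ex_nat) (simp_all add: defS_neg assms)
  moreover have "(\<lambda>A a. \<exists>i. \<not> P i A a) = (\<lambda>A a. \<not> (\<forall>i. P i A a))" by (simp add: fun_eq_iff)
  ultimately show ?thesis by (simp only: defS_neg)
qed

lemma defP_conj:
  assumes "defP L \<alpha> n P" "defP L \<alpha> n Q"
  shows "defP L \<alpha> n (\<lambda>A a. P A a \<and> Q A a)"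
proof (cases "\<alpha> = 0")
  case True
  from assms obtain p q where
    "p \<in> formulas L n" "qfree p" "\<forall>A. is_structure L A \<longrightarrow> (\<forall>a\<in>tuples A n. holds A a p \<longleftrightarrow> P A a)"
    "q \<in> formulas L n" "qfree q" "\<forall>A. is_structure L A \<longrightarrow> (\<forall>a\<in>tuples A n. holds A a q \<longleftrightarrow> Q A a)"
    unfolding defP_def True Pi_in_0 by metis
  then show ?thesis unfolding defP_def True Pi_in_0
    by (intro bexI[of _ "AndF p q"]) (auto simp: formulas_def holds_def intro: qfree.intros)
next
  case False
  have "defP L \<alpha> n (\<lambda>A a. \<forall>i::nat. (if i = 0 then P else Q) A a)"
    by (rule defP_all_nat) (use assms False in \<open>auto simp: zero_less_iff_omega1\<close>)
  moreover have "(\<forall>i::nat. (if i = 0 then P else Q) A a) \<longleftrightarrow> P A a \<and> Q A a" for A a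
    by (metis zero_neq_one)
  ultimately show ?thesis by simp
qed

lemma defS_disj:
  assumes "defS L \<alpha> n P" "defS L \<alpha> n Q"
  shows "defS L \<alpha> n (\<lambda>A a. P A a \<or> Q A a)"
proof -
  have "defP L \<alpha> n (\<lambda>A a. \<not> P A a \<and> \<not> Q A a)"
    by (rule defP_conj) (simp_all add: defP_neg assms)
  moreover have "(\<lambda>A a. \<not> P A a \<and> \<not> Q A a) = (\<lambda>A a. \<not> (P A a \<or> Q A a))" by (simp add: fun_eq_iff)
  ultimately show ?thesis by (simp only: defP_neg)
qed

text \<open>\<open>js\<close> lists the positions to be selected, and \<open>f\<close> is the
  resulting tuple as it is usually written, with \<open>take\<close> and
  \<open>drop\<close>.\<close>

lemma defP_subst_append:
  assumes "defP L \<alpha> k P" "length js = k" "\<And>i. i \<in> set js \<Longrightarrow> i < n"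
    "\<And>A a. a \<in> tuples A n \<Longrightarrow> map ((!) a) js = f a"
  shows "defP L \<alpha> n (\<lambda>A a. P A (f a))"
  by (rule defP_congI[OF defP_subst[OF assms(1-3)]]) (simp_all add: assms(4))

lemma defS_subst_append:
  assumes "defS L \<alpha> k P" "length js = k" "\<And>i. i \<in> set js \<Longrightarrow> i < n"
    "\<And>A a. a \<in> tuples A n \<Longrightarrow> map ((!) a) js = f a"
  shows "defS L \<alpha> n (\<lambda>A a. P A (f a))"
  by (rule defS_congI[OF defS_subst[OF assms(1-3)]]) (simp_all add: assms(4))

lemma map_nth_take: "map ((!) a) [0..<k] = take k a" if "k \<le> length a"
  using that by (auto intro!: nth_equalityI)

text \<open>At positive levels conjunction is not part of the syntax. The two disjunctions are
  distributed, and the two existential blocks are placed side by side on separate positions; the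
  matrices then sit at the maximum of two levels, which is still below
  \<open>\<alpha>\<close>.\<close>

lemma defS_conj:
  assumes "defS L \<alpha> n P" "defS L \<alpha> n Q"
  shows "defS L \<alpha> n (\<lambda>A a. P A a \<and> Q A a)"
proof (cases "\<alpha> = 0")
  case True
  then show ?thesis using assms defP_conj[of L 0 n P Q] by (simp add: defP_0)
next
  case False
  then have pos: "0 < \<alpha>" by (simp add: zero_less_iff_omega1)
  from defS_decompose[OF assms(1) pos] obtain m \<beta> R where
    R: "\<And>i::nat. \<beta> i < \<alpha>" "\<And>i. defP L (\<beta> i) (n + m i) (R i)" and
    P: "\<And>A a. is_structure L A \<Longrightarrow> a \<in> tuples A n \<Longrightarrow> P A a \<longleftrightarrow> (\<exists>i. \<exists>c\<in>tuples A (m i). R i A (a @ c))"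
    by metis
  from defS_decompose[OF assms(2) pos] obtain m' \<beta>' R' where
    R': "\<And>i::nat. \<beta>' i < \<alpha>" "\<And>i. defP L (\<beta>' i) (n + m' i) (R' i)" and
    Q: "\<And>A a. is_structure L A \<Longrightarrow> a \<in> tuples A n \<Longrightarrow> Q A a \<longleftrightarrow> (\<exists>i. \<exists>c\<in>tuples A (m' i). R' i A (a @ c))"
    by metis
  have "defS L \<alpha> n (\<lambda>A a. \<exists>c\<in>tuples A (m i + m' j).
          R i A (take (n + m i) (a @ c)) \<and> R' j A (take n (a @ c) @ drop (n + m i) (a @ c)))" for i j
  proof -
    let ?\<gamma> = "max (\<beta> i) (\<beta>' j)"
    have "defP L ?\<gamma> (n + (m i + m' j))
       (\<lambda>A a. R i A (take (n + m i) a) \<and> R' j A (take n a @ drop (n + m i) a))"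
    proof (rule defP_conj)
      show "defP L ?\<gamma> (n + (m i + m' j)) (\<lambda>A a. R i A (take (n + m i) a))"
        by (rule defP_subst_append[OF defP_mono[OF R(2)], where js = "[0..<n + m i]"])
          (auto simp: tuples_def simp del: upt_add_eq_append intro!: nth_equalityI)
      show "defP L ?\<gamma> (n + (m i + m' j)) (\<lambda>A a. R' j A (take n a @ drop (n + m i) a))"
        by (rule defP_subst_append[OF defP_mono[OF R'(2)],
              where js = "[0..<n] @ [n + m i..<n + (m i + m' j)]"])
          (auto simp: tuples_def nth_append intro!: nth_equalityI)
    qed
    then have "defS L \<alpha> (n + (m i + m' j))
       (\<lambda>A a. R i A (take (n + m i) a) \<and> R' j A (take n a @ drop (n + m i) a))"
      using R(1)[of i] R'(1)[of j] by (intro defS_of_defP[where \<beta> = ?\<gamma>]) auto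
    from defS_Ex[OF this pos] show ?thesis .
  qed
  then have *: "defS L \<alpha> n (\<lambda>A a. \<exists>i j. \<exists>c\<in>tuples A (m i + m' j).
          R i A (take (n + m i) (a @ c)) \<and> R' j A (take n (a @ c) @ drop (n + m i) (a @ c)))"
    by (intro defS_ex_nat pos)
  show ?thesis
  proof (rule defS_congI[OF *])
    fix A a assume A: "is_structure L A" "a \<in> tuples A n"
    show "(\<exists>i j. \<exists>c\<in>tuples A (m i + m' j).
      R i A (take (n + m i) (a @ c)) \<and> R' j A (take n (a @ c) @ drop (n + m i) (a @ c))) \<longleftrightarrow>
      P A a \<and> Q A a" (is "?l \<longleftrightarrow> ?r")
  proof
    assume ?l
    then obtain i j c where c: "c \<in> tuples A (m i + m' j)"
      "R i A (a @ take (m i) c)" "R' j A (a @ drop (m i) c)"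
      using A by (auto simp: tuples_def)
    have "take (m i) c \<in> tuples A (m i)" "drop (m i) c \<in> tuples A (m' j)"
      using c(1) by (auto simp: tuples_def dest: in_set_takeD in_set_dropD)
    then show ?r using c P[OF A] Q[OF A] by blast
  next
    assume ?r
    then obtain i c j d where c: "c \<in> tuples A (m i)" "R i A (a @ c)"
      and d: "d \<in> tuples A (m' j)" "R' j A (a @ d)"
      using P[OF A] Q[OF A] by blast
    then show ?l using A tuples_appendI[OF c(1) d(1)]
      by (intro exI[of _ i] exI[of _ j] bexI[of _ "c @ d"]) (auto simp: tuples_def)
  qed
  qed
qed

lemma defS_const: "defS L \<alpha> n (\<lambda>A a. b)"
proof -
  have "defS L 0 n (\<lambda>A a. False)"
    unfolding defS_def Sigma_in_0
    by (intro bexI[of _ FalseF]) (auto simp: formulas_def holds_def intro: qfree.intros)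
  moreover from this have "defS L 0 n (\<lambda>A a. True)"
    using defS_neg[of L 0 n "\<lambda>A a. False"] by (simp add: defP_0)
  ultimately show ?thesis by (cases b) (auto intro: defS_mono)
qed

lemma defP_const: "defP L \<alpha> n (\<lambda>A a. b)"
  using defS_const[of L \<alpha> n "\<not> b"] by (simp add: defS_neg)

text \<open>\<open>b\<close> does not depend on the structure. This turns conjunctions over all
  natural numbers into conjunctions over an arbitrary set of codes.\<close>

lemma defP_imp:
  assumes "b \<Longrightarrow> defP L \<alpha> n P"
  shows "defP L \<alpha> n (\<lambda>A a. b \<longrightarrow> P A a)"
  using assms by (cases b) (auto simp: defP_const)

lemma defS_conjI:
  assumes "b \<Longrightarrow> defS L \<alpha> n P"
  shows "defS L \<alpha> n (\<lambda>A a. b \<and> P A a)"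
  using assms by (cases b) (auto simp: defS_const)

lemma defS_eq: "i < n \<Longrightarrow> j < n \<Longrightarrow> defS L 0 n (\<lambda>A a. a ! i = a ! j)"
  unfolding defS_def Sigma_in_0
  by (intro bexI[of _ "EqF (Var i) (Var j)"]) (auto simp: formulas_def holds_def intro: qfree.intros)

lemma defS_rel:
  assumes "r \<in> rel_syms L" "length is = rel_arity L r" "\<And>i. i \<in> set is \<Longrightarrow> i < n"
  shows "defS L 0 n (\<lambda>A a. rel_of A r (map ((!) a) is))"
  unfolding defS_def Sigma_in_0 using assms
  by (intro bexI[of _ "RelF r (map Var is)"]) (auto simp: formulas_def holds_def comp_def intro: qfree.intros)

lemma defS_fun:
  assumes "f \<in> fun_syms L" "length is = fun_arity L f" "\<And>i. i \<in> set is \<Longrightarrow> i < n" "j < n"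
  shows "defS L 0 n (\<lambda>A a. fun_of A f (map ((!) a) is) = a ! j)"
  unfolding defS_def Sigma_in_0 using assms
  by (intro bexI[of _ "EqF (App f (map Var is)) (Var j)"])
    (auto simp: formulas_def holds_def comp_def intro: qfree.intros)

lemma defS_formula: "p \<in> formulas L n \<Longrightarrow> Sigma_in \<alpha> p \<Longrightarrow> defS L \<alpha> n (\<lambda>A a. holds A a p)"
  unfolding defS_def by blast

lemma defP_formula: "p \<in> formulas L n \<Longrightarrow> Pi_in \<alpha> p \<Longrightarrow> defP L \<alpha> n (\<lambda>A a. holds A a p)"
  unfolding defP_def by blast

lemma ex_common_bound:
  assumes "\<And>i::nat. \<exists>\<alpha>. Q \<alpha> i" "\<And>i \<alpha> \<beta>. Q \<alpha> i \<Longrightarrow> \<alpha> \<le> \<beta> \<Longrightarrow> Q \<beta> i"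
  shows "\<exists>\<alpha>::omega1. 0 < \<alpha> \<and> (\<forall>i. Q \<alpha> i)"
proof -
  obtain g where g: "\<And>i. Q (g i) i" using assms(1) by metis
  obtain \<beta> where "\<forall>\<alpha>\<in>range g. \<alpha> < \<beta>" using countable_imp_bounded_omega1[of "range g"] by auto
  then have "\<And>i. g i < \<beta>" by auto
  then show ?thesis using assms(2)[OF g] by (metis le_less_trans less_imp_le zero_le_omega1)
qed

text \<open>The countable connectives are no obstacle because countably many levels have a common
  bound, by \<open>ex_common_bound\<close>. The lemma guarantees that the least level in
  \<open>qr\<close> exists.\<close>

lemma ex_defS_formula: "p \<in> formulas L n \<Longrightarrow> \<exists>\<alpha>. defS L \<alpha> n (\<lambda>A a. holds A a p)"
proof (induction p arbitrary: n)
  case FalseF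
  show ?case using defS_const by (auto simp: holds_def)
next
  case (EqF s t)
  then show ?case by (intro exI[of _ 0] defS_formula) (auto simp: Sigma_in_0 intro: qfree.intros)
next
  case (RelF r ts)
  then show ?case by (intro exI[of _ 0] defS_formula) (auto simp: Sigma_in_0 intro: qfree.intros)
next
  case (NegF p)
  then obtain \<alpha> where "defS L \<alpha> n (\<lambda>A a. holds A a p)" by (auto simp: formulas_def)
  from defP_of_defS[OF this, of "osuc \<alpha>"] show ?case
    by (auto simp: holds_def simp flip: defS_neg)
next
  case (AndF p q)
  then obtain \<alpha> \<beta> where "defS L \<alpha> n (\<lambda>A a. holds A a p)" "defS L \<beta> n (\<lambda>A a. holds A a q)"
    by (fastforce simp: formulas_def)
  then have "defS L (max \<alpha> \<beta>) n (\<lambda>A a. holds A a p \<and> holds A a q)"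
    by (intro defS_conj) (auto elim: defS_mono)
  then show ?case by (auto simp: holds_def)
next
  case (OrF p q)
  then obtain \<alpha> \<beta> where "defS L \<alpha> n (\<lambda>A a. holds A a p)" "defS L \<beta> n (\<lambda>A a. holds A a q)"
    by (fastforce simp: formulas_def)
  then have "defS L (max \<alpha> \<beta>) n (\<lambda>A a. holds A a p \<or> holds A a q)"
    by (intro defS_disj) (auto elim: defS_mono)
  then show ?case by (auto simp: holds_def)
next
  case (ConjF h)
  have "\<exists>\<alpha>. defS L \<alpha> n (\<lambda>A a. holds A a (h i))" for i
    by (rule ConjF.IH) (use ConjF.prems in \<open>auto simp: formulas_def\<close>)
  then have "\<exists>\<alpha>. 0 < \<alpha> \<and> (\<forall>i. defS L \<alpha> n (\<lambda>A a. holds A a (h i)))"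
    by (rule ex_common_bound) (rule defS_mono)
  then obtain \<alpha> where "0 < \<alpha>" "\<And>i. defS L \<alpha> n (\<lambda>A a. holds A a (h i))"
    by blast
  then have "defP L (osuc \<alpha>) n (\<lambda>A a. \<forall>i. holds A a (h i))"
    by (intro defP_all_nat defP_of_defS[where \<beta> = \<alpha>]) auto
  then have "defS L (osuc (osuc \<alpha>)) n (\<lambda>A a. \<forall>i. holds A a (h i))"
    by (rule defS_of_defP) simp
  then show ?case by (auto simp: holds_def)
next
  case (DisjF h)
  have "\<exists>\<alpha>. defS L \<alpha> n (\<lambda>A a. holds A a (h i))" for i
    by (rule DisjF.IH) (use DisjF.prems in \<open>auto simp: formulas_def\<close>)
  then have "\<exists>\<alpha>. 0 < \<alpha> \<and> (\<forall>i. defS L \<alpha> n (\<lambda>A a. holds A a (h i)))"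
    by (rule ex_common_bound) (rule defS_mono)
  then obtain \<alpha> where "0 < \<alpha>" "\<And>i. defS L \<alpha> n (\<lambda>A a. holds A a (h i))"
    by blast
  then have "defS L \<alpha> n (\<lambda>A a. \<exists>i. holds A a (h i))"
    by (intro defS_ex_nat) auto
  then show ?case by (auto simp: holds_def)
next
  case (AllF x p)
  \<comment> \<open>\<open>x\<close> may lie below \<open>n\<close> or beyond it. The quantified
    value is stored at the new position \<open>n\<close>, index \<open>x\<close> is redirected
    there, and the remaining dummy indices, which do not occur free, are sent there too.\<close>
  let ?is = "map (\<lambda>i. if i = x then n else if i < n then i else n) [0..<n + Suc x]"
  have fv: "fvars p \<subseteq> {..<n} \<union> {x}" using AllF.prems by (auto simp: formulas_def)
  then have "p \<in> formulas L (n + Suc x)" using AllF.prems by (auto simp: formulas_def)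
  from AllF.IH[OF this] obtain \<alpha> where "defS L \<alpha> (n + Suc x) (\<lambda>A a. holds A a p)" by blast
  then have "defS L \<alpha> (n + 1) (\<lambda>A a. holds A (map ((!) a) ?is) p)"
    by (rule defS_subst) (auto split: if_splits)
  then have "defP L (osuc \<alpha>) (n + 1) (\<lambda>A a. holds A (map ((!) a) ?is) p)"
    by (rule defP_of_defS) simp
  from defP_All[OF this] have "defP L (osuc \<alpha>) n (\<lambda>A a. \<forall>c\<in>tuples A 1. holds A (map ((!) (a @ c)) ?is) p)"
    by simp
  then have *: "defS L (osuc (osuc \<alpha>)) n (\<lambda>A a. \<forall>c\<in>tuples A 1. holds A (map ((!) (a @ c)) ?is) p)"
    by (rule defS_of_defP) simp
  show ?case
  proof (rule exI, rule defS_congI[OF *])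
    fix A a assume that: "is_structure L A" "a \<in> tuples A n"
    show "(\<forall>c\<in>tuples A 1. holds A (map ((!) (a @ c)) ?is) p) \<longleftrightarrow> holds A a (AllF x p)"
  proof -
    have "tuples A 1 = (\<lambda>d. [d]) ` univ A" by (auto simp: tuples_def length_Suc_conv)
    moreover have "sat A ((!) (map ((!) (a @ [d])) ?is)) p \<longleftrightarrow> sat A (((!) a)(x := d)) p" for d
      by (rule sat_cong) (use fv tuples_length[OF that(2)] in \<open>auto simp: nth_append simp del: upt_Suc\<close>)
    ultimately show ?thesis by (auto simp: holds_def)
  qed
  qed
next
  case (ExF x p)
  let ?is = "map (\<lambda>i. if i = x then n else if i < n then i else n) [0..<n + Suc x]"
  have fv: "fvars p \<subseteq> {..<n} \<union> {x}" using ExF.prems by (auto simp: formulas_def)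
  then have "p \<in> formulas L (n + Suc x)" using ExF.prems by (auto simp: formulas_def)
  from ExF.IH[OF this] obtain \<alpha> where "defS L \<alpha> (n + Suc x) (\<lambda>A a. holds A a p)" by blast
  then have "defS L \<alpha> (n + 1) (\<lambda>A a. holds A (map ((!) a) ?is) p)"
    by (rule defS_subst) (auto split: if_splits)
  then have "defS L (osuc \<alpha>) (n + 1) (\<lambda>A a. holds A (map ((!) a) ?is) p)"
    by (rule defS_mono) (simp add: less_imp_le)
  from defS_Ex[OF this] have *: "defS L (osuc \<alpha>) n (\<lambda>A a. \<exists>c\<in>tuples A 1. holds A (map ((!) (a @ c)) ?is) p)"
    by simp
  show ?case
  proof (rule exI, rule defS_congI[OF *])
    fix A a assume that: "is_structure L A" "a \<in> tuples A n"
    show "(\<exists>c\<in>tuples A 1. holds A (map ((!) (a @ c)) ?is) p) \<longleftrightarrow> holds A a (ExF x p)"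
  proof -
    have "tuples A 1 = (\<lambda>d. [d]) ` univ A" by (auto simp: tuples_def length_Suc_conv)
    moreover have "sat A ((!) (map ((!) (a @ [d])) ?is)) p \<longleftrightarrow> sat A (((!) a)(x := d)) p" for d
      by (rule sat_cong) (use fv tuples_length[OF that(2)] in \<open>auto simp: nth_append simp del: upt_Suc\<close>)
    ultimately show ?thesis by (auto simp: holds_def)
  qed
  qed
qed

section \<open>Isomorphism and back-and-forth between countable structures\<close>

section \<open>Isomorphisms\<close>

definition iso_map :: "vocabulary \<Rightarrow> (nat \<Rightarrow> nat) \<Rightarrow> struct \<Rightarrow> struct \<Rightarrow> bool" where
  "iso_map L h A B \<longleftrightarrow> bij_betw h (univ A) (univ B) \<and>
    (\<forall>r\<in>rel_syms L. \<forall>a\<in>tuples A (rel_arity L r). rel_of B r (map h a) \<longleftrightarrow> rel_of A r a) \<and>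
    (\<forall>f\<in>fun_syms L. \<forall>a\<in>tuples A (fun_arity L f). fun_of B f (map h a) = h (fun_of A f a))"

lemma isomorphic_iff: "isomorphic L A B \<longleftrightarrow> (\<exists>h. iso_map L h A B)"
  by (simp add: isomorphic_def iso_map_def)

lemma iso_map_tuples: "iso_map L h A B \<Longrightarrow> a \<in> tuples A n \<Longrightarrow> map h a \<in> tuples B n"
  by (auto simp: iso_map_def tuples_def dest: bij_betwE)

lemma iso_map_id: "iso_map L (\<lambda>x. x) A A"
  by (auto simp: iso_map_def bij_betw_def)

lemma iso_map_comp: "iso_map L h A B \<Longrightarrow> iso_map L g B C \<Longrightarrow> iso_map L (g \<circ> h) A C"
  unfolding iso_map_def
  using iso_map_tuples[of L h A B] 
  by (auto simp: iso_map_def bij_betw_trans simp flip: map_map)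

lemma iso_map_inv:
  assumes h: "iso_map L h A B" and A: "is_structure L A"
  shows "iso_map L (inv_into (univ A) h) B A"
proof -
  let ?g = "inv_into (univ A) h"
  have bij: "bij_betw h (univ A) (univ B)" using h by (simp add: iso_map_def)
  have hg: "map h (map ?g b) = b" "map ?g b \<in> tuples A n" if "b \<in> tuples B n" for b n
  proof -
    have "set b \<subseteq> univ B" using that by (simp add: tuples_def)
    then show "map h (map ?g b) = b"
      using bij by (auto simp: bij_betw_def f_inv_into_f subset_iff intro!: map_idI)
    show "map ?g b \<in> tuples A n" using that bij
      by (auto simp: tuples_def bij_betw_def intro!: inv_into_into)
  qed
  have gh: "?g (h x) = x" if "x \<in> univ A" for x
    using that bij by (simp add: bij_betw_def)
  show ?thesis unfolding iso_map_def
  proof (intro conjI ballI)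
    show "bij_betw ?g (univ B) (univ A)" using bij by (rule bij_betw_inv_into)
  next
    fix r b assume r: "r \<in> rel_syms L" "b \<in> tuples B (rel_arity L r)"
    then have "rel_of B r (map h (map ?g b)) = rel_of A r (map ?g b)"
      using h hg(2)[OF r(2)] unfolding iso_map_def by blast
    then show "rel_of A r (map ?g b) \<longleftrightarrow> rel_of B r b" by (simp only: hg(1)[OF r(2)])
  next
    fix f b assume f: "f \<in> fun_syms L" "b \<in> tuples B (fun_arity L f)"
    then have "fun_of B f (map h (map ?g b)) = h (fun_of A f (map ?g b))"
      using h hg(2)[OF f(2)] unfolding iso_map_def by blast
    then show "fun_of A f (map ?g b) = ?g (fun_of B f b)"
      using A f(1) hg(2)[OF f(2)] unfolding hg(1)[OF f(2)] by (simp add: gh is_structure_def)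
  qed
qed

lemma val_in_univ:
  assumes "is_structure L A" "wf_trm L t" "\<And>x. x \<in> vars t \<Longrightarrow> e x \<in> univ A"
  shows "val A e t \<in> univ A"
  using assms(2,3)
proof (induction t)
  case (App f ts)
  have "val A e t \<in> univ A" if "t \<in> set ts" for t
    by (rule App.IH[OF that]) (use App.prems that in auto)
  then have "map (val A e) ts \<in> tuples A (fun_arity L f)"
    using App.prems(1) by (auto simp: tuples_def)
  then show ?case using App.prems(1) assms(1) by (auto simp: is_structure_def)
qed simp

lemma val_iso:
  assumes "iso_map L h A B" "is_structure L A" "wf_trm L t" "\<And>x. x \<in> vars t \<Longrightarrow> e x \<in> univ A"
  shows "val B (h \<circ> e) t = h (val A e t)"
  using assms(3,4)
proof (induction t)
  case (App f ts)
  have "val A e t \<in> univ A" if "t \<in> set ts" for t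
    by (rule val_in_univ[OF assms(2)]) (use App.prems that in auto)
  then have "map (val A e) ts \<in> tuples A (fun_arity L f)"
    using App.prems(1) by (auto simp: tuples_def)
  then have "fun_of B f (map h (map (val A e) ts)) = h (fun_of A f (map (val A e) ts))"
    using App.prems(1) assms(1) unfolding iso_map_def by (simp del: map_map)
  moreover have "val B (h \<circ> e) t = h (val A e t)" if "t \<in> set ts" for t
    by (rule App.IH[OF that]) (use App.prems that in auto)
  then have "map (val B (h \<circ> e)) ts = map h (map (val A e) ts)" by simp
  ultimately show ?case by (simp only: val.simps)
qed simp

lemma sat_iso:
  assumes "iso_map L h A B" "is_structure L A" "wf_fm L p" "\<And>x. x \<in> fvars p \<Longrightarrow> e x \<in> univ A"
  shows "sat B (h \<circ> e) p \<longleftrightarrow> sat A e p"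
  using assms(3,4)
proof (induction p arbitrary: e)
  case (EqF s t)
  have u: "val A e s \<in> univ A" "val A e t \<in> univ A"
    by (rule val_in_univ[OF assms(2)]; use EqF.prems in simp)+
  have inj: "inj_on h (univ A)" using assms(1) by (simp add: iso_map_def bij_betw_def)
  have "val B (h \<circ> e) s = h (val A e s)" "val B (h \<circ> e) t = h (val A e t)"
    by (rule val_iso[OF assms(1,2)]; use EqF.prems in simp)+
  then show ?case by (simp only: sat.simps inj_on_eq_iff[OF inj u])
next
  case (RelF r ts)
  have "val A e t \<in> univ A" if "t \<in> set ts" for t
    by (rule val_in_univ[OF assms(2)]) (use RelF.prems that in auto)
  then have "map (val A e) ts \<in> tuples A (rel_arity L r)"
    using RelF.prems(1) by (auto simp: tuples_def)
  then have "rel_of B r (map h (map (val A e) ts)) \<longleftrightarrow> rel_of A r (map (val A e) ts)"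
    using RelF.prems(1) assms(1) unfolding iso_map_def by (simp del: map_map)
  moreover have "val B (h \<circ> e) t = h (val A e t)" if "t \<in> set ts" for t
    by (rule val_iso[OF assms(1,2)]) (use RelF.prems that in auto)
  then have "map (val B (h \<circ> e)) ts = map h (map (val A e) ts)" by simp
  ultimately show ?case by (simp only: sat.simps)
next
  case (AllF x p)
  have hu: "univ B = h ` univ A" using assms(1) by (auto simp: iso_map_def bij_betw_def)
  have st: "sat B ((h \<circ> e)(x := h d)) p \<longleftrightarrow> sat A (e(x := d)) p" if "d \<in> univ A" for d
  proof -
    have "(h \<circ> e)(x := h d) = h \<circ> (e(x := d))" by auto
    moreover have "sat B (h \<circ> (e(x := d))) p \<longleftrightarrow> sat A (e(x := d)) p"
      by (rule AllF.IH) (use AllF.prems that in auto)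
    ultimately show ?thesis by (simp only:)
  qed
  show ?case unfolding sat.simps hu using st by (simp del: fun_upd_apply)
next
  case (ExF x p)
  have hu: "univ B = h ` univ A" using assms(1) by (auto simp: iso_map_def bij_betw_def)
  have st: "sat B ((h \<circ> e)(x := h d)) p \<longleftrightarrow> sat A (e(x := d)) p" if "d \<in> univ A" for d
  proof -
    have "(h \<circ> e)(x := h d) = h \<circ> (e(x := d))" by auto
    moreover have "sat B (h \<circ> (e(x := d))) p \<longleftrightarrow> sat A (e(x := d)) p"
      by (rule ExF.IH) (use ExF.prems that in auto)
    ultimately show ?thesis by (simp only:)
  qed
  show ?case unfolding sat.simps hu using st by (simp del: fun_upd_apply)
next
  case (AndF p q)
  have "sat B (h \<circ> e) p \<longleftrightarrow> sat A e p"
    by (rule AndF.IH(1)) (use AndF.prems in auto)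
  moreover have "sat B (h \<circ> e) q \<longleftrightarrow> sat A e q"
    by (rule AndF.IH(2)) (use AndF.prems in auto)
  ultimately show ?case by (simp only: sat.simps)
next
  case (OrF p q)
  have "sat B (h \<circ> e) p \<longleftrightarrow> sat A e p"
    by (rule OrF.IH(1)) (use OrF.prems in auto)
  moreover have "sat B (h \<circ> e) q \<longleftrightarrow> sat A e q"
    by (rule OrF.IH(2)) (use OrF.prems in auto)
  ultimately show ?case by (simp only: sat.simps)
next
  case (ConjF g)
  have "sat B (h \<circ> e) (g i) \<longleftrightarrow> sat A e (g i)" for i
    by (rule ConjF.IH) (use ConjF.prems in auto)
  then show ?case by (simp only: sat.simps)
next
  case (DisjF g)
  have "sat B (h \<circ> e) (g i) \<longleftrightarrow> sat A e (g i)" for i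
    by (rule DisjF.IH) (use DisjF.prems in auto)
  then show ?case by (simp only: sat.simps)
next
  case (NegF p)
  have "sat B (h \<circ> e) p \<longleftrightarrow> sat A e p"
    by (rule NegF.IH) (use NegF.prems in auto)
  then show ?case by (simp only: sat.simps)
next
  case FalseF
  show ?case by (simp only: sat.simps)
qed

lemma holds_iso:
  assumes "iso_map L h A B" "is_structure L A" "a \<in> tuples A n" "p \<in> formulas L n"
  shows "holds B (map h a) p \<longleftrightarrow> holds A a p"
proof -
  have fv: "fvars p \<subseteq> {..<n}" using assms(4) by (simp add: formulas_def)
  have "holds B (map h a) p \<longleftrightarrow> sat B (h \<circ> (!) a) p"
    unfolding holds_def by (rule sat_cong) (use fv assms(3) in \<open>auto simp: tuples_def\<close>)
  also have "\<dots> \<longleftrightarrow> holds A a p"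
    unfolding holds_def
    by (rule sat_iso[OF assms(1,2)]) (use assms(4) fv tuples_nth[OF assms(3)] in \<open>auto simp: formulas_def\<close>)
  finally show ?thesis .
qed

lemma isomorphic_refl: "isomorphic L A A"
  unfolding isomorphic_iff using iso_map_id by blast

lemma isomorphic_sym: "isomorphic L A B \<Longrightarrow> is_structure L A \<Longrightarrow> isomorphic L B A"
  unfolding isomorphic_iff using iso_map_inv by blast

lemma isomorphic_trans: "isomorphic L A B \<Longrightarrow> isomorphic L B C \<Longrightarrow> isomorphic L A C"
  unfolding isomorphic_iff using iso_map_comp by blast

lemma copies_eq:
  assumes "isomorphic L A B" "is_structure L A"
  shows "copies L A = copies L B"
  using isomorphic_sym[OF assms] assms(1) isomorphic_trans unfolding copies_def by blast

lemma holds_sentence_iso: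
  "isomorphic L A B \<Longrightarrow> is_structure L A \<Longrightarrow> p \<in> sentences L \<Longrightarrow> holds B [] p \<longleftrightarrow> holds A [] p"
  using holds_iso[of L _ A B "[]" 0 p] by (auto simp: isomorphic_iff tuples_0)

section \<open>Back-and-forth relations\<close>

abbreviation pt :: "vocabulary \<Rightarrow> nat \<Rightarrow> struct \<Rightarrow> nat list \<Rightarrow> bool" where
  "pt L n A a \<equiv> is_structure L A \<and> a \<in> tuples A n"

text \<open>Inclusion of \<Pi> types, the usual back-and-forth preorder; \<open>leq_back\<close>
  recovers its game description at positive levels.\<close>

definition leq :: "vocabulary \<Rightarrow> omega1 \<Rightarrow> struct \<Rightarrow> nat list \<Rightarrow> struct \<Rightarrow> nat list \<Rightarrow> bool" where
  "leq L \<alpha> A a B b \<longleftrightarrow> (\<forall>p\<in>formulas L (length a). Pi_in \<alpha> p \<longrightarrow> holds A a p \<longrightarrow> holds B b p)"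

lemma leq_iff:
  assumes "pt L n A a" "pt L n B b"
  shows "leq L \<alpha> A a B b \<longleftrightarrow> (\<forall>P. defP L \<alpha> n P \<longrightarrow> P A a \<longrightarrow> P B b)"
proof
  have len: "length a = n" using assms(1) tuples_length by blast
  assume l: "leq L \<alpha> A a B b"
  show "\<forall>P. defP L \<alpha> n P \<longrightarrow> P A a \<longrightarrow> P B b"
  proof (intro allI impI)
    fix P assume P: "defP L \<alpha> n P" "P A a"
    from P(1) obtain p where "p \<in> formulas L n" "Pi_in \<alpha> p"
      "\<forall>A. is_structure L A \<longrightarrow> (\<forall>a\<in>tuples A n. holds A a p \<longleftrightarrow> P A a)"
      unfolding defP_def by blast
    then show "P B b" using assms P(2) l unfolding leq_def len by blast
  qed
next
  assume r: "\<forall>P. defP L \<alpha> n P \<longrightarrow> P A a \<longrightarrow> P B b"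
  show "leq L \<alpha> A a B b"
    unfolding leq_def
  proof (intro ballI impI)
    fix p assume "p \<in> formulas L (length a)" "Pi_in \<alpha> p" "holds A a p"
    then show "holds B b p"
      using r[rule_format, OF defP_formula, of p] assms tuples_length[of a A n] by simp
  qed
qed

lemma leqD:
  "leq L \<alpha> A a B b \<Longrightarrow> pt L n A a \<Longrightarrow> pt L n B b \<Longrightarrow> defP L \<alpha> n P \<Longrightarrow> P A a \<Longrightarrow> P B b"
  using leq_iff by metis

lemma leqI:
  "pt L n A a \<Longrightarrow> pt L n B b \<Longrightarrow> (\<And>P. defP L \<alpha> n P \<Longrightarrow> P A a \<Longrightarrow> P B b) \<Longrightarrow> leq L \<alpha> A a B b"
  using leq_iff by metis

lemma leq_refl: "leq L \<alpha> A a A a"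
  by (simp add: leq_def)

lemma leq_trans:
  assumes "leq L \<alpha> A a B b" "leq L \<alpha> B b C c" "pt L n A a" "pt L n B b" "pt L n C c"
  shows "leq L \<alpha> A a C c"
  by (rule leqI[OF assms(3,5)]) (meson leqD assms)

lemma leq_mono:
  assumes "leq L \<alpha> A a B b" "\<beta> \<le> \<alpha>" "pt L n A a" "pt L n B b"
  shows "leq L \<beta> A a B b"
  by (rule leqI[OF assms(3,4)]) (meson leqD assms defP_mono)

text \<open>Strictly below \<open>\<alpha>\<close> both a \<Sigma> predicate and its negation are
  \<Pi> of level \<open>\<alpha>\<close>. Hence inclusion turns into agreement, and
  \<open>leq_rev\<close> can reverse the relation at the cost of one level.\<close>

lemma leq_D_S:
  assumes "leq L \<alpha> A a B b" "\<beta> < \<alpha>" "pt L n A a" "pt L n B b" "defS L \<beta> n P"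
  shows "P A a \<longleftrightarrow> P B b"
proof -
  have "defP L \<alpha> n P" using defP_of_defS[OF assms(5,2)] .
  moreover have "defP L \<alpha> n (\<lambda>A a. \<not> P A a)"
    using assms(2,5) by (intro defP_mono[of L \<beta> n _ \<alpha>]) (simp_all add: defP_neg)
  ultimately show ?thesis
    using leqD[OF assms(1,3,4), where P = P] leqD[OF assms(1,3,4), where P = "\<lambda>A a. \<not> P A a"]
    by blast
qed

lemma leq_rev:
  assumes "leq L \<alpha> A a B b" "\<beta> < \<alpha>" "pt L n A a" "pt L n B b"
  shows "leq L \<beta> B b A a"
proof (rule leqI[OF assms(4,3)])
  fix P assume "defP L \<beta> n P" "P B b"
  then show "P A a"
    using leq_D_S[OF assms, of "\<lambda>A a. \<not> P A a"] by (simp add: defS_neg)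
qed

lemma leq_subst:
  assumes "leq L \<alpha> A a B b" "pt L n A a" "pt L n B b" "\<And>i. i \<in> set is \<Longrightarrow> i < n"
  shows "leq L \<alpha> A (map ((!) a) is) B (map ((!) b) is)"
proof (rule leqI[where n = "length is"])
  show "pt L (length is) A (map ((!) a) is)" "pt L (length is) B (map ((!) b) is)"
    using assms tuples_map_nth by auto
  fix P assume "defP L \<alpha> (length is) P" "P A (map ((!) a) is)"
  then show "P B (map ((!) b) is)"
    using leqD[OF assms(1-3) defP_subst[OF _ refl assms(4)]] by blast
qed

lemma leq_take:
  assumes "leq L \<alpha> A a B b" "pt L n A a" "pt L n B b" "k \<le> n"
  shows "leq L \<alpha> A (take k a) B (take k b)"
  using leq_subst[OF assms(1-3), of "[0..<k]"] assms(4)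
    map_nth_take[of k a] map_nth_take[of k b] tuples_length[of a A n] tuples_length[of b B n] assms(2,3)
  by simp

lemma pt_append: "pt L n A a \<Longrightarrow> c \<in> tuples A m \<Longrightarrow> pt L (n + m) A (a @ c)"
  by (simp add: tuples_appendI)

text \<open>If every \<open>c\<close> in \<open>A\<close> failed, choose for each a \<Pi> predicate
  of level \<open>\<beta>\<close> true of \<open>b @ d\<close> and false of \<open>a @ c\<close>. As
  \<open>A\<close> is countable, their conjunction is again \<Pi> of level \<open>\<beta>\<close>,
  which uses \<open>0 < \<beta>\<close>. That no tuple of \<open>A\<close> satisfies it over
  \<open>a\<close> is a \<Pi> statement of level \<open>\<alpha>\<close>, hence true of
  \<open>b\<close> as well, contradicting \<open>d\<close>.\<close>

lemma leq_back:
  assumes l: "leq L \<alpha> A a B b" and A: "pt L n A a" and B: "pt L n B b"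
    and \<beta>: "0 < \<beta>" "\<beta> < \<alpha>" and d: "d \<in> tuples B m"
  shows "\<exists>c\<in>tuples A m. leq L \<beta> B (b @ d) A (a @ c)"
proof (rule ccontr)
  assume neg: "\<not> ?thesis"
  have "\<forall>c\<in>tuples A m. \<exists>P. defP L \<beta> (n + m) P \<and> P B (b @ d) \<and> \<not> P A (a @ c)"
    using neg leqI[OF pt_append[OF B d] pt_append[OF A]] by blast
  then obtain P where P: "\<And>c. c \<in> tuples A m \<Longrightarrow> defP L \<beta> (n + m) (P c) \<and> P c B (b @ d) \<and> \<not> P c A (a @ c)"
    by (metis (no_types))
  let ?Q = "\<lambda>N x. \<forall>i. list_decode i \<in> tuples A m \<longrightarrow> P (list_decode i) N x"
  have "defP L \<beta> (n + m) ?Q"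
    by (intro defP_all_nat defP_imp \<beta>) (simp add: P)
  from defS_Ex[OF defS_of_defP[OF this \<beta>(2)]]
  have "defS L \<alpha> n (\<lambda>N x. \<exists>c\<in>tuples N m. ?Q N (x @ c))" using \<beta> by (auto dest: less_trans)
  then have "defP L \<alpha> n (\<lambda>N x. \<not> (\<exists>c\<in>tuples N m. ?Q N (x @ c)))" by (simp only: defP_neg)
  moreover have "\<not> (\<exists>c\<in>tuples A m. ?Q A (a @ c))"
    using P by (metis list_encode_inverse)
  ultimately have "\<not> (\<exists>c\<in>tuples B m. ?Q B (b @ c))"
    by (rule leqD[OF l A B])
  then show False using d P by blast
qed

text \<open>The conjunction of one separating predicate for each tuple of \<open>M\<close> that
  violates the relation; countability of \<open>M\<close> keeps it at level
  \<open>\<gamma>\<close>.\<close>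

lemma ex_leq_formula:
  assumes t: "pt L n B t" and M: "is_structure L M" and "0 < \<gamma>"
  shows "\<exists>P. defP L \<gamma> n P \<and> P B t \<and> (\<forall>b\<in>tuples M n. P M b \<longleftrightarrow> leq L \<gamma> B t M b)"
proof -
  have "\<forall>b. b \<in> tuples M n \<and> \<not> leq L \<gamma> B t M b \<longrightarrow> (\<exists>P. defP L \<gamma> n P \<and> P B t \<and> \<not> P M b)"
    using leqI[OF t] M by blast
  then obtain P where P: "\<And>b. b \<in> tuples M n \<and> \<not> leq L \<gamma> B t M b \<Longrightarrow> defP L \<gamma> n (P b) \<and> P b B t \<and> \<not> P b M b"
    by (metis (no_types))
  let ?Q = "\<lambda>N x. \<forall>i. list_decode i \<in> tuples M n \<and> \<not> leq L \<gamma> B t M (list_decode i) \<longrightarrow> P (list_decode i) N x"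
  have Q: "defP L \<gamma> n ?Q"
    by (intro defP_all_nat defP_imp assms) (simp add: P)
  moreover have "?Q B t" using P by blast
  moreover have "?Q M b \<longleftrightarrow> leq L \<gamma> B t M b" if b: "b \<in> tuples M n" for b
  proof
    assume "?Q M b"
    then show "leq L \<gamma> B t M b" using P[of b] b by (metis list_encode_inverse)
  next
    assume l: "leq L \<gamma> B t M b"
    have ptb: "pt L n M b" using b M by simp
    show "?Q M b" using leqD[OF l t ptb Q] P by blast
  qed
  ultimately show ?thesis by (intro exI[of _ ?Q]) simp
qed

section \<open>Atomic equivalence\<close>

text \<open>Only unnested atomic formulas are compared, functions through their graphs. This
  suffices because a chain of tuples that exhausts the universe eventually contains the value of
  every term.\<close>

definition atomic_eq :: "vocabulary \<Rightarrow> struct \<Rightarrow> nat list \<Rightarrow> struct \<Rightarrow> nat list \<Rightarrow> bool" where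
  "atomic_eq L A a B b \<longleftrightarrow> length a = length b \<and>
    (\<forall>i j. i < length a \<and> j < length a \<longrightarrow> (a ! i = a ! j \<longleftrightarrow> b ! i = b ! j)) \<and>
    (\<forall>r is. r \<in> rel_syms L \<and> length is = rel_arity L r \<and> set is \<subseteq> {..<length a} \<longrightarrow>
       (rel_of A r (map ((!) a) is) \<longleftrightarrow> rel_of B r (map ((!) b) is))) \<and>
    (\<forall>f is j. f \<in> fun_syms L \<and> length is = fun_arity L f \<and> set is \<subseteq> {..<length a} \<and> j < length a \<longrightarrow>
       (fun_of A f (map ((!) a) is) = a ! j \<longleftrightarrow> fun_of B f (map ((!) b) is) = b ! j))"

lemma atomic_eqI:
  assumes "pt L n A a" "pt L n B b" "\<And>P. defS L 0 n P \<Longrightarrow> P A a \<longleftrightarrow> P B b"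
  shows "atomic_eq L A a B b"
proof -
  have len: "length a = n" "length b = n" using assms by (auto simp: tuples_length)
  show ?thesis unfolding atomic_eq_def len
  proof (intro conjI allI impI refl)
    fix i j assume "i < n \<and> j < n"
    then show "a ! i = a ! j \<longleftrightarrow> b ! i = b ! j"
      using assms(3)[OF defS_eq[of i n j]] by simp
  next
    fix r "is" assume "r \<in> rel_syms L \<and> length is = rel_arity L r \<and> set is \<subseteq> {..<n}"
    then show "rel_of A r (map ((!) a) is) \<longleftrightarrow> rel_of B r (map ((!) b) is)"
      using assms(3)[OF defS_rel[of r L "is" n]] by auto
  next
    fix f "is" j assume "f \<in> fun_syms L \<and> length is = fun_arity L f \<and> set is \<subseteq> {..<n} \<and> j < n"
    then show "fun_of A f (map ((!) a) is) = a ! j \<longleftrightarrow> fun_of B f (map ((!) b) is) = b ! j"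
      using assms(3)[OF defS_fun[of f L "is" n j]] by auto
  qed
qed

lemma leq_atomic_eq:
  assumes "leq L \<alpha> A a B b" "pt L n A a" "pt L n B b"
  shows "atomic_eq L A a B b"
proof (rule atomic_eqI[OF assms(2,3)])
  fix P assume "defS L 0 n P"
  then have "defP L 0 n P" "defP L 0 n (\<lambda>A a. \<not> P A a)" by (simp_all add: defP_0 defP_neg)
  then have "defP L \<alpha> n P" "defP L \<alpha> n (\<lambda>A a. \<not> P A a)" by (auto elim: defP_mono)
  then show "P A a \<longleftrightarrow> P B b"
    using leqD[OF assms, where P = P] leqD[OF assms, where P = "\<lambda>A a. \<not> P A a"] by blast
qed

lemma defP_iff_const:
  assumes "b \<Longrightarrow> defS L 0 n P"
  shows "defP L \<alpha> n (\<lambda>A a. b \<longrightarrow> (c \<longleftrightarrow> P A a))"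
proof (rule defP_imp)
  assume b
  then have "defP L 0 n P" "defP L 0 n (\<lambda>A a. \<not> P A a)" using assms by (simp_all add: defP_0 defP_neg)
  then have "defP L \<alpha> n P" "defP L \<alpha> n (\<lambda>A a. \<not> P A a)" by (auto elim: defP_mono)
  then show "defP L \<alpha> n (\<lambda>A a. c \<longleftrightarrow> P A a)" by (cases c) simp_all
qed

lemma all_nat_list: "(\<forall>k. P (list_decode k)) \<longleftrightarrow> (\<forall>xs. P xs)"
proof (intro iffI allI)
  fix xs assume "\<forall>k. P (list_decode k)"
  from spec[OF this, of "list_encode xs"] show "P xs" by simp
qed blast

lemma defP_all_list:
  assumes "\<And>xs::nat list. defP L \<alpha> n (P xs)" "0 < \<alpha>"
  shows "defP L \<alpha> n (\<lambda>A a. \<forall>xs. P xs A a)"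
  using defP_all_nat[of L \<alpha> n "\<lambda>k. P (list_decode k)"] assms
  by (simp add: all_nat_list[of "\<lambda>xs. P xs A a" for A a])

text \<open>The vocabulary may be infinite, so this is a countable conjunction and is placed at
  level 1 rather than 0. Here originates the hypothesis \<open>osuc 0 < \<beta>\<close> of
  \<open>atomic_at_scott\<close>.\<close>

lemma defP_atomic_eq:
  assumes "length a = n"
  shows "defP L (osuc 0) n (atomic_eq L M a)"
proof -
  have "defP L (osuc 0) n (\<lambda>N b.
    (\<forall>i j. i < n \<and> j < n \<longrightarrow> (a ! i = a ! j \<longleftrightarrow> b ! i = b ! j)) \<and>
    (\<forall>r is. r \<in> rel_syms L \<and> length is = rel_arity L r \<and> set is \<subseteq> {..<n} \<longrightarrow>
       (rel_of M r (map ((!) a) is) \<longleftrightarrow> rel_of N r (map ((!) b) is))) \<and>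
    (\<forall>f is j. f \<in> fun_syms L \<and> length is = fun_arity L f \<and> set is \<subseteq> {..<n} \<and> j < n \<longrightarrow>
       (fun_of M f (map ((!) a) is) = a ! j \<longleftrightarrow> fun_of N f (map ((!) b) is) = b ! j)))"
    by (intro defP_conj defP_all_nat defP_all_list defP_iff_const zero_less_osuc defS_eq defS_rel defS_fun)
      auto
  then show ?thesis
    by (rule defP_congI) (simp add: atomic_eq_def assms tuples_length)
qed

text \<open>The isomorphism is the union of the finite partial maps. Stages agree with each other,
  so everything about a finite list of elements can be read off at one stage that contains
  it.\<close>

lemma iso_of_chain:
  assumes A: "is_structure L A" and B: "is_structure L B"
    and at: "\<And>n. a n \<in> tuples A (length (a n))" "\<And>n. b n \<in> tuples B (length (b n))"
    and aeq: "\<And>n. atomic_eq L A (a n) B (b n)"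
    and ext: "\<And>n. \<exists>x. a (Suc n) = a n @ x" "\<And>n. \<exists>x. b (Suc n) = b n @ x"
    and cov: "\<And>x. x \<in> univ A \<Longrightarrow> \<exists>n. x \<in> set (a n)" "\<And>x. x \<in> univ B \<Longrightarrow> \<exists>n. x \<in> set (b n)"
  shows "\<exists>h. iso_map L h A B \<and> (\<forall>n. map h (a n) = b n)"
proof -
  have len: "length (a n) = length (b n)" for n using aeq[of n] by (simp add: atomic_eq_def)
  have pre: "\<exists>x. c m = c n @ x" if "n \<le> m" "\<And>n. \<exists>x. c (Suc n) = c n @ (x::nat list)" for n m c
    using that(1)
  proof (induction m rule: dec_induct)
    case (step m)
    then show ?case using that(2)[of m] by force
  qed simp
  have nth_pre: "c m ! i = c n ! i \<and> i < length (c m)"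
    if "n \<le> m" "\<And>n. \<exists>x. c (Suc n) = c n @ (x::nat list)" "i < length (c n)" for n m c i
    using pre[OF that(1), of c, OF that(2)] that(3) by (auto simp: nth_append)
  define h where "h x = (SOME y. \<exists>n i. i < length (a n) \<and> a n ! i = x \<and> b n ! i = y)" for x
  have eq: "a n ! i = a m ! j \<longleftrightarrow> b n ! i = b m ! j" if "i < length (a n)" "j < length (a m)" for n m i j
  proof -
    let ?k = "max n m"
    have "a ?k ! i = a n ! i \<and> i < length (a ?k)" "a ?k ! j = a m ! j \<and> j < length (a ?k)"
      using nth_pre[of n ?k a i] nth_pre[of m ?k a j] ext that by auto
    moreover have "b ?k ! i = b n ! i" "b ?k ! j = b m ! j"
      using nth_pre[of n ?k b i] nth_pre[of m ?k b j] ext that len by auto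
    ultimately show ?thesis using aeq[of ?k] unfolding atomic_eq_def by metis
  qed
  have h: "h (a n ! i) = b n ! i" if "i < length (a n)" for n i
  proof -
    have "\<exists>n' i'. i' < length (a n') \<and> a n' ! i' = a n ! i \<and> b n' ! i' = h (a n ! i)"
      unfolding h_def by (rule someI[where x = "b n ! i"]) (use that in blast)
    then show ?thesis using eq that by metis
  qed
  have hmap: "map h (a n) = b n" for n
    by (rule nth_equalityI) (simp_all add: len[symmetric] h)
  \<comment> \<open>A finite list occurs at a single stage, though scattered over its positions;
    \<open>is\<close> records them.\<close>
  have cov_list: "\<exists>n is. set is \<subseteq> {..<length (a n)} \<and> xs = map ((!) (a n)) is \<and> map h xs = map ((!) (b n)) is"
    if "set xs \<subseteq> univ A" for xs
    using that
  proof (induction xs)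
    case Nil
    show ?case by (rule exI[of _ 0], rule exI[of _ "[]"]) simp
  next
    case (Cons x xs)
    then obtain n "is" where 1: "set is \<subseteq> {..<length (a n)}" "xs = map ((!) (a n)) is"
      "map h xs = map ((!) (b n)) is" by auto
    obtain m i where 2: "i < length (a m)" "a m ! i = x"
      using cov(1)[of x] Cons.prems by (auto simp: in_set_conv_nth)
    let ?k = "max n m"
    have n1: "a ?k ! j = a n ! j \<and> j < length (a ?k)" "b ?k ! j = b n ! j" if "j \<in> set is" for j
      using nth_pre[of n ?k a j] nth_pre[of n ?k b j] ext that 1(1) len by (auto simp: subset_iff)
    have n2: "a ?k ! i = x \<and> i < length (a ?k)" "b ?k ! i = h x"
      using nth_pre[of m ?k a i] nth_pre[of m ?k b i] ext 2 len h[OF 2(1)] by auto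
    show ?case
      by (rule exI[of _ ?k], rule exI[of _ "i # is"]) (use 1 n1 n2 in \<open>auto simp del: map_map\<close>)
  qed
  have cov_one: "\<exists>n i. i < length (a n) \<and> x = a n ! i \<and> h x = b n ! i" if "x \<in> univ A" for x
    using cov(1)[OF that] h by (metis in_set_conv_nth)
  have mem: "h x \<in> univ B" if "x \<in> univ A" for x
    using cov_one[OF that] at(2) len by (metis tuples_nth)
  have bij: "bij_betw h (univ A) (univ B)"
    unfolding bij_betw_def
  proof (intro conjI inj_onI equalityI subsetI)
    fix x y assume xy: "x \<in> univ A" "y \<in> univ A" "h x = h y"
    then show "x = y" using cov_one[OF xy(1)] cov_one[OF xy(2)] eq by metis
  next
    fix y assume "y \<in> h ` univ A"
    then show "y \<in> univ B" using mem by auto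
  next
    fix y assume "y \<in> univ B"
    then obtain n where "y \<in> set (b n)" using cov(2) by blast
    then have "y \<in> h ` set (a n)" unfolding hmap[of n, symmetric] by simp
    then show "y \<in> h ` univ A" using at(1)[of n] by (auto simp: tuples_def)
  qed
  have "iso_map L h A B"
    unfolding iso_map_def
  proof (intro conjI ballI bij)
    fix r xs assume r: "r \<in> rel_syms L" "xs \<in> tuples A (rel_arity L r)"
    then obtain n "is" where "set is \<subseteq> {..<length (a n)}" "xs = map ((!) (a n)) is"
      "map h xs = map ((!) (b n)) is" using cov_list[of xs] by (auto simp: tuples_def)
    then show "rel_of B r (map h xs) \<longleftrightarrow> rel_of A r xs"
      using aeq[of n] r unfolding atomic_eq_def by (simp add: tuples_def del: map_map)
  next
    fix f xs assume f: "f \<in> fun_syms L" "xs \<in> tuples A (fun_arity L f)"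
    let ?y = "fun_of A f xs"
    have y: "?y \<in> univ A" using A f by (auto simp: is_structure_def)
    \<comment> \<open>The value is put in front of the arguments so that one stage contains all of
      them; only then can \<open>atomic_eq\<close> compare the graph of \<open>f\<close>.\<close>
    define ys where "ys = ?y # xs"
    have "set xs \<subseteq> univ A" using f(2) unfolding tuples_def by blast
    then have ys: "set ys \<subseteq> univ A" using y unfolding ys_def by simp
    from cov_list[OF ys] obtain n "is" where "set is \<subseteq> {..<length (a n)}" "ys = map ((!) (a n)) is"
      "map h ys = map ((!) (b n)) is" by (elim exE conjE)
    then have 1: "set is \<subseteq> {..<length (a n)}" "?y # xs = map ((!) (a n)) is"
      "map h (?y # xs) = map ((!) (b n)) is" by (simp_all only: ys_def)
    then obtain j js where js: "is = j # js" by (cases "is") auto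
    from 1(2) have e: "?y = a n ! j" "xs = map ((!) (a n)) js"
      unfolding js list.map list.inject by blast+
    from 1(3) have e': "h ?y = b n ! j" "map h xs = map ((!) (b n)) js"
      unfolding js list.map list.inject by blast+
    have l: "length js = fun_arity L f" using e(2) f(2) by (metis tuples_length length_map)
    have "fun_of A f (map ((!) (a n)) js) = a n ! j"
      using e(1) unfolding e(2)[symmetric] .
    then have "fun_of B f (map ((!) (b n)) js) = b n ! j"
      using aeq[of n] f(1) 1(1) js l unfolding atomic_eq_def by simp
    then show "fun_of B f (map h xs) = h ?y" unfolding e' .
  qed
  then show ?thesis using hmap by blast
qed

lemma iso_of_back_and_forth:
  assumes A: "is_structure L A" and B: "is_structure L B"
    and R: "\<And>a b. R a b \<Longrightarrow> a \<in> tuples A (length a) \<and> b \<in> tuples B (length b) \<and> atomic_eq L A a B b"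
    and forth: "\<And>a b c. R a b \<Longrightarrow> c \<in> univ A \<Longrightarrow> \<exists>d. R (a @ [c]) (b @ [d])"
    and backw: "\<And>a b d. R a b \<Longrightarrow> d \<in> univ B \<Longrightarrow> \<exists>c. R (a @ [c]) (b @ [d])"
    and start: "R a0 b0"
  shows "\<exists>h. iso_map L h A B \<and> map h a0 = b0"
proof -
  \<comment> \<open>Universes are sets of natural numbers, so stage \<open>n\<close> can simply put
    \<open>n\<close> itself into domain and range when it belongs there.\<close>
  define good where "good n p q \<longleftrightarrow> (\<exists>x. fst q = fst p @ x) \<and> (\<exists>x. snd q = snd p @ x) \<and>
     (n \<in> univ A \<longrightarrow> n \<in> set (fst q)) \<and> (n \<in> univ B \<longrightarrow> n \<in> set (snd q))"
     for n :: nat and p q :: "nat list \<times> nat list"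
  have "\<exists>s. \<forall>n. (R (fst (s n)) (snd (s n)) \<and> (n = 0 \<longrightarrow> s n = (a0, b0))) \<and> good n (s n) (s (Suc n))"
  proof (rule dependent_nat_choice)
    show "\<exists>p. R (fst p) (snd p) \<and> (0 = 0 \<longrightarrow> p = (a0, b0))" using start by auto
  next
    fix p and n :: nat assume "R (fst p) (snd p) \<and> (n = 0 \<longrightarrow> p = (a0, b0))"
    then have p: "R (fst p) (snd p)" by simp
    obtain a b where 1: "R a b" "\<exists>x. a = fst p @ x" "\<exists>x. b = snd p @ x" "n \<in> univ A \<longrightarrow> n \<in> set a"
    proof (cases "n \<in> univ A")
      case True
      then obtain d where "R (fst p @ [n]) (snd p @ [d])" using forth p by blast
      then show thesis using that by auto
    next
      case False
      then show thesis using that[of "fst p" "snd p"] p by auto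
    qed
    obtain a' b' where 2: "R a' b'" "\<exists>x. a' = a @ x" "\<exists>x. b' = b @ x" "n \<in> univ B \<longrightarrow> n \<in> set b'"
    proof (cases "n \<in> univ B")
      case True
      then obtain c where "R (a @ [c]) (b @ [n])" using backw 1(1) by blast
      then show thesis using that by auto
    next
      case False
      then show thesis using that[of a b] 1(1) by auto
    qed
    show "\<exists>q. (R (fst q) (snd q) \<and> (Suc n = 0 \<longrightarrow> q = (a0, b0))) \<and> good n p q"
      by (rule exI[of _ "(a', b')"]) (use 1 2 in \<open>auto simp: good_def\<close>)
  qed
  then obtain s where s: "\<And>n. R (fst (s n)) (snd (s n))" "s 0 = (a0, b0)" "\<And>n. good n (s n) (s (Suc n))"
    by metis
  have "\<exists>h. iso_map L h A B \<and> (\<forall>n. map h (fst (s n)) = snd (s n))"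
  proof (rule iso_of_chain[OF A B])
    fix x assume "x \<in> univ A"
    then show "\<exists>n. x \<in> set (fst (s n))" using s(3)[of x] unfolding good_def by blast
  next
    fix x assume "x \<in> univ B"
    then show "\<exists>n. x \<in> set (snd (s n))" using s(3)[of x] unfolding good_def by blast
  qed (use R[OF s(1)] s(3) in \<open>simp_all add: good_def\<close>)
  then show ?thesis using s(2) by (metis fst_conv snd_conv)
qed

section \<open>Structures with isolated types and their Scott sentences\<close>

section \<open>Atomic structures and Scott sentences\<close>

lemma Sigma_type_eqI:
  assumes "pt L n A a" "pt L n B b" "\<And>P. defS L \<beta> n P \<Longrightarrow> P A a \<longleftrightarrow> P B b"
  shows "Sigma_type L \<beta> A a = Sigma_type L \<beta> B b"
proof -
  have len: "length a = n" "length b = n" using assms(1,2) tuples_length by blast+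
  show ?thesis
    unfolding Sigma_type_def len using assms(3)[OF defS_formula] by blast
qed

lemma Sigma_type_subsetD:
  assumes "Sigma_type L \<beta> A a \<subseteq> Sigma_type L \<beta> B b" "pt L n A a" "pt L n B b" "defS L \<beta> n P" "P A a"
  shows "P B b"
proof -
  have len: "length a = n" "length b = n" using assms(2,3) tuples_length by blast+
  obtain p where p: "p \<in> formulas L n" "Sigma_in \<beta> p"
    "\<forall>A. is_structure L A \<longrightarrow> (\<forall>a\<in>tuples A n. holds A a p \<longleftrightarrow> P A a)"
    using assms(4) unfolding defS_def by blast
  then have "p \<in> Sigma_type L \<beta> A a" using assms(2,5) len by (simp add: Sigma_type_def)
  then have "holds B b p" using assms(1) by (auto simp: Sigma_type_def)
  then show ?thesis using p(3) assms(3) by blast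
qed

lemma Sigma_type_eqD:
  assumes "Sigma_type L \<beta> A a = Sigma_type L \<beta> B b" "pt L n A a" "pt L n B b" "defS L \<beta> n P"
  shows "P A a \<longleftrightarrow> P B b"
  using Sigma_type_subsetD[OF _ assms(2,3,4)] Sigma_type_subsetD[OF _ assms(3,2,4)] assms(1) by blast

lemma Sigma_type_iso:
  assumes "iso_map L h A B" "is_structure L A" "a \<in> tuples A n"
  shows "Sigma_type L \<beta> B (map h a) = Sigma_type L \<beta> A a"
  unfolding Sigma_type_def using holds_iso[OF assms] tuples_length[OF assms(3)] by auto

text \<open>This is atomicity with respect to \<open>\<Sigma>\<^sub>\<beta>\<close> types: an
  isolating formula can always be cut down to one of its disjuncts, an existential block over a
  \<Pi> matrix. The matrix is kept visible because the Scott sentence is built from it.\<close>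

definition atomic_at :: "vocabulary \<Rightarrow> omega1 \<Rightarrow> struct \<Rightarrow> bool" where
  "atomic_at L \<beta> M \<longleftrightarrow> (\<forall>n. \<forall>a\<in>tuples M n. \<exists>m \<gamma> P. \<gamma> < \<beta> \<and> defP L \<gamma> (n + m) P \<and>
     (\<exists>c\<in>tuples M m. P M (a @ c)) \<and>
     (\<forall>b\<in>tuples M n. \<forall>c\<in>tuples M m. P M (b @ c) \<longrightarrow> Sigma_type L \<beta> M b = Sigma_type L \<beta> M a))"

lemma atomic_at_support:
  assumes "atomic_at L \<beta> M" "a \<in> tuples M n"
  shows "\<exists>S. defS L \<beta> n S \<and> S M a \<and>
    (\<forall>b\<in>tuples M n. S M b \<longrightarrow> Sigma_type L \<beta> M b = Sigma_type L \<beta> M a)"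
proof -
  obtain m \<gamma> P where P: "\<gamma> < \<beta>" "defP L \<gamma> (n + m) P" "\<exists>c\<in>tuples M m. P M (a @ c)"
     "\<forall>b\<in>tuples M n. \<forall>c\<in>tuples M m. P M (b @ c) \<longrightarrow> Sigma_type L \<beta> M b = Sigma_type L \<beta> M a"
    using assms unfolding atomic_at_def by blast
  have "0 < \<beta>" using P(1) le_less_trans zero_le_omega1 by blast
  from defS_Ex[OF defS_of_defP[OF P(2,1)] this]
  have "defS L \<beta> n (\<lambda>N b. \<exists>c\<in>tuples N m. P N (b @ c))" .
  then show ?thesis using P(3,4) by blast
qed

text \<open>\<open>S\<close> isolates the type of \<open>a @ c\<close> in \<open>A\<close>; some
  \<open>d\<close> satisfies it in \<open>K\<close>, and \<open>T\<close> isolates the type of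
  \<open>k @ d\<close> there. Pulling \<open>S\<close> and \<open>T\<close> back together gives
  \<open>c'\<close> with the type of \<open>a @ c\<close>, so \<open>T\<close> already holds of
  \<open>a @ c\<close>. Each of the two tuples now satisfies both isolating formulas, which
  transfers any further formula.\<close>

lemma atomic_at_forth:
  assumes A: "atomic_at L \<beta> A" "is_structure L A" and K: "atomic_at L \<beta> K" "is_structure L K"
    and a: "a \<in> tuples A n" and k: "k \<in> tuples K n" and eq: "Sigma_type L \<beta> A a = Sigma_type L \<beta> K k"
    and \<beta>: "0 < \<beta>" and c: "c \<in> tuples A m"
  shows "\<exists>d\<in>tuples K m. Sigma_type L \<beta> A (a @ c) = Sigma_type L \<beta> K (k @ d)"
proof -
  have pa: "pt L n A a" and pk: "pt L n K k" using a k A K by auto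
  have ac: "pt L (n + m) A (a @ x)" if "x \<in> tuples A m" for x using pt_append[OF pa that] .
  have kd: "pt L (n + m) K (k @ x)" if "x \<in> tuples K m" for x using pt_append[OF pk that] .
  have transfer: "(\<exists>x\<in>tuples A m. P A (a @ x)) \<longleftrightarrow> (\<exists>x\<in>tuples K m. P K (k @ x))"
    if "defS L \<beta> (n + m) P" for P
    using Sigma_type_eqD[OF eq pa pk defS_Ex[OF that \<beta>]] .
  obtain S where S: "defS L \<beta> (n + m) S" "S A (a @ c)"
    "\<And>x. x \<in> tuples A (n + m) \<Longrightarrow> S A x \<Longrightarrow> Sigma_type L \<beta> A x = Sigma_type L \<beta> A (a @ c)"
    using atomic_at_support[OF A(1), of "a @ c" "n + m"] ac[OF c] by blast
  obtain d where d: "d \<in> tuples K m" "S K (k @ d)" using transfer[OF S(1)] S(2) c by blast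
  obtain T where T: "defS L \<beta> (n + m) T" "T K (k @ d)"
    "\<And>x. x \<in> tuples K (n + m) \<Longrightarrow> T K x \<Longrightarrow> Sigma_type L \<beta> K x = Sigma_type L \<beta> K (k @ d)"
    using atomic_at_support[OF K(1), of "k @ d" "n + m"] kd[OF d(1)] by blast
  obtain c' where c': "c' \<in> tuples A m" "S A (a @ c')" "T A (a @ c')"
    using transfer[OF defS_conj[OF S(1) T(1)]] d T(2) by blast
  have "Sigma_type L \<beta> A (a @ c') = Sigma_type L \<beta> A (a @ c)" using S(3) ac c' by blast
  from Sigma_type_eqD[OF this ac[OF c'(1)] ac[OF c] T(1)] have Tc: "T A (a @ c)" using c'(3) by blast
  have "Sigma_type L \<beta> A (a @ c) = Sigma_type L \<beta> K (k @ d)"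
  proof (rule Sigma_type_eqI[OF ac[OF c] kd[OF d(1)]])
    fix P assume P: "defS L \<beta> (n + m) P"
    show "P A (a @ c) \<longleftrightarrow> P K (k @ d)"
    proof
      assume "P A (a @ c)"
      then obtain x where x: "x \<in> tuples K m" "P K (k @ x)" "T K (k @ x)"
        using transfer[OF defS_conj[OF P T(1)]] Tc c by blast
      then have "Sigma_type L \<beta> K (k @ x) = Sigma_type L \<beta> K (k @ d)" using T(3) kd by blast
      from Sigma_type_eqD[OF this kd[OF x(1)] kd[OF d(1)] P] show "P K (k @ d)" using x(2) by blast
    next
      assume "P K (k @ d)"
      then obtain x where x: "x \<in> tuples A m" "P A (a @ x)" "S A (a @ x)"
        using transfer[OF defS_conj[OF P S(1)]] d by blast
      then have "Sigma_type L \<beta> A (a @ x) = Sigma_type L \<beta> A (a @ c)" using S(3) ac by blast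
      from Sigma_type_eqD[OF this ac[OF x(1)] ac[OF c] P] show "P A (a @ c)" using x(2) by blast
    qed
  qed
  then show ?thesis using d(1) by blast
qed

lemma tuples_1: "tuples A (Suc 0) = (\<lambda>d. [d]) ` univ A"
  by (auto simp: tuples_def length_Suc_conv)

lemma Sigma_type_atomic_eq:
  assumes "Sigma_type L \<beta> A a = Sigma_type L \<beta> B b" "pt L n A a" "pt L n B b"
  shows "atomic_eq L A a B b"
  by (rule atomic_eqI[OF assms(2,3)]) (rule Sigma_type_eqD[OF assms], erule defS_mono, simp)

lemma atomic_at_iso:
  assumes A: "atomic_at L \<beta> A" "is_structure L A" and K: "atomic_at L \<beta> K" "is_structure L K"
    and a: "a \<in> tuples A n" and k: "k \<in> tuples K n" and eq: "Sigma_type L \<beta> A a = Sigma_type L \<beta> K k"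
    and \<beta>: "0 < \<beta>"
  shows "\<exists>h. iso_map L h A K \<and> map h a = k"
proof -
  define R where "R a b \<longleftrightarrow> length a = length b \<and> a \<in> tuples A (length a) \<and> b \<in> tuples K (length b) \<and>
    Sigma_type L \<beta> A a = Sigma_type L \<beta> K b" for a b
  show ?thesis
  proof (rule iso_of_back_and_forth[of L A K R])
    fix a b assume R: "R a b"
    then show "a \<in> tuples A (length a) \<and> b \<in> tuples K (length b) \<and> atomic_eq L A a K b"
      using Sigma_type_atomic_eq[of L \<beta> A a K b "length a"] A(2) K(2) unfolding R_def by metis
    {
      fix c assume "c \<in> univ A"
      then have "[c] \<in> tuples A (Suc 0)" by (simp add: tuples_1)
      with R obtain d where "d \<in> tuples K (Suc 0)" "Sigma_type L \<beta> A (a @ [c]) = Sigma_type L \<beta> K (b @ d)"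
        using atomic_at_forth[OF A K, of a "length a" b] \<beta> unfolding R_def by metis
      then show "\<exists>d. R (a @ [c]) (b @ [d])"
        using R \<open>c \<in> univ A\<close> unfolding tuples_1 by (auto simp: R_def tuples_def)
    next
      fix d assume "d \<in> univ K"
      then have "[d] \<in> tuples K (Suc 0)" by (simp add: tuples_1)
      with R obtain c where "c \<in> tuples A (Suc 0)" "Sigma_type L \<beta> K (b @ [d]) = Sigma_type L \<beta> A (a @ c)"
        using atomic_at_forth[OF K A, of b "length b" a] \<beta> unfolding R_def by metis
      then show "\<exists>c. R (a @ [c]) (b @ [d])"
        using R \<open>d \<in> univ K\<close> unfolding tuples_1 by (auto simp: R_def tuples_def)
    }
  qed (use A K a k eq tuples_length in \<open>auto simp: R_def\<close>)
qed

lemma atomic_at_aut: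
  assumes "atomic_at L \<beta> A" "is_structure L A" "a \<in> tuples A n" "b \<in> tuples A n"
    "Sigma_type L \<beta> A a = Sigma_type L \<beta> A b" "0 < \<beta>" "p \<in> formulas L n"
  shows "holds A a p \<longleftrightarrow> holds A b p"
  using atomic_at_iso[OF assms(1,2,1,2,3-6)] holds_iso[OF _ assms(2,3,7)] by blast

lemma scott_sentenceI:
  assumes M: "is_structure L M" and S: "defP L \<alpha> 0 S" "S M []"
    and iso: "\<And>N. is_structure L N \<Longrightarrow> S N [] \<Longrightarrow> isomorphic L M N"
  shows "\<exists>p. scott_sentence L M p \<and> Pi_in \<alpha> p"
proof -
  obtain p where p: "p \<in> sentences L" "Pi_in \<alpha> p" "\<And>A. is_structure L A \<Longrightarrow> holds A [] p \<longleftrightarrow> S A []"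
    using S(1) unfolding defP_def by (auto simp: tuples_0)
  have "models L p = copies L M"
  proof (intro equalityI subsetI)
    fix N assume "N \<in> models L p"
    then show "N \<in> copies L M" using iso p(3) unfolding models_def copies_def by blast
  next
    fix N assume N: "N \<in> copies L M"
    then have "holds N [] p"
      using holds_sentence_iso[OF _ M p(1)] p(3)[OF M] S(2) by (auto simp: copies_def)
    then show "N \<in> models L p" using N by (simp add: models_def copies_def)
  qed
  then show ?thesis using p by (auto simp: scott_sentence_def)
qed

text \<open>
  The hypothesis of each clause of the Scott sentence is one of the \<open>\<Pi>\<^sub>\<gamma>\<close> formulas, \<open>\<gamma> < \<beta>\<close>, and not
  the \<open>\<Sigma>\<^sub>\<beta>\<close> formula defining the orbit; this is what keeps the sentence \<open>\<Pi>\<^sub>\<beta>\<^sub>+\<^sub>1\<close>.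
\<close>

lemma atomic_at_scott:
  assumes M: "atomic_at L \<beta> M" "is_structure L M" and \<beta>: "osuc 0 < \<beta>"
  shows "\<exists>S. scott_sentence L M S \<and> Pi_in (osuc \<beta>) S"
proof -
  have \<beta>0: "0 < \<beta>" using \<beta> less_trans zero_less_osuc by blast
  have "\<forall>a. a \<in> tuples M (length a) \<longrightarrow> (\<exists>m \<gamma> P. \<gamma> < \<beta> \<and> defP L \<gamma> (length a + m) P \<and>
     (\<exists>c\<in>tuples M m. P M (a @ c)) \<and>
     (\<forall>b\<in>tuples M (length a). \<forall>c\<in>tuples M m. P M (b @ c) \<longrightarrow> Sigma_type L \<beta> M b = Sigma_type L \<beta> M a))"
    using M(1) unfolding atomic_at_def by blast
  then obtain m \<gamma> P where ex: "\<forall>a. a \<in> tuples M (length a) \<longrightarrow> \<gamma> a < \<beta> \<and> defP L (\<gamma> a) (length a + m a) (P a) \<and>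
     (\<exists>c\<in>tuples M (m a). P a M (a @ c)) \<and>
     (\<forall>b\<in>tuples M (length a). \<forall>c\<in>tuples M (m a). P a M (b @ c) \<longrightarrow> Sigma_type L \<beta> M b = Sigma_type L \<beta> M a)"
    unfolding choice_iff' by (elim exE)
  have P: "\<gamma> a < \<beta>" "defP L (\<gamma> a) (length a + m a) (P a)" "\<exists>c\<in>tuples M (m a). P a M (a @ c)"
    "\<And>b c. b \<in> tuples M (length a) \<Longrightarrow> c \<in> tuples M (m a) \<Longrightarrow> P a M (b @ c) \<Longrightarrow>
       Sigma_type L \<beta> M b = Sigma_type L \<beta> M a" if "a \<in> tuples M (length a)" for a
    using ex that by blast+
  define S where "S a N b \<longleftrightarrow> (\<exists>c\<in>tuples N (m a). P a N (b @ c))" for a N b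
  have defS_S: "defS L \<beta> (length a) (S a)" if "a \<in> tuples M (length a)" for a
    unfolding S_def using defS_Ex[OF defS_of_defP[OF P(2,1)] \<beta>0] that by blast
  have snoc: "a @ [c] \<in> tuples M (length (a @ [c]))" if "a \<in> tuples M (length a)" "c \<in> univ M" for a c
    using that by (simp add: tuples_def)
  have nP: "defS L \<beta> (length a + m a) (\<lambda>N x. \<not> P a N x)" if "a \<in> tuples M (length a)" for a
    using defS_mono[of L "\<gamma> a" _ "\<lambda>N x. \<not> P a N x" \<beta>] P(1,2)[OF that] by (simp add: defS_neg)
  \<comment> \<open>\<open>x\<close> is a tuple matched with \<open>a\<close> followed by a witness
    for the matrix \<open>P a\<close>, and in \<open>E3\<close> by one more element. The three
    clauses express atomic agreement, the forth step and the back step; each is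
    \<open>\<Sigma>\<^sub>\<beta>\<close>.\<close>
  define E1 where "E1 a N x \<longleftrightarrow> \<not> P a N x \<or> atomic_eq L M a N (take (length a) x)" for a N x
  define E2 where "E2 a c N x \<longleftrightarrow> \<not> P a N x \<or> (\<exists>d\<in>tuples N 1. S (a @ [c]) N (take (length a) x @ d))" for a c N x
  define E3 where "E3 a N x \<longleftrightarrow> \<not> P a N (take (length a + m a) x) \<or>
     (\<exists>c. c \<in> univ M \<and> S (a @ [c]) N (take (length a) x @ [x ! (length a + m a)]))" for a N x
  have E1: "defS L \<beta> (length a + m a) (E1 a)" if a: "a \<in> tuples M (length a)" for a
  proof -
    have "defS L \<beta> (length a) (atomic_eq L M a)"
      using defS_of_defP[OF defP_atomic_eq[OF refl] \<beta>] .
    then have "defS L \<beta> (length a + m a) (\<lambda>N x. atomic_eq L M a N (take (length a) x))"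
      by (rule defS_subst_append[where js = "[0..<length a]"]) (auto simp: tuples_def map_nth_take)
    from defS_disj[OF nP[OF a] this] show ?thesis unfolding E1_def .
  qed
  have E2: "defS L \<beta> (length a + m a) (E2 a c)" if a: "a \<in> tuples M (length a)" "c \<in> univ M" for a c
  proof -
    have "defS L \<beta> (length a + m a + 1) (\<lambda>N x. S (a @ [c]) N (take (length a) x @ drop (length a + m a) x))"
      by (rule defS_subst_append[OF defS_S[OF snoc[OF a]], where js = "[0..<length a] @ [length a + m a]"])
        (auto simp: tuples_def nth_append less_Suc_eq intro!: nth_equalityI)
    from defS_Ex[OF this \<beta>0] have "defS L \<beta> (length a + m a) (\<lambda>N x. \<exists>d\<in>tuples N 1.
       S (a @ [c]) N (take (length a) (x @ d) @ drop (length a + m a) (x @ d)))" .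
    then have "defS L \<beta> (length a + m a) (\<lambda>N x. \<exists>d\<in>tuples N 1. S (a @ [c]) N (take (length a) x @ d))"
      by (rule defS_congI) (auto simp: tuples_def)
    from defS_disj[OF nP[OF a(1)] this] show ?thesis unfolding E2_def .
  qed
  have E3: "defS L \<beta> (length a + m a + 1) (E3 a)" if a: "a \<in> tuples M (length a)" for a
  proof -
    have 1: "defS L \<beta> (length a + m a + 1) (\<lambda>N x. \<not> P a N (take (length a + m a) x))"
      by (rule defS_subst_append[OF nP[OF a], where js = "[0..<length a + m a]"])
        (auto simp: tuples_def map_nth_take simp del: upt_add_eq_append)
    have "defS L \<beta> (length a + m a + 1) (\<lambda>N x. S (a @ [c]) N (take (length a) x @ [x ! (length a + m a)]))"
      if c: "c \<in> univ M" for c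
      by (rule defS_subst_append[OF defS_S[OF snoc[OF a c]], where js = "[0..<length a] @ [length a + m a]"])
        (auto simp: tuples_def map_nth_take)
    then have "defS L \<beta> (length a + m a + 1) (\<lambda>N x.
        \<exists>c. c \<in> univ M \<and> S (a @ [c]) N (take (length a) x @ [x ! (length a + m a)]))"
      by (intro defS_ex_nat defS_conjI \<beta>0)
    from defS_disj[OF 1 this] show ?thesis unfolding E3_def .
  qed
  define T where "T N y \<longleftrightarrow> S [] N y \<and> (\<forall>a. a \<in> tuples M (length a) \<longrightarrow>
     (\<forall>x\<in>tuples N (length a + m a). E1 a N (y @ x)) \<and>
     (\<forall>c. c \<in> univ M \<longrightarrow> (\<forall>x\<in>tuples N (length a + m a). E2 a c N (y @ x))) \<and>
     (\<forall>x\<in>tuples N (length a + m a + 1). E3 a N (y @ x)))" for N y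
  have nil: "[] \<in> tuples M (length [])" by (simp add: tuples_def)
  have "defP L (osuc \<beta>) 0 T"
    unfolding T_def
  proof (intro defP_conj defP_all_list defP_imp defP_all_nat zero_less_osuc)
    show "defP L (osuc \<beta>) 0 (S [])" using defP_of_defS[OF defS_S[OF nil]] by simp
  next
    fix a assume a: "a \<in> tuples M (length a)"
    show "defP L (osuc \<beta>) 0 (\<lambda>N y. \<forall>x\<in>tuples N (length a + m a). E1 a N (y @ x))"
      by (rule defP_All) (use defP_of_defS[OF E1[OF a], of "osuc \<beta>"] in simp_all)
    show "defP L (osuc \<beta>) 0 (\<lambda>N y. \<forall>x\<in>tuples N (length a + m a + 1). E3 a N (y @ x))"
      by (rule defP_All) (use defP_of_defS[OF E3[OF a], of "osuc \<beta>"] in simp_all)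
    fix c assume c: "c \<in> univ M"
    show "defP L (osuc \<beta>) 0 (\<lambda>N y. \<forall>x\<in>tuples N (length a + m a). E2 a c N (y @ x))"
      by (rule defP_All) (use defP_of_defS[OF E2[OF a c], of "osuc \<beta>"] in simp_all)
  qed
  moreover have "T M []"
    unfolding T_def
  proof (intro conjI allI impI ballI)
    show "S [] M []" using P(3)[OF nil] by (simp add: S_def)
  next
    fix a assume a: "a \<in> tuples M (length a)"
    have pa: "pt L (length a) M a" using a M by simp
    have type: "Sigma_type L \<beta> M (take (length a) x) = Sigma_type L \<beta> M a \<and> pt L (length a) M (take (length a) x)"
      if "x \<in> tuples M (length a + m a)" "P a M x" for x
    proof -
      have "take (length a) x \<in> tuples M (length a)" "drop (length a) x \<in> tuples M (m a)"
        using that(1) by (auto simp: tuples_def dest: in_set_takeD in_set_dropD)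
      then show ?thesis using P(4)[OF a, of "take (length a) x" "drop (length a) x"] that(2) M(2) by simp
    qed
    have Sext: "S (a @ [c]) M (a @ [c])" if "c \<in> univ M" for c
      using P(3)[OF snoc[OF a that]] by (simp add: S_def)
    {
      fix x assume x: "x \<in> tuples M (length a + m a)"
      show "E1 a M ([] @ x)"
        unfolding E1_def using type[OF x] Sigma_type_atomic_eq[of L \<beta> M a M "take (length a) x"] pa by auto
    next
      fix c x assume c: "c \<in> univ M" and x: "x \<in> tuples M (length a + m a)"
      have "\<exists>d\<in>tuples M 1. S (a @ [c]) M (take (length a) x @ d)" if Px: "P a M x"
      proof -
        have "defS L \<beta> (length a + 1) (S (a @ [c]))" using defS_S[OF snoc[OF a c]] by simp
        from Sigma_type_eqD[OF _ _ _ defS_Ex[OF this \<beta>0], of M "take (length a) x" M a]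
        have "(\<exists>d\<in>tuples M 1. S (a @ [c]) M (take (length a) x @ d)) \<longleftrightarrow> (\<exists>d\<in>tuples M 1. S (a @ [c]) M (a @ d))"
          using type[OF x Px] pa by blast
        moreover have "[c] \<in> tuples M 1" using c by (simp add: tuples_def)
        ultimately show ?thesis using Sext[OF c] by blast
      qed
      then show "E2 a c M ([] @ x)" unfolding E2_def by auto
    next
      fix x assume x: "x \<in> tuples M (length a + m a + 1)"
      let ?x = "take (length a + m a) x" and ?y = "x ! (length a + m a)"
      have x': "?x \<in> tuples M (length a + m a)" and y: "?y \<in> univ M"
        using x by (auto simp: tuples_def dest: in_set_takeD)
      have "\<exists>c. c \<in> univ M \<and> S (a @ [c]) M (take (length a) x @ [?y])" if Px: "P a M ?x"
      proof -
        have t: "take (length a) ?x = take (length a) x" by simp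
        have ty: "Sigma_type L \<beta> M (take (length a) x) = Sigma_type L \<beta> M a" "pt L (length a) M (take (length a) x)"
          using type[OF x' Px] unfolding t by simp_all
        have y1: "[?y] \<in> tuples M (Suc 0)" using y by (simp add: tuples_1)
        from ty(2) have "take (length a) x \<in> tuples M (length a)" by simp
        from atomic_at_forth[OF M M this a ty(1) \<beta>0 y1] obtain c where
          c: "c \<in> univ M" "Sigma_type L \<beta> M (take (length a) x @ [?y]) = Sigma_type L \<beta> M (a @ [c])"
          by (auto simp: tuples_1)
        have "S (a @ [c]) M (take (length a) x @ [?y])"
          using Sigma_type_eqD[OF c(2) _ _ defS_S[OF snoc[OF a c(1)]]] Sext[OF c(1)]
            pt_append[OF ty(2) y1] pt_append[OF pa, of "[c]" "Suc 0"] c(1) by (simp add: tuples_1)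
        then show ?thesis using c(1) by blast
      qed
      then show "E3 a M ([] @ x)" unfolding E3_def by auto
    }
  qed
  moreover have "isomorphic L M N" if N: "is_structure L N" and T: "T N []" for N
  proof -
    define R where "R a b \<longleftrightarrow> length a = length b \<and> a \<in> tuples M (length a) \<and> b \<in> tuples N (length b) \<and> S a N b" for a b
    have "\<exists>h. iso_map L h M N \<and> map h [] = []"
    proof (rule iso_of_back_and_forth[OF M(2) N, of R])
      fix a b assume R: "R a b"
      then have a: "a \<in> tuples M (length a)" and b: "b \<in> tuples N (length a)" and len: "length b = length a"
        unfolding R_def by metis+
      obtain z where z: "z \<in> tuples N (m a)" "P a N (b @ z)" using R by (auto simp: R_def S_def)
      have bz: "b @ z \<in> tuples N (length a + m a)" using tuples_appendI[OF b z(1)] .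
      have "E1 a N (b @ z)" using T a bz unfolding T_def by fastforce
      then show "a \<in> tuples M (length a) \<and> b \<in> tuples N (length b) \<and> atomic_eq L M a N b"
        using z(2) a b len[symmetric] by (simp add: E1_def)
      {
        fix c assume c: "c \<in> univ M"
        then have "E2 a c N (b @ z)" using T a bz unfolding T_def by fastforce
        then obtain d where "d \<in> tuples N 1" "S (a @ [c]) N (b @ d)"
          using z(2) len by (auto simp: E2_def)
        then show "\<exists>d. R (a @ [c]) (b @ [d])"
          using a b c len unfolding One_nat_def tuples_1 by (auto simp: R_def tuples_def)
      next
        fix d assume d: "d \<in> univ N"
        then have "b @ z @ [d] \<in> tuples N (length a + m a + 1)" using bz by (auto simp: tuples_def)
        then have "E3 a N (b @ z @ [d])" using T a unfolding T_def by fastforce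
        moreover have "(b @ z @ [d]) ! (length a + m a) = d" "take (length a + m a) (b @ z @ [d]) = b @ z"
          "take (length a) (b @ z @ [d]) = b"
          using len z(1) by (simp_all add: tuples_def nth_append)
        ultimately obtain c where "c \<in> univ M" "S (a @ [c]) N (b @ [d])"
          using z(2) unfolding E3_def by metis
        then show "\<exists>c. R (a @ [c]) (b @ [d])"
          using a b d len by (auto simp: R_def tuples_def)
      }
    next
      show "R [] []" using T by (simp add: R_def T_def tuples_def)
    qed
    then show ?thesis by (auto simp: isomorphic_iff)
  qed
  ultimately show ?thesis by (intro scott_sentenceI[OF M(2)])
qed

lemma cSR_le: "scott_sentence L A S \<Longrightarrow> Pi_in (osuc \<alpha>) S \<Longrightarrow> cSR L A \<le> \<alpha>"
  unfolding cSR_def by (rule Least_le) blast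

text \<open>If agreement at level \<open>\<delta>\<close> determines the complete type, then the
  predicate of \<open>ex_leq_formula\<close> isolates it, with an empty witness tuple; being \<Pi>
  of level \<open>\<delta>\<close> it falls below \<open>osuc \<delta>\<close>.\<close>

lemma atomic_at_osucI:
  assumes M: "is_structure L M" and \<delta>: "0 < \<delta>"
    and leq: "\<And>n a b p. a \<in> tuples M n \<Longrightarrow> b \<in> tuples M n \<Longrightarrow> leq L \<delta> M a M b \<Longrightarrow>
      p \<in> formulas L n \<Longrightarrow> holds M a p \<longleftrightarrow> holds M b p"
  shows "atomic_at L (osuc \<delta>) M"
  unfolding atomic_at_def
proof (intro allI ballI)
  fix n a assume a: "a \<in> tuples M n"
  then obtain P where P: "defP L \<delta> n P" "P M a" "\<And>b. b \<in> tuples M n \<Longrightarrow> P M b \<longleftrightarrow> leq L \<delta> M a M b"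
    using ex_leq_formula[where B = M and t = a and n = n and M = M and L = L and \<gamma> = \<delta>] M \<delta> by blast
  have "Sigma_type L \<beta> M b = Sigma_type L \<beta> M a" if "b \<in> tuples M n" "P M b" for b \<beta>
    using leq[OF a that(1)] P(3)[OF that(1)] that tuples_length[OF a] tuples_length[OF that(1)]
    unfolding Sigma_type_def by auto
  then show "\<exists>m \<gamma> P. \<gamma> < osuc \<delta> \<and> defP L \<gamma> (n + m) P \<and> (\<exists>c\<in>tuples M m. P M (a @ c)) \<and>
     (\<forall>b\<in>tuples M n. \<forall>c\<in>tuples M m. P M (b @ c) \<longrightarrow> Sigma_type L (osuc \<delta>) M b = Sigma_type L (osuc \<delta>) M a)"
    using P by (intro exI[of _ 0] exI[of _ \<delta>] exI[of _ P]) (simp add: tuples_0)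
qed

text \<open>There are only countably many pairs of tuples, so one countable \<open>\<delta>\<close>
  lies above a separating level for every pair that is separated at all. Agreement at
  \<open>\<delta>\<close> is then agreement at every level, and this relation is a back-and-forth
  system.\<close>

lemma ex_leq_aut:
  assumes M: "is_structure L M"
  shows "\<exists>\<delta>>0. \<forall>n. \<forall>a\<in>tuples M n. \<forall>b\<in>tuples M n. leq L \<delta> M a M b \<longrightarrow> (\<exists>h. iso_map L h M M \<and> map h a = b)"
proof -
  \<comment> \<open>For a pair that is never separated the chosen value is arbitrary; it can only
    make \<open>\<delta>\<close> larger.\<close>
  define g where "g a b = (SOME \<alpha>. \<not> leq L \<alpha> M a M b)" for a b
  have "countable (range (\<lambda>(a, b). g a b))" by simp
  then obtain \<delta> where \<delta>: "\<And>a b. g a b < \<delta>"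
    using countable_imp_bounded_omega1[of "range (\<lambda>(a, b). g a b)"] by auto
  then have \<delta>0: "0 < \<delta>" using le_less_trans zero_le_omega1 by blast
  have all: "leq L \<alpha> M a M b" if "leq L \<delta> M a M b" "a \<in> tuples M n" "b \<in> tuples M n" for n a b \<alpha>
  proof (rule ccontr)
    assume "\<not> leq L \<alpha> M a M b"
    then have "\<not> leq L (g a b) M a M b" unfolding g_def by (rule someI)
    then show False using leq_mono[OF that(1), of "g a b" n] \<delta>[of a b] that(2,3) M by simp
  qed
  define R where "R a b \<longleftrightarrow> length a = length b \<and> a \<in> tuples M (length a) \<and> b \<in> tuples M (length b) \<and>
    (\<forall>\<alpha>. leq L \<alpha> M a M b)" for a b
  have sym: "R b a" if "R a b" for a b
  proof -
    have "leq L \<alpha> M b M a" for \<alpha>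
      using leq_rev[of L "osuc \<alpha>" M a M b \<alpha> "length a"] that M less_osuc unfolding R_def by metis
    then show ?thesis using that unfolding R_def by metis
  qed
  \<comment> \<open>Agreement at \<open>osuc \<delta>\<close> survives a back step as agreement at
    \<open>\<delta>\<close>, and \<open>all\<close> lifts it to every level again; the reversal of
    sides is undone by \<open>sym\<close>.\<close>
  have ext: "\<exists>c. R (a @ [c]) (b @ [d])" if R: "R a b" and d: "d \<in> univ M" for a b d
  proof -
    have "[d] \<in> tuples M (Suc 0)" using d by (simp add: tuples_1)
    with R M \<delta>0 obtain c where c: "c \<in> univ M" "leq L \<delta> M (b @ [d]) M (a @ [c])"
      using leq_back[of L "osuc \<delta>" M a M b "length a" \<delta> "[d]" "Suc 0"] less_osuc
      unfolding R_def tuples_1 by (metis (no_types, lifting) imageE)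
    have "b @ [d] \<in> tuples M (Suc (length a))" "a @ [c] \<in> tuples M (Suc (length a))"
      using R c d by (auto simp: R_def tuples_def)
    then have "R (b @ [d]) (a @ [c])" using all[OF c(2)] R by (simp add: R_def)
    then show ?thesis using sym by blast
  qed
  have "\<exists>h. iso_map L h M M \<and> map h a = b" if "leq L \<delta> M a M b" "a \<in> tuples M n" "b \<in> tuples M n" for n a b
  proof (rule iso_of_back_and_forth[OF M M, of R])
    fix a b assume "R a b"
    then show "a \<in> tuples M (length a) \<and> b \<in> tuples M (length b) \<and> atomic_eq L M a M b"
      using leq_atomic_eq[of L 0 M a M b "length a"] M unfolding R_def by metis
  next
    fix a b c assume "R a b" "c \<in> univ M"
    then show "\<exists>d. R (a @ [c]) (b @ [d])" using ext sym by blast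
  next
    show "R a b" using all[OF that] that(2,3) by (simp add: R_def tuples_def)
  qed (rule ext)
  then show ?thesis using \<delta>0 by blast
qed

text \<open>Scott's isomorphism theorem. It shows that the least level in \<open>cSR\<close> exists
  and is attained.\<close>

lemma ex_scott_sentence:
  assumes M: "is_structure L M"
  shows "\<exists>S. scott_sentence L M S \<and> Pi_in (osuc (cSR L M)) S"
proof -
  obtain \<delta> where \<delta>: "0 < \<delta>" "\<And>n a b. a \<in> tuples M n \<Longrightarrow> b \<in> tuples M n \<Longrightarrow>
    leq L \<delta> M a M b \<Longrightarrow> \<exists>h. iso_map L h M M \<and> map h a = b"
    using ex_leq_aut[OF M] by blast
  have "atomic_at L (osuc \<delta>) M"
  proof (rule atomic_at_osucI[OF M \<delta>(1)])
    fix n a b p assume ab: "a \<in> tuples M n" "b \<in> tuples M n" "leq L \<delta> M a M b" "p \<in> formulas L n"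
    show "holds M a p \<longleftrightarrow> holds M b p"
      using \<delta>(2)[OF ab(1-3)] holds_iso[OF _ M ab(1) ab(4)] by blast
  qed
  from atomic_at_scott[OF this M] \<delta>(1)
  have "\<exists>\<alpha> S. scott_sentence L M S \<and> Pi_in (osuc \<alpha>) S" by auto
  then show ?thesis
    unfolding cSR_def by (rule LeastI_ex)
qed

section \<open>Omitting types: the structure read off from a generic sequence of tuples\<close>

section \<open>Generic structures\<close>

text \<open>Reversing the relation costs one level and the back step another, whence the condition
  \<open>osuc \<epsilon> < \<rho>\<close>, which reappears in the assumption \<open>wit\<close>
  below.\<close>

lemma leq_forth:
  assumes l: "leq L \<rho> A a B b" and A: "pt L n A a" and B: "pt L n B b"
    and \<epsilon>: "0 < \<epsilon>" "osuc \<epsilon> < \<rho>" and y: "y \<in> tuples A m"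
  shows "\<exists>z\<in>tuples B m. leq L \<epsilon> A (a @ y) B (b @ z)"
  using leq_back[OF leq_rev[OF l \<epsilon>(2) A B] B A \<epsilon>(1) less_osuc y] .

text \<open>The Rasiowa-Sikorski lemma for countably many dense sets.\<close>

lemma generic_chain:
  assumes "countable \<D>" and "p0 \<in> P"
    and dense: "\<And>D p. D \<in> \<D> \<Longrightarrow> p \<in> P \<Longrightarrow> \<exists>q\<in>P. le p q \<and> q \<in> D"
    and refl: "\<And>p. p \<in> P \<Longrightarrow> le p p"
  shows "\<exists>c :: nat \<Rightarrow> 'a. (\<forall>n. c n \<in> P \<and> le (c n) (c (Suc n))) \<and> (\<forall>D\<in>\<D>. \<exists>n. c n \<in> D)"
proof -
  \<comment> \<open>\<open>P\<close> itself is added so that the enumerated family is nonempty; by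
    reflexivity it is met anyway.\<close>
  let ?E = "from_nat_into (insert P \<D>)"
  have E: "\<exists>q\<in>P. le p q \<and> q \<in> ?E n" if "p \<in> P" for p n
    using from_nat_into[of "insert P \<D>" n] dense refl that by blast
  have "\<exists>c. \<forall>n. c n \<in> P \<and> (le (c n) (c (Suc n)) \<and> c (Suc n) \<in> ?E n)"
    by (rule dependent_nat_choice) (use assms(2) E in blast)+
  then obtain c where c: "\<And>n. c n \<in> P" "\<And>n. le (c n) (c (Suc n))" "\<And>n. c (Suc n) \<in> ?E n" by blast
  have "\<exists>n. c n \<in> D" if "D \<in> \<D>" for D
    using from_nat_into_surj[of "insert P \<D>" D] assms(1) that c(3) by (metis countable_insert insertI2)
  then show ?thesis using c by blast
qed

text \<open>Elements of the new structure are named by positions. At stage \<open>n\<close> position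
  \<open>i\<close> stands for \<open>t n ! i\<close>; a later stage may reinterpret it by another
  element of \<open>B\<close>, as long as the \<Pi> properties of level \<open>g n\<close> survive.
  By \<open>wit\<close>, whatever a tuple \<open>y\<close> of \<open>B\<close> adds at stage
  \<open>n\<close> is imitated, up to level \<open>\<epsilon>\<close>, by positions at some
  stage.\<close>

locale generic_struct =
  fixes L :: vocabulary and B :: struct and t :: "nat \<Rightarrow> nat list" and g :: "nat \<Rightarrow> omega1"
  assumes B: "is_structure L B"
    and tuple: "\<And>n. t n \<in> tuples B (length (t n))"
    and mono: "\<And>n m. n \<le> m \<Longrightarrow> g n \<le> g m \<and> length (t n) \<le> length (t m) \<and>
      leq L (g n) B (t n) B (take (length (t n)) (t m))"
    and big: "\<And>n. osuc (osuc (osuc 0)) \<le> g n"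
    and len: "\<And>k. \<exists>n. k \<le> length (t n)"
    and func: "\<And>f is. f \<in> fun_syms L \<Longrightarrow> length is = fun_arity L f \<Longrightarrow>
      \<exists>n e. set is \<subseteq> {..<length (t n)} \<and> e < length (t n) \<and> t n ! e = fun_of B f (map ((!) (t n)) is)"
    and wit: "\<And>n y \<epsilon>. set y \<subseteq> univ B \<Longrightarrow> 0 < \<epsilon> \<Longrightarrow> osuc \<epsilon> < g n \<Longrightarrow>
      \<exists>m js. length js = length y \<and> set js \<subseteq> {..<length (t m)} \<and> length (t n) \<le> length (t m) \<and> \<epsilon> \<le> g m \<and>
        leq L \<epsilon> B (t n @ y) B (map ((!) (t m)) ([0..<length (t n)] @ js))"
begin

abbreviation inst :: "nat \<Rightarrow> nat list \<Rightarrow> nat list" where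
  "inst n a \<equiv> map ((!) (t n)) a"

lemma inst_tuples: "set a \<subseteq> {..<length (t n)} \<Longrightarrow> length a = k \<Longrightarrow> inst n a \<in> tuples B k"
  using tuple[of n] by (force simp: tuples_def)

lemma inst_leq:
  assumes "n \<le> m" "set a \<subseteq> {..<length (t n)}"
  shows "leq L (g n) B (inst n a) B (inst m a)"
proof -
  have "take (length (t n)) (t m) \<in> tuples B (length (t n))"
    using mono[OF assms(1)] tuple[of m] by (auto simp: tuples_def dest: in_set_takeD)
  then have "leq L (g n) B (map ((!) (t n)) a) B (map ((!) (take (length (t n)) (t m))) a)"
    by (intro leq_subst[where n = "length (t n)"]) (use mono[OF assms(1)] B tuple assms(2) in auto)
  moreover have "map ((!) (take (length (t n)) (t m))) a = inst m a"
    using assms(2) by auto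
  ultimately show ?thesis by simp
qed

lemma inst_atomic_eq:
  assumes "n \<le> m" "set a \<subseteq> {..<length (t n)}"
  shows "atomic_eq L B (inst n a) B (inst m a)"
proof -
  have "set a \<subseteq> {..<length (t m)}" using assms mono[OF assms(1)] by fastforce
  then show ?thesis
    using leq_atomic_eq[OF inst_leq[OF assms], of "length a"] inst_tuples B assms(2) by blast
qed

lemma ex_len: "\<exists>n. \<forall>m\<ge>n. set a \<subseteq> {..<length (t m)}"
proof -
  obtain n where n: "Suc (sum_list a) \<le> length (t n)" using len by blast
  have "x < length (t m)" if "x \<in> set a" "n \<le> m" for x m
    using member_le_sum_list[OF that(1)] n mono[OF that(2)] by linarith
  then show ?thesis by auto
qed

definition eqv :: "nat \<Rightarrow> nat \<Rightarrow> bool" where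
  "eqv i j \<longleftrightarrow> (\<exists>n. i < length (t n) \<and> j < length (t n) \<and> t n ! i = t n ! j)"

lemma eq_stable:
  assumes "n \<le> m" "i < length (t n)" "j < length (t n)"
  shows "t n ! i = t n ! j \<longleftrightarrow> t m ! i = t m ! j"
proof -
  have "atomic_eq L B (inst n [i, j]) B (inst m [i, j])"
    using assms by (intro inst_atomic_eq) auto
  then have "\<forall>x y. x < 2 \<and> y < 2 \<longrightarrow> (inst n [i, j] ! x = inst n [i, j] ! y \<longleftrightarrow> inst m [i, j] ! x = inst m [i, j] ! y)"
    by (simp add: atomic_eq_def)
  from this[rule_format, of 0 1] show ?thesis by simp
qed

lemma eqv_iff:
  assumes "i < length (t n)" "j < length (t n)"
  shows "eqv i j \<longleftrightarrow> t n ! i = t n ! j"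
proof
  assume "eqv i j"
  then obtain m where m: "i < length (t m)" "j < length (t m)" "t m ! i = t m ! j" by (auto simp: eqv_def)
  then show "t n ! i = t n ! j"
    using eq_stable[of m "max n m" i j] eq_stable[of n "max n m" i j] assms by auto
qed (use assms in \<open>auto simp: eqv_def\<close>)

lemma ex_len2: "\<exists>n. i < length (t n) \<and> j < length (t n) \<and> k < length (t n)"
  using ex_len[of "[i, j, k]"] by auto

lemma eqv_refl: "eqv i i"
  using ex_len2[of i i i] by (auto simp: eqv_def)

lemma eqv_trans: "eqv i j \<Longrightarrow> eqv j k \<Longrightarrow> eqv i k"
  using ex_len2[of i j k] eqv_iff by metis

lemma eqv_sym: "eqv i j \<Longrightarrow> eqv j i"
  by (auto simp: eqv_def)

definition cls :: "nat \<Rightarrow> nat" where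
  "cls i = (LEAST j. eqv i j)"

lemma eqv_cls: "eqv i (cls i)"
  unfolding cls_def using eqv_refl by (rule LeastI)

lemma cls_eq_iff: "cls i = cls j \<longleftrightarrow> eqv i j"
proof
  assume "cls i = cls j"
  then show "eqv i j" using eqv_cls eqv_sym eqv_trans by metis
next
  assume "eqv i j"
  then have "eqv i = eqv j" using eqv_sym eqv_trans by blast
  then show "cls i = cls j" by (simp add: cls_def)
qed

lemma cls_cls: "cls (cls i) = cls i"
  using cls_eq_iff eqv_cls eqv_sym by blast

lemma inst_cls:
  assumes "set a \<subseteq> {..<length (t n)}" "set (map cls a) \<subseteq> {..<length (t n)}"
  shows "inst n (map cls a) = inst n a"
proof -
  have "t n ! cls i = t n ! i" if "i \<in> set a" for i
  proof -
    have "i < length (t n)" "cls i < length (t n)" using assms that by auto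
    then show ?thesis using eqv_iff eqv_cls by metis
  qed
  then show ?thesis by simp
qed

text \<open>The quotient of the positions, realised on least representatives because universes
  consist of natural numbers. One stage settles an atomic fact, by \<open>rel_stable\<close> and
  \<open>fun_stable\<close>; the choice in \<open>fun_of\<close> picks some position carrying the
  value, and \<open>cls\<close> passes to its representative.\<close>

definition M :: struct where
  "M = \<lparr>univ = {i. cls i = i},
     rel_of = (\<lambda>r a. \<exists>n. set a \<subseteq> {..<length (t n)} \<and> rel_of B r (inst n a)),
     fun_of = (\<lambda>f a. cls (SOME e. \<exists>n. set a \<subseteq> {..<length (t n)} \<and> e < length (t n) \<and>
        t n ! e = fun_of B f (inst n a)))\<rparr>"

lemma univ_M: "univ M = {i. cls i = i}"
  by (simp add: M_def)

lemma cls_in_M: "cls i \<in> univ M"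
  by (simp add: univ_M cls_cls)

lemma rel_stable:
  assumes "n \<le> m" "set a \<subseteq> {..<length (t n)}" "r \<in> rel_syms L" "length a = rel_arity L r"
  shows "rel_of B r (inst n a) \<longleftrightarrow> rel_of B r (inst m a)"
proof -
  have "map ((!) (inst k a)) [0..<length a] = inst k a" for k
    by (simp add: map_nth_take)
  then show ?thesis
    using inst_atomic_eq[OF assms(1,2), unfolded atomic_eq_def, THEN conjunct2, THEN conjunct2,
        THEN conjunct1, rule_format, of r "[0..<length a]"] assms(3,4)
    by (simp add: lessThan_atLeast0)
qed

lemma fun_stable:
  assumes "n \<le> m" "set a \<subseteq> {..<length (t n)}" "e < length (t n)" "f \<in> fun_syms L" "length a = fun_arity L f"
  shows "t n ! e = fun_of B f (inst n a) \<longleftrightarrow> t m ! e = fun_of B f (inst m a)"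
proof -
  have at: "atomic_eq L B (inst n (a @ [e])) B (inst m (a @ [e]))"
    using assms by (intro inst_atomic_eq) auto
  have l: "length (inst n (a @ [e])) = Suc (length a)" by simp
  have "map ((!) (inst k (a @ [e]))) [0..<length a] = inst k a" for k
    using map_nth_take[of "length a" "inst k (a @ [e])"] by simp
  moreover have "inst k (a @ [e]) ! length a = t k ! e" for k by (simp add: nth_append)
  moreover have "fun_of B f (map ((!) (inst n (a @ [e]))) [0..<length a]) = inst n (a @ [e]) ! length a \<longleftrightarrow>
     fun_of B f (map ((!) (inst m (a @ [e]))) [0..<length a]) = inst m (a @ [e]) ! length a"
    using at[unfolded atomic_eq_def l, THEN conjunct2, THEN conjunct2, THEN conjunct2, rule_format,
        of f "[0..<length a]" "length a"] assms(4,5) by (simp add: subset_iff)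
  ultimately show ?thesis by auto
qed

lemma fun_M:
  assumes "f \<in> fun_syms L" "length a = fun_arity L f"
  shows "fun_of M f a \<in> univ M \<and> (\<exists>n0. \<forall>n\<ge>n0. set a \<subseteq> {..<length (t n)} \<and> fun_of M f a < length (t n) \<and>
    t n ! fun_of M f a = fun_of B f (inst n a))"
proof -
  let ?Q = "\<lambda>e. \<exists>n. set a \<subseteq> {..<length (t n)} \<and> e < length (t n) \<and> t n ! e = fun_of B f (inst n a)"
  define e where "e = (SOME e. ?Q e)"
  have F: "fun_of M f a = cls e" by (simp add: M_def e_def)
  have "\<exists>e. ?Q e" using func[OF assms] by blast
  then have "?Q e" unfolding e_def by (rule someI_ex)
  then obtain n where n: "set a \<subseteq> {..<length (t n)}" "e < length (t n)" "t n ! e = fun_of B f (inst n a)" by blast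
  obtain n' where n': "\<And>m. m \<ge> n' \<Longrightarrow> set (cls e # a) \<subseteq> {..<length (t m)}" using ex_len by blast
  have "set a \<subseteq> {..<length (t m)} \<and> cls e < length (t m) \<and> t m ! cls e = fun_of B f (inst m a)"
    if m: "max n n' \<le> m" for m
  proof -
    have nm: "n \<le> m" "n' \<le> m" using m by auto
    have 1: "set a \<subseteq> {..<length (t m)}" "cls e < length (t m)" using n'[OF nm(2)] by auto
    have 2: "e < length (t m)" using n(2) mono[OF nm(1)] by auto
    have "t m ! e = t m ! cls e" using eqv_iff[OF 2 1(2)] eqv_cls by blast
    moreover have "t m ! e = fun_of B f (inst m a)" using fun_stable[OF nm(1) n(1,2) assms] n(3) by blast
    ultimately show ?thesis using 1 by simp
  qed
  then show ?thesis unfolding F using cls_in_M by blast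
qed

lemma is_structure_M: "is_structure L M"
  unfolding is_structure_def using fun_M tuples_length cls_in_M by blast

lemma val_M:
  assumes "a \<in> tuples M k" "wf_trm L s" "vars s \<subseteq> {..<k}"
  shows "val M ((!) a) s \<in> univ M \<and> (\<exists>n0. \<forall>n\<ge>n0. val M ((!) a) s < length (t n) \<and>
    t n ! val M ((!) a) s = val B ((!) (inst n a)) s)"
  using assms(2,3)
proof (induction s)
  case (Var x)
  obtain n0 where n0: "\<And>n. n \<ge> n0 \<Longrightarrow> set a \<subseteq> {..<length (t n)}" using ex_len by blast
  have x: "x < length a" using Var assms(1) by (simp add: tuples_length)
  then have "a ! x < length (t n)" if "n \<ge> n0" for n
    using subsetD[OF n0[OF that] nth_mem[OF x]] by simp
  then show ?case using assms(1) x by (auto simp: tuples_def)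
next
  case (App f ts)
  let ?v = "val M ((!) a)"
  have "\<forall>s. s \<in> set ts \<longrightarrow> (\<exists>n0. \<forall>n\<ge>n0. ?v s < length (t n) \<and> t n ! ?v s = val B ((!) (inst n a)) s)"
    using App by auto
  then obtain N where N: "\<And>s n. s \<in> set ts \<Longrightarrow> n \<ge> N s \<Longrightarrow> ?v s < length (t n) \<and> t n ! ?v s = val B ((!) (inst n a)) s"
    by metis
  have l: "length (map ?v ts) = fun_arity L f" "f \<in> fun_syms L" using App.prems by auto
  obtain n1 where n1: "\<And>n. n \<ge> n1 \<Longrightarrow> fun_of M f (map ?v ts) < length (t n) \<and>
      t n ! fun_of M f (map ?v ts) = fun_of B f (inst n (map ?v ts))"
    using fun_M[OF l(2,1)] by blast
  have "fun_of M f (map ?v ts) < length (t n) \<and>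
      t n ! fun_of M f (map ?v ts) = fun_of B f (map (val B ((!) (inst n a))) ts)"
    if n: "n \<ge> n1 + sum_list (map N ts)" for n
  proof -
    have "n \<ge> N s" if "s \<in> set ts" for s
    proof -
      have "N s \<in> set (map N ts)" using that by simp
      from member_le_sum_list[OF this] show ?thesis using n by linarith
    qed
    then have "map (\<lambda>s. t n ! ?v s) ts = map (val B ((!) (inst n a))) ts"
      using N by (intro map_cong) auto
    moreover have "inst n (map ?v ts) = map (\<lambda>s. t n ! ?v s) ts" by simp
    ultimately show ?thesis using n1[of n] n by (metis add_leD1)
  qed
  then show ?case using fun_M[OF l(2,1)] unfolding val.simps by blast
qed

text \<open>Equivalence holds only from some stage on: the value of every term that occurs must
  first have acquired a position.\<close>

lemma truth_qfree:
  assumes "qfree p" "a \<in> tuples M k" "wf_fm L p" "fvars p \<subseteq> {..<k}"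
  shows "\<exists>n0. \<forall>n\<ge>n0. sat M ((!) a) p \<longleftrightarrow> sat B ((!) (inst n a)) p"
  using assms(1,3,4)
proof (induction rule: qfree.induct)
  case (2 s u)
  from 2 obtain n1 where 1: "val M ((!) a) s \<in> univ M" "\<And>n. n \<ge> n1 \<Longrightarrow> val M ((!) a) s < length (t n) \<and>
    t n ! val M ((!) a) s = val B ((!) (inst n a)) s"
    using val_M[OF assms(2), of s] by auto
  from 2 obtain n2 where 2: "val M ((!) a) u \<in> univ M" "\<And>n. n \<ge> n2 \<Longrightarrow> val M ((!) a) u < length (t n) \<and>
    t n ! val M ((!) a) u = val B ((!) (inst n a)) u"
    using val_M[OF assms(2), of u] by auto
  have "sat M ((!) a) (EqF s u) \<longleftrightarrow> sat B ((!) (inst n a)) (EqF s u)" if n: "n \<ge> max n1 n2" for n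
  proof -
    have "val M ((!) a) s = val M ((!) a) u \<longleftrightarrow> eqv (val M ((!) a) s) (val M ((!) a) u)"
      using 1(1) 2(1) unfolding cls_eq_iff[symmetric] by (simp add: univ_M)
    then show ?thesis using 1(2)[of n] 2(2)[of n] n eqv_iff[of "val M ((!) a) s" n "val M ((!) a) u"] by simp
  qed
  then show ?case by blast
next
  case (3 r ts)
  let ?v = "val M ((!) a)"
  have l: "length (map ?v ts) = rel_arity L r" "r \<in> rel_syms L" using 3 by auto
  have "\<forall>s. s \<in> set ts \<longrightarrow> (\<exists>n0. \<forall>n\<ge>n0. ?v s < length (t n) \<and> t n ! ?v s = val B ((!) (inst n a)) s)"
  proof (intro allI impI)
    fix s assume "s \<in> set ts"
    then have "wf_trm L s" "vars s \<subseteq> {..<k}" using 3 by auto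
    then show "\<exists>n0. \<forall>n\<ge>n0. ?v s < length (t n) \<and> t n ! ?v s = val B ((!) (inst n a)) s"
      using val_M[OF assms(2)] by blast
  qed
  then obtain N where N: "\<And>s n. s \<in> set ts \<Longrightarrow> n \<ge> N s \<Longrightarrow> ?v s < length (t n) \<and> t n ! ?v s = val B ((!) (inst n a)) s"
    by metis
  have "sat M ((!) a) (RelF r ts) \<longleftrightarrow> sat B ((!) (inst n a)) (RelF r ts)" if n: "n \<ge> sum_list (map N ts)" for n
  proof -
    have Ns: "n \<ge> N s" if "s \<in> set ts" for s
    proof -
      have "N s \<in> set (map N ts)" using that by simp
      from member_le_sum_list[OF this] show ?thesis using n by linarith
    qed
    have eq: "inst n (map ?v ts) = map (val B ((!) (inst n a))) ts" using N Ns by simp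
    have sub: "set (map ?v ts) \<subseteq> {..<length (t n)}" using N Ns by auto
    have "rel_of M r (map ?v ts) \<longleftrightarrow> rel_of B r (inst n (map ?v ts))"
    proof
      assume "rel_of M r (map ?v ts)"
      then obtain m where m: "set (map ?v ts) \<subseteq> {..<length (t m)}" "rel_of B r (inst m (map ?v ts))"
        by (auto simp: M_def)
      show "rel_of B r (inst n (map ?v ts))"
        using rel_stable[OF _ m(1) l(2,1), of "max n m"] rel_stable[OF _ sub l(2,1), of "max n m"] m(2) by auto
    next
      assume "rel_of B r (inst n (map ?v ts))"
      then show "rel_of M r (map ?v ts)" using sub by (auto simp: M_def)
    qed
    then show ?thesis unfolding sat.simps eq .
  qed
  then show ?case by blast
next
  case (4 p)
  then show ?case by simp
next
  case (5 p q)
  then obtain n1 n2 where "\<And>n. n \<ge> n1 \<Longrightarrow> sat M ((!) a) p \<longleftrightarrow> sat B ((!) (inst n a)) p"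
    "\<And>n. n \<ge> n2 \<Longrightarrow> sat M ((!) a) q \<longleftrightarrow> sat B ((!) (inst n a)) q" by auto
  then show ?case unfolding sat.simps by (intro exI[of _ "max n1 n2"]) (metis max.bounded_iff)
next
  case (6 p q)
  then obtain n1 n2 where "\<And>n. n \<ge> n1 \<Longrightarrow> sat M ((!) a) p \<longleftrightarrow> sat B ((!) (inst n a)) p"
    "\<And>n. n \<ge> n2 \<Longrightarrow> sat M ((!) a) q \<longleftrightarrow> sat B ((!) (inst n a)) q" by auto
  then show ?case unfolding sat.simps by (intro exI[of _ "max n1 n2"]) (metis max.bounded_iff)
qed simp

lemma persist:
  assumes "n \<le> m" "set a \<subseteq> {..<length (t n)}" "defP L \<gamma> (length a) P" "\<gamma> \<le> g n" "P B (inst n a)"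
  shows "P B (inst m a)"
proof -
  have "set a \<subseteq> {..<length (t m)}" using assms(2) mono[OF assms(1)] by fastforce
  then show ?thesis
    using leqD[OF inst_leq[OF assms(1,2)] _ _ defP_mono[OF assms(3,4)] assms(5)] B inst_tuples assms(2) by blast
qed

text \<open>The forcing theorem for \<Pi> predicates, by induction on the level. A \<Pi> predicate
  unfolds to \<Sigma> predicates of positions, and each of these has a witness \<open>d\<close> in
  \<open>B\<close>; \<open>wit\<close> exchanges \<open>d\<close> for positions with the same \<Pi>
  properties of lower level, to which the induction hypothesis applies.\<close>

lemma truth:
  assumes "defP L \<gamma> k P" "a \<in> tuples M k" "set a \<subseteq> {..<length (t n)}" "\<gamma> \<le> g n" "P B (inst n a)"
  shows "P M a"
  using assms
proof (induction \<gamma> arbitrary: k P a n rule: less_induct)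
  case (less \<gamma>)
  have la: "length a = k" using less.prems(2) by (rule tuples_length)
  show ?case
  proof (cases "\<gamma> = 0")
    case True
    from less.prems(1) obtain p where p: "p \<in> formulas L k" "qfree p"
      "\<And>A a. is_structure L A \<Longrightarrow> a \<in> tuples A k \<Longrightarrow> holds A a p \<longleftrightarrow> P A a"
      unfolding defP_def True Pi_in_0 by blast
    obtain n0 where n0: "\<And>n. n \<ge> n0 \<Longrightarrow> sat M ((!) a) p \<longleftrightarrow> sat B ((!) (inst n a)) p"
      using truth_qfree[OF p(2) less.prems(2)] p(1) by (auto simp: formulas_def)
    let ?m = "max n n0"
    have sub: "set a \<subseteq> {..<length (t ?m)}" using less.prems(3) mono[of n ?m] by fastforce
    have "P B (inst ?m a)"
      using persist[OF _ less.prems(3), of ?m \<gamma> P] less.prems(1,4,5) la by simp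
    then have "holds B (inst ?m a) p" using p(3)[OF B inst_tuples[OF sub la]] by simp
    then have "holds M a p" using n0[of ?m] by (simp add: holds_def)
    then show ?thesis using p(3)[OF is_structure_M less.prems(2)] by simp
  next
    case False
    then have "0 < \<gamma>" by (simp add: zero_less_iff_omega1)
    from defP_decompose[OF less.prems(1) this] obtain m \<delta> Q where
      Q: "\<And>i::nat. \<delta> i < \<gamma>" "\<And>i. defS L (\<delta> i) (k + m i) (Q i)" and
      P: "\<And>A a. is_structure L A \<Longrightarrow> a \<in> tuples A k \<Longrightarrow> P A a \<longleftrightarrow> (\<forall>i. \<forall>c\<in>tuples A (m i). Q i A (a @ c))"
      by metis
    have "Q i M (a @ c)" if c: "c \<in> tuples M (m i)" for i c
    proof -
      \<comment> \<open>The positions in \<open>c\<close> may not yet exist at stage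
        \<open>n\<close>; the property is first carried to a stage where they do.\<close>
      obtain n' where n': "\<And>m. m \<ge> n' \<Longrightarrow> set c \<subseteq> {..<length (t m)}" using ex_len by blast
      define n1 where "n1 = max n n'"
      have nn1: "n \<le> n1" by (simp add: n1_def)
      have sa: "set a \<subseteq> {..<length (t n1)}" using less.prems(3) mono[OF nn1] by fastforce
      have sc: "set c \<subseteq> {..<length (t n1)}" using n' by (simp add: n1_def)
      have sac: "set (a @ c) \<subseteq> {..<length (t n1)}" using sa sc by simp
      have lc: "length c = m i" using c by (rule tuples_length)
      have ac: "a @ c \<in> tuples M (k + m i)" using tuples_appendI[OF less.prems(2) c] .
      have gn: "\<gamma> \<le> g n1" using less.prems(4) mono[OF nn1] by (meson order_trans)
      have "P B (inst n1 a)"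
        using persist[OF nn1 less.prems(3), of \<gamma> P] less.prems(1,4,5) la by simp
      then have "Q i B (inst n1 a @ inst n1 c)"
        using P[OF B inst_tuples[OF sa la]] inst_tuples[OF sc lc] by blast
      then have Qi: "Q i B (inst n1 (a @ c))" by simp
      show ?thesis
      proof (cases "\<delta> i = 0")
        case True
        then have "defP L 0 (k + m i) (Q i)" using Q(2)[of i] by (simp add: defP_0)
        then show ?thesis
          using less.IH[OF _ _ ac sac, of 0 "Q i"] \<open>0 < \<gamma>\<close> Qi by simp
      next
        case False
        then have "0 < \<delta> i" by (simp add: zero_less_iff_omega1)
        from defS_decompose[OF Q(2) this] obtain l \<epsilon> R where
          R: "\<And>j::nat. \<epsilon> j < \<delta> i" "\<And>j. defP L (\<epsilon> j) (k + m i + l j) (R j)" and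
          QR: "\<And>A a. is_structure L A \<Longrightarrow> a \<in> tuples A (k + m i) \<Longrightarrow> Q i A a \<longleftrightarrow> (\<exists>j. \<exists>c\<in>tuples A (l j). R j A (a @ c))"
          by metis
        have lac: "length (a @ c) = k + m i" using la lc by simp
        obtain j d where d: "d \<in> tuples B (l j)" "R j B (inst n1 (a @ c) @ d)"
          using QR[OF B inst_tuples[OF sac lac]] Qi by blast
        have ld: "length d = l j" using d(1) by (rule tuples_length)
        \<comment> \<open>\<open>wit\<close> requires a positive level, hence the maximum with 1.
          The bound \<open>osuc \<epsilon>' < g n1\<close> then asks for
          \<open>osuc (osuc 0) < g n1\<close>, which is what \<open>big\<close> provides.\<close>
        define \<epsilon>' where "\<epsilon>' = max (\<epsilon> j) (osuc 0)"
        have e0: "0 < \<epsilon>'" by (simp add: \<epsilon>'_def less_max_iff_disj)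
        have "osuc (\<epsilon> j) < g n1" using R(1)[of j] Q(1)[of i] gn by (meson le_less_trans osuc_least less_le_trans)
        moreover have "osuc (osuc 0) < g n1" using big[of n1] by simp
        ultimately have "osuc \<epsilon>' < g n1" by (simp add: \<epsilon>'_def max_def)
        from wit[OF _ e0 this, of d] d(1) obtain m' js where
          js: "length js = length d" "set js \<subseteq> {..<length (t m')}" "length (t n1) \<le> length (t m')" "\<epsilon>' \<le> g m'"
          and lq: "leq L \<epsilon>' B (t n1 @ d) B (inst m' ([0..<length (t n1)] @ js))"
          by (auto simp: tuples_def)
        let ?n = "length (t n1)"
        have p1: "pt L (?n + length d) B (t n1 @ d)"
          using B tuple[of n1] d(1) ld by (simp add: tuples_appendI)
        have "inst m' ([0..<?n] @ js) \<in> tuples B (?n + length d)"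
          by (rule inst_tuples) (use js in auto)
        then have p2: "pt L (?n + length d) B (inst m' ([0..<?n] @ js))" using B by blast
        have lq': "leq L \<epsilon>' B (map ((!) (t n1 @ d)) ((a @ c) @ [?n..<?n + length d]))
            B (map ((!) (inst m' ([0..<?n] @ js))) ((a @ c) @ [?n..<?n + length d]))"
          by (rule leq_subst[OF lq p1 p2]) (use sac in auto)
        have e1: "map ((!) (t n1 @ d)) ((a @ c) @ [?n..<?n + length d]) = inst n1 (a @ c) @ d"
          using sac by (auto simp: nth_append intro!: nth_equalityI)
        have "map ((!) (inst m' ([0..<?n] @ js))) [?n..<?n + length d] = inst m' js"
          using js(1) by (intro nth_equalityI) (auto simp: nth_append)
        moreover have "map ((!) (inst m' ([0..<?n] @ js))) (a @ c) = inst m' (a @ c)"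
          using sac by (auto simp: nth_append)
        ultimately have e2: "map ((!) (inst m' ([0..<?n] @ js))) ((a @ c) @ [?n..<?n + length d]) = inst m' ((a @ c) @ js)"
          by (simp only: map_append)
        have sacj: "set ((a @ c) @ js) \<subseteq> {..<length (t m')}" using sac js by auto
        have lacj: "length ((a @ c) @ js) = k + m i + l j" using lac js(1) ld by simp
        have Rp: "defP L \<epsilon>' (k + m i + l j) (R j)" using defP_mono[OF R(2)] by (simp add: \<epsilon>'_def)
        have "R j B (inst m' ((a @ c) @ js))"
          by (rule leqD[OF lq'[unfolded e1 e2] _ _ Rp d(2)])
            (use B tuples_appendI[OF inst_tuples[OF sac lac] d(1)] inst_tuples[OF sacj lacj] in blast)+
        \<comment> \<open>The positions \<open>js\<close> need not be least representatives and so
          need not be elements of \<open>M\<close>; they are replaced by their images under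
          \<open>cls\<close>, which leaves the interpretation unchanged.\<close>
        moreover obtain n2 where n2: "\<And>m. m \<ge> n2 \<Longrightarrow> set (map cls js) \<subseteq> {..<length (t m)}" using ex_len by blast
        ultimately have Rn: "R j B (inst (max m' n2) ((a @ c) @ js))"
          using persist[OF _ sacj, of "max m' n2" \<epsilon>' "R j"] Rp lacj js(4) by simp
        let ?m2 = "max m' n2"
        have gm2: "g m' \<le> g ?m2" "length (t m') \<le> length (t ?m2)" using mono[of m' ?m2] by auto
        have scl: "set (map cls js) \<subseteq> {..<length (t ?m2)}" "set js \<subseteq> {..<length (t ?m2)}"
          using n2[of ?m2] js(2) gm2(2) by auto
        have "inst ?m2 ((a @ c) @ map cls js) = inst ?m2 ((a @ c) @ js)"
          using inst_cls[OF scl(2,1)] by simp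
        then have R2: "R j B (inst ?m2 ((a @ c) @ map cls js))" using Rn by (simp only:)
        have mj: "map cls js \<in> tuples M (l j)" using js(1) ld cls_in_M by (auto simp: tuples_def)
        have "R j M ((a @ c) @ map cls js)"
        proof (rule less.IH[OF _ R(2)])
          show "\<epsilon> j < \<gamma>" using R(1)[of j] Q(1)[of i] by (rule less_trans)
          show "(a @ c) @ map cls js \<in> tuples M (k + m i + l j)" using tuples_appendI[OF ac mj] .
          show "set ((a @ c) @ map cls js) \<subseteq> {..<length (t ?m2)}" using sacj gm2(2) scl by auto
          show "\<epsilon> j \<le> g ?m2" using js(4) gm2(1) by (auto simp: \<epsilon>'_def)
          show "R j B (inst ?m2 ((a @ c) @ map cls js))" by (rule R2)
        qed
        then show ?thesis using QR[OF is_structure_M ac] mj by blast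
      qed
    qed
    then show ?thesis using P[OF is_structure_M less.prems(2)] by blast
  qed
qed

lemma leq_M:
  assumes "a \<in> tuples M k" "set a \<subseteq> {..<length (t n)}"
  shows "leq L (g n) B (inst n a) M a"
proof (rule leqI[where n = k])
  fix P assume "defP L (g n) k P" "P B (inst n a)"
  then show "P M a" using truth[OF _ assms] by blast
qed (use assms B is_structure_M inst_tuples tuples_length in blast)+

lemma leq_M_all: "leq L (g n) B (t n) M (map cls [0..<length (t n)])"
proof -
  let ?k = "length (t n)"
  let ?a = "map cls [0..<?k]"
  obtain n' where n': "\<And>m. m \<ge> n' \<Longrightarrow> set ?a \<subseteq> {..<length (t m)}" using ex_len by blast
  let ?m = "max n n'"
  have nm: "n \<le> ?m" by simp
  have sub: "set [0..<?k] \<subseteq> {..<length (t ?m)}" using mono[OF nm] by auto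
  have suba: "set ?a \<subseteq> {..<length (t ?m)}" by (rule n') simp
  have a: "?a \<in> tuples M ?k" using cls_in_M by (auto simp: tuples_def)
  have e: "inst ?m ?a = inst ?m [0..<?k]" using inst_cls[OF sub suba] .
  have pa: "pt L ?k B (inst ?m ?a)" using B inst_tuples[OF suba] by simp
  have pM: "pt L ?k M ?a" using a is_structure_M by blast
  have "leq L (g ?m) B (inst ?m ?a) M ?a" using leq_M[OF a suba] .
  then have 2: "leq L (g n) B (inst ?m ?a) M ?a"
    by (rule leq_mono[OF _ _ pa pM]) (use mono[OF nm] in blast)
  have "inst n [0..<?k] = t n" by (simp add: map_nth_take)
  then have 1: "leq L (g n) B (t n) B (inst ?m ?a)"
    using inst_leq[OF nm, of "[0..<?k]"] unfolding e by (simp add: lessThan_atLeast0)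
  show ?thesis by (rule leq_trans[OF 1 2 _ pa pM]) (use B tuple in blast)
qed

text \<open>The form of \<open>truth\<close> for witnesses given by arbitrary positions, which are
  exchanged for their representatives.\<close>

lemma truth_ex:
  assumes "defP L \<epsilon> (k + length js) R" "a \<in> tuples M k" "set (a @ js) \<subseteq> {..<length (t n)}" "\<epsilon> \<le> g n"
    "R B (inst n (a @ js))"
  shows "\<exists>c\<in>tuples M (length js). R M (a @ c)"
proof -
  have la: "length a = k" using assms(2) by (rule tuples_length)
  obtain n' where n': "\<And>m. m \<ge> n' \<Longrightarrow> set (map cls js) \<subseteq> {..<length (t m)}" using ex_len by blast
  let ?m = "max n n'"
  have nm: "n \<le> ?m" by simp
  have scl: "set (map cls js) \<subseteq> {..<length (t ?m)}" by (rule n') simp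
  have saj: "set (a @ js) \<subseteq> {..<length (t ?m)}" using assms(3) mono[OF nm] by fastforce
  have "R B (inst ?m (a @ js))"
    using persist[OF nm assms(3), of \<epsilon> R] assms(1,4,5) la by simp
  moreover have "inst ?m (a @ map cls js) = inst ?m (a @ js)"
    using inst_cls[of js ?m] saj scl by simp
  ultimately have R: "R B (inst ?m (a @ map cls js))" by (simp only:)
  have c: "map cls js \<in> tuples M (length js)" using cls_in_M by (auto simp: tuples_def)
  have "R M (a @ map cls js)"
  proof (rule truth[OF assms(1) tuples_appendI[OF assms(2) c] _ _ R])
    show "set (a @ map cls js) \<subseteq> {..<length (t ?m)}" using saj scl by auto
    show "\<epsilon> \<le> g ?m" using assms(4) mono[OF nm] by (meson order_trans)
  qed
  then show ?thesis using c by blast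
qed

end

section \<open>Forcing conditions, density, and the atomic generic model\<close>

definition gcond :: "omega1 \<Rightarrow> struct \<Rightarrow> (nat list \<times> omega1) set" where
  "gcond \<beta> B = {(t, \<gamma>). t \<in> tuples B (length t) \<and> osuc (osuc (osuc 0)) \<le> \<gamma> \<and> \<gamma> < \<beta>}"

text \<open>A stronger condition does not have to extend the tuple; it may replace it by another one
  that keeps its \<Pi> properties of the recorded level. This freedom is used in
  \<open>gle_jump\<close>.\<close>

definition gle :: "vocabulary \<Rightarrow> struct \<Rightarrow> nat list \<times> omega1 \<Rightarrow> nat list \<times> omega1 \<Rightarrow> bool" where
  "gle L B p q \<longleftrightarrow> snd p \<le> snd q \<and> length (fst p) \<le> length (fst q) \<and>
     leq L (snd p) B (fst p) B (take (length (fst p)) (fst q))"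

lemma take_tuples: "t \<in> tuples B n \<Longrightarrow> k \<le> n \<Longrightarrow> take k t \<in> tuples B k"
  by (auto simp: tuples_def dest: in_set_takeD)

lemma drop_tuples: "t \<in> tuples B (k + n) \<Longrightarrow> drop k t \<in> tuples B n"
  by (auto simp: tuples_def dest: in_set_dropD)

lemma gle_refl: "gle L B p p"
  by (simp add: gle_def leq_refl)

lemma gle_trans:
  assumes "gle L B p q" "gle L B q r" "p \<in> gcond \<beta> B" "q \<in> gcond \<beta> B" "r \<in> gcond \<beta> B" "is_structure L B"
  shows "gle L B p r"
proof -
  obtain s \<alpha> t \<gamma> u \<delta> where p: "p = (s, \<alpha>)" and q: "q = (t, \<gamma>)" and r: "r = (u, \<delta>)"
    by (metis surj_pair)
  have st: "s \<in> tuples B (length s)" "t \<in> tuples B (length t)" "u \<in> tuples B (length u)"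
    using assms p q r by (auto simp: gcond_def)
  have h: "\<alpha> \<le> \<gamma>" "\<gamma> \<le> \<delta>" "length s \<le> length t" "length t \<le> length u"
    "leq L \<alpha> B s B (take (length s) t)" "leq L \<gamma> B t B (take (length t) u)"
    using assms(1,2) p q r by (auto simp: gle_def)
  have pt: "pt L (length t) B t" "pt L (length t) B (take (length t) u)"
    using st h(4) take_tuples assms(6) by auto
  have "leq L \<alpha> B t B (take (length t) u)"
    using leq_mono[OF h(6,1) pt] .
  from leq_take[OF this pt h(3)] have "leq L \<alpha> B (take (length s) t) B (take (length s) u)"
    using h(3) by (simp add: min_def)
  from leq_trans[OF h(5) this, of "length s"] have "leq L \<alpha> B s B (take (length s) u)"
    using st h take_tuples assms(6) by simp
  then show ?thesis using h by (auto simp: gle_def p r)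
qed

lemma gle_extend:
  assumes "(t, \<gamma>) \<in> gcond \<beta> B" "y \<in> tuples B m" "\<gamma> \<le> \<gamma>'" "\<gamma>' < \<beta>"
  shows "(t @ y, \<gamma>') \<in> gcond \<beta> B" "gle L B (t, \<gamma>) (t @ y, \<gamma>')"
  using assms by (auto simp: gcond_def gle_def leq_refl tuples_def)

text \<open>
  All structures satisfying the sentence at hand agree up to level \<open>\<beta>\<close>, so that a condition which is
  compatible with a tuple of another such structure can be extended inside \<open>B\<close> accordingly.
\<close>

lemma gle_jump:
  assumes c: "(t, \<gamma>) \<in> gcond \<beta> B" and B: "is_structure L B" and N: "is_structure L N"
    and d: "d \<in> tuples N (length t)" and l: "leq L \<gamma> B t N d" and y: "y \<in> tuples N m"
    and \<gamma>': "\<gamma> \<le> \<gamma>'" "\<gamma>' < \<beta>" and eq: "leq L \<beta> B [] N []"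
  shows "\<exists>s z. s \<in> tuples B (length t) \<and> z \<in> tuples B m \<and> (s @ z, \<gamma>') \<in> gcond \<beta> B \<and>
    gle L B (t, \<gamma>) (s @ z, \<gamma>') \<and> leq L \<gamma>' N (d @ y) B (s @ z)"
proof -
  have ptn: "pt L 0 B []" "pt L 0 N []" using B N by (auto simp: tuples_0)
  have g: "osuc (osuc (osuc 0)) \<le> \<gamma>" "t \<in> tuples B (length t)" using c by (auto simp: gcond_def)
  then have g0: "0 < \<gamma>'" using \<gamma>' by (meson less_le_trans zero_less_osuc)
  have dy: "d @ y \<in> tuples N (length t + m)" using d y by (rule tuples_appendI)
  from leq_back[OF eq ptn g0 \<gamma>'(2) dy] obtain c where
    c: "c \<in> tuples B (length t + m)" "leq L \<gamma>' N (d @ y) B c" by auto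
  let ?s = "take (length t) c" and ?z = "drop (length t) c"
  have s: "?s \<in> tuples B (length t)" and z: "?z \<in> tuples B m"
    using c(1) take_tuples drop_tuples by auto
  have ptc: "pt L (length t + m) N (d @ y)" "pt L (length t + m) B c" using B N dy c(1) by auto
  have "leq L \<gamma> N (d @ y) B c" using leq_mono[OF c(2) \<gamma>'(1) ptc] .
  from leq_take[OF this ptc, of "length t"] have "leq L \<gamma> N d B ?s"
    using tuples_length[OF d] by simp
  from leq_trans[OF l this, of "length t"] have "leq L \<gamma> B t B ?s" using g d s B N by blast
  then show ?thesis
    using s z c(2) \<gamma>' g order_trans[OF g(1) \<gamma>'(1)] tuples_length[OF c(1)] c(1)
    by (intro exI[of _ ?s] exI[of _ ?z]) (auto simp: gcond_def gle_def)
qed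

text \<open>Inclusion is enough: if \<open>b\<close> satisfies the predicate chosen for
  \<open>a\<close>, the \<open>\<Sigma>\<^sub>\<beta>\<close> predicate chosen for \<open>b\<close>
  belongs to the type of \<open>b\<close>, hence to that of \<open>a\<close>, and gives the reverse
  inclusion.\<close>

lemma atomic_atI:
  assumes M: "is_structure L M" and \<beta>: "0 < \<beta>"
    and weak: "\<And>n a. a \<in> tuples M n \<Longrightarrow> \<exists>m \<gamma> P. \<gamma> < \<beta> \<and> defP L \<gamma> (n + m) P \<and>
     (\<exists>c\<in>tuples M m. P M (a @ c)) \<and>
     (\<forall>b\<in>tuples M n. \<forall>c\<in>tuples M m. P M (b @ c) \<longrightarrow> Sigma_type L \<beta> M b \<subseteq> Sigma_type L \<beta> M a)"
  shows "atomic_at L \<beta> M"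
  unfolding atomic_at_def
proof (intro allI ballI)
  fix n a assume a: "a \<in> tuples M n"
  from weak[OF a] obtain m \<gamma> P where P: "\<gamma> < \<beta>" "defP L \<gamma> (n + m) P" "\<exists>c\<in>tuples M m. P M (a @ c)"
     "\<And>b c. b \<in> tuples M n \<Longrightarrow> c \<in> tuples M m \<Longrightarrow> P M (b @ c) \<Longrightarrow> Sigma_type L \<beta> M b \<subseteq> Sigma_type L \<beta> M a"
    by blast
  have "Sigma_type L \<beta> M b = Sigma_type L \<beta> M a"
    if b: "b \<in> tuples M n" and c: "c \<in> tuples M m" "P M (b @ c)" for b c
  proof
    show ba: "Sigma_type L \<beta> M b \<subseteq> Sigma_type L \<beta> M a" using P(4)[OF b c] .
    from weak[OF b] obtain m' \<gamma>' P' where P': "\<gamma>' < \<beta>" "defP L \<gamma>' (n + m') P'" "\<exists>c\<in>tuples M m'. P' M (b @ c)"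
       "\<And>x c. x \<in> tuples M n \<Longrightarrow> c \<in> tuples M m' \<Longrightarrow> P' M (x @ c) \<Longrightarrow> Sigma_type L \<beta> M x \<subseteq> Sigma_type L \<beta> M b"
      by blast
    have "defS L \<beta> n (\<lambda>N x. \<exists>c\<in>tuples N m'. P' N (x @ c))"
      using defS_Ex[OF defS_of_defP[OF P'(2,1)] \<beta>] .
    from Sigma_type_subsetD[OF ba _ _ this P'(3)] M a b have "\<exists>c\<in>tuples M m'. P' M (a @ c)" by blast
    then show "Sigma_type L \<beta> M a \<subseteq> Sigma_type L \<beta> M b" using P'(4)[OF a] by blast
  qed
  then show "\<exists>m \<gamma> P. \<gamma> < \<beta> \<and> defP L \<gamma> (n + m) P \<and> (\<exists>c\<in>tuples M m. P M (a @ c)) \<and>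
     (\<forall>b\<in>tuples M n. \<forall>c\<in>tuples M m. P M (b @ c) \<longrightarrow> Sigma_type L \<beta> M b = Sigma_type L \<beta> M a)"
    using P(1-3) by blast
qed

lemma map_nth_shift: "length xs = k \<Longrightarrow> map ((!) (xs @ ys)) [k..<k + length ys] = ys"
  by (auto intro!: nth_equalityI simp: nth_append)

text \<open>An omitting types argument. For each realised type and each list of positions, some
  condition either forces the type of these positions to be included in it, or forces a formula
  outside it. For the type that the generic tuple really has, the second is impossible, so the first
  happens, and the condition itself supplies the isolating formula. Countability of the set of types
  keeps the number of dense sets countable.\<close>

theorem ex_atomic_model:
  assumes \<beta>: "osuc (osuc (osuc 0)) < \<beta>" and S: "defP L (osuc \<beta>) 0 S"
    and B: "is_structure L B" "S B []"
    and eq: "\<And>N. is_structure L N \<Longrightarrow> S N [] \<Longrightarrow> leq L \<beta> B [] N []"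
    and types: "countable {Sigma_type L \<beta> N a | N a n. is_structure L N \<and> S N [] \<and> a \<in> tuples N n}"
  shows "\<exists>M. is_structure L M \<and> S M [] \<and> atomic_at L \<beta> M"
proof -
  let ?C = "gcond \<beta> B" and ?le = "gle L B"
  define Ty where "Ty = {Sigma_type L \<beta> N a | N a n. is_structure L N \<and> S N [] \<and> a \<in> tuples N n}"
  have \<beta>0: "0 < \<beta>" using \<beta> by (meson less_trans zero_less_osuc)
  \<comment> \<open>Every conjunct of \<open>S\<close> says that all tuples satisfy some
    \<open>\<Sigma>\<^sub>\<beta>\<close> predicate \<open>Q i\<close>, whose matrices
    \<open>R i j\<close> lie below \<open>\<beta>\<close> and so can be guaranteed by a
    condition.\<close>
  from defP_decompose[OF S zero_less_osuc] obtain m \<delta> Q where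
    "\<forall>i::nat. \<delta> i < osuc \<beta> \<and> defS L (\<delta> i) (0 + m i) (Q i)"
    and SQ: "\<forall>A. is_structure L A \<longrightarrow> (\<forall>a\<in>tuples A 0. S A a \<longleftrightarrow> (\<forall>i. \<forall>c\<in>tuples A (m i). Q i A (a @ c)))"
    by blast
  then have Q: "defS L \<beta> (m i) (Q i)" for i using defS_mono[of L "\<delta> i" "m i" "Q i" \<beta>] by auto
  have S_iff: "S A [] \<longleftrightarrow> (\<forall>i. \<forall>c\<in>tuples A (m i). Q i A c)" if "is_structure L A" for A
    using SQ that by (simp add: tuples_0)
  have "\<forall>i. \<exists>k \<epsilon> R. (\<forall>j::nat. \<epsilon> j < \<beta> \<and> defP L (\<epsilon> j) (m i + k j) (R j)) \<and>
    (\<forall>A. is_structure L A \<longrightarrow> (\<forall>a\<in>tuples A (m i). Q i A a \<longleftrightarrow> (\<exists>j. \<exists>c\<in>tuples A (k j). R j A (a @ c))))"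
    using defS_decompose[OF Q \<beta>0] by blast
  then obtain k \<epsilon> R where kR: "\<forall>i. (\<forall>j::nat. \<epsilon> i j < \<beta> \<and> defP L (\<epsilon> i j) (m i + k i j) (R i j)) \<and>
    (\<forall>A. is_structure L A \<longrightarrow> (\<forall>a\<in>tuples A (m i). Q i A a \<longleftrightarrow> (\<exists>j. \<exists>c\<in>tuples A (k i j). R i j A (a @ c))))"
    unfolding choice_iff by (elim exE)
  have R: "\<epsilon> i j < \<beta>" "defP L (\<epsilon> i j) (m i + k i j) (R i j)" for i j using kR by blast+
  have QR: "Q i A a \<longleftrightarrow> (\<exists>j. \<exists>c\<in>tuples A (k i j). R i j A (a @ c))"
    if "is_structure L A" "a \<in> tuples A (m i)" for i A a using kR that by blast

  define D1 :: "nat \<Rightarrow> (nat list \<times> omega1) set" where "D1 n = {p. n \<le> length (fst p)}" for n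
  define D2 :: "nat \<times> nat list \<Rightarrow> (nat list \<times> omega1) set" where
    "D2 x = {(t, \<gamma>). \<exists>e. set (snd x) \<subseteq> {..<length t} \<and> e < length t \<and>
        t ! e = fun_of B (fst x) (map ((!) t) (snd x))}" for x
  define W where "W r \<rho> y \<epsilon> = {(t, \<gamma>). \<exists>js. length js = length y \<and> set js \<subseteq> {..<length t} \<and>
     length r \<le> length t \<and> \<epsilon> \<le> \<gamma> \<and> leq L \<epsilon> B (r @ y) B (map ((!) t) ([0..<length r] @ js))}"
    for r :: "nat list" and \<rho> :: omega1 and y \<epsilon>
  define D3 where "D3 x = {p. (\<forall>q\<in>?C. ?le p q \<longrightarrow> \<not> ?le (fst x) q)} \<union>
     W (fst (fst x)) (snd (fst x)) (fst (snd x)) (snd (snd x))"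
     for x :: "(nat list \<times> omega1) \<times> nat list \<times> omega1"
  \<comment> \<open>\<open>N\<close> ranges over all models of \<open>S\<close> and not only over
    \<open>B\<close>, because the structure to which this is applied is the generic one, not yet
    available.\<close>
  define Iso where "Iso p is = {(t, \<gamma>). set is \<subseteq> {..<length t} \<and>
     (\<forall>N d. is_structure L N \<and> S N [] \<and> d \<in> tuples N (length t) \<and> leq L \<gamma> B t N d \<longrightarrow>
        Sigma_type L \<beta> N (map ((!) d) is) \<subseteq> p)}" for p "is"
  define Force where "Force p is = {(t, \<gamma>). \<exists>\<sigma>\<in>formulas L (length is). Sigma_in \<beta> \<sigma> \<and> \<sigma> \<notin> p \<and>
     (\<exists>\<epsilon> P js. \<epsilon> \<le> \<gamma> \<and> defP L \<epsilon> (length is + length js) P \<and> set (is @ js) \<subseteq> {..<length t} \<and>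
        P B (map ((!) t) (is @ js)) \<and>
        (\<forall>N x c. is_structure L N \<and> x \<in> tuples N (length is) \<and> c \<in> tuples N (length js) \<and> P N (x @ c) \<longrightarrow>
           holds N x \<sigma>))}" for p "is"
  define D4 where "D4 x = Iso (fst x) (snd x) \<union> Force (fst x) (snd x)" for x
  \<comment> \<open>Lists of the wrong length meet the requirement vacuously, so the family may be
    indexed by all pairs.\<close>
  define D5 :: "nat \<times> nat list \<Rightarrow> (nat list \<times> omega1) set" where
    "D5 x = {(t, \<gamma>). length (snd x) = m (fst x) \<longrightarrow> set (snd x) \<subseteq> {..<length t} \<and>
      (\<exists>j js. \<epsilon> (fst x) j \<le> \<gamma> \<and> length js = k (fst x) j \<and> set js \<subseteq> {..<length t} \<and>
         R (fst x) j B (map ((!) t) (snd x @ js)))}" for x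
  define I2 where "I2 = {x :: nat \<times> nat list. fst x \<in> fun_syms L \<and> length (snd x) = fun_arity L (fst x)}"
  define I3 where "I3 = {x. fst x \<in> ?C \<and> set (fst (snd x)) \<subseteq> univ B \<and> 0 < snd (snd x) \<and>
     osuc (snd (snd x)) < snd (fst x)}"
  define \<D> where "\<D> = range D1 \<union> D2 ` I2 \<union> D3 ` I3 \<union> D4 ` (Ty \<times> UNIV) \<union> range D5"

  obtain u where u: "u \<in> univ B" using B(1) by (auto simp: is_structure_def)
  have cond_len: "\<exists>s. (s, \<gamma>) \<in> ?C \<and> ?le (t, \<gamma>) (s, \<gamma>) \<and> set is \<subseteq> {..<length s}"
    if "(t, \<gamma>) \<in> ?C" for t \<gamma> "is"
  proof -
    have r: "replicate (Suc (sum_list is)) u \<in> tuples B (Suc (sum_list is))"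
      using u by (auto simp: tuples_def)
    have "\<gamma> < \<beta>" using that by (simp add: gcond_def)
    from gle_extend[OF that r order_refl this] show ?thesis
      by (intro exI[of _ "t @ replicate (Suc (sum_list is)) u"])
        (auto dest: member_le_sum_list)
  qed
  have cC: "countable ?C"
  proof (rule countable_subset)
    show "?C \<subseteq> UNIV \<times> {\<gamma>. \<gamma> < \<beta>}" by (auto simp: gcond_def)
    show "countable ((UNIV :: nat list set) \<times> {\<gamma>. \<gamma> < \<beta>})"
      by (intro countable_SIGMA countable_below_omega1) auto
  qed
  have cI3: "countable I3"
  proof (rule countable_subset)
    show "I3 \<subseteq> ?C \<times> UNIV \<times> {\<gamma>. \<gamma> < \<beta>}"
    proof
      fix x assume "x \<in> I3"
      then have x: "fst x \<in> ?C" "osuc (snd (snd x)) < snd (fst x)" by (auto simp: I3_def)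
      have "snd (snd x) < snd (fst x)" using x(2) less_osuc less_trans by blast
      moreover have "snd (fst x) < \<beta>" using x(1) by (auto simp: gcond_def)
      ultimately show "x \<in> ?C \<times> UNIV \<times> {\<gamma>. \<gamma> < \<beta>}"
        using x(1) less_trans by (cases x) auto
    qed
    show "countable (?C \<times> (UNIV :: nat list set) \<times> {\<gamma>. \<gamma> < \<beta>})"
      by (intro countable_SIGMA countable_below_omega1 cC) auto
  qed
  have c\<D>: "countable \<D>"
    unfolding \<D>_def
    by (intro countable_Un countable_image countable_SIGMA types[folded Ty_def] cI3) auto

  have dense: "\<exists>q\<in>?C. ?le p q \<and> q \<in> D" if "D \<in> \<D>" "p \<in> ?C" for D p
  proof -
    obtain t \<gamma> where p: "p = (t, \<gamma>)" by fastforce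
    have tc: "(t, \<gamma>) \<in> ?C" using that(2) p by simp
    then have t: "t \<in> tuples B (length t)" and g3: "osuc (osuc (osuc 0)) \<le> \<gamma>" and g\<beta>: "\<gamma> < \<beta>"
      by (auto simp: gcond_def)
    from that(1) consider (1) n where "D = D1 n" | (2) x where "x \<in> I2" "D = D2 x"
      | (3) x where "x \<in> I3" "D = D3 x" | (4) T "is" where "T \<in> Ty" "D = D4 (T, is)"
      | (5) i "is" where "D = D5 (i, is)"
      unfolding \<D>_def by auto
    then show ?thesis
    proof cases
      case 1
      obtain s where s: "(s, \<gamma>) \<in> ?C" "?le (t, \<gamma>) (s, \<gamma>)" "set [n] \<subseteq> {..<length s}" using cond_len[OF tc] by blast
      then show ?thesis unfolding p 1 by (intro bexI[of _ "(s, \<gamma>)"]) (auto simp: D1_def)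
    next
      case 2
      obtain f js where x: "x = (f, js)" by fastforce
      have f: "f \<in> fun_syms L" "length js = fun_arity L f" using 2(1) by (auto simp: I2_def x)
      obtain s where s: "(s, \<gamma>) \<in> ?C" "?le (t, \<gamma>) (s, \<gamma>)" "set js \<subseteq> {..<length s}" using cond_len[OF tc] by blast
      let ?v = "fun_of B f (map ((!) s) js)"
      have "map ((!) s) js \<in> tuples B (fun_arity L f)"
        using s(1,3) f(2) by (force simp: gcond_def tuples_def)
      then have v: "[?v] \<in> tuples B 1" using B(1) f(1) by (auto simp: is_structure_def tuples_def)
      have e: "(s @ [?v], \<gamma>) \<in> ?C" "?le (s, \<gamma>) (s @ [?v], \<gamma>)"
        using gle_extend[OF s(1) v order_refl g\<beta>] by auto
      have "?le (t, \<gamma>) (s @ [?v], \<gamma>)" using gle_trans[OF s(2) e(2) tc s(1) e(1) B(1)] .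
      moreover have eq: "map ((!) (s @ [?v])) js = map ((!) s) js" using s(3) by (auto simp: nth_append)
      have "(s @ [?v], \<gamma>) \<in> D2 x"
        unfolding D2_def x mem_Collect_eq prod.case fst_conv snd_conv eq
        using s(3) by (intro exI[of _ "length s"]) auto
      ultimately show ?thesis unfolding p 2(2) using e(1) by blast
    next
      case 3
      obtain r \<rho> y \<eta> where x: "x = ((r, \<rho>), y, \<eta>)" by (metis surj_pair)
      have rc: "(r, \<rho>) \<in> ?C" and y: "y \<in> tuples B (length y)" and \<eta>: "0 < \<eta>" "osuc \<eta> < \<rho>"
        using 3(1) by (auto simp: I3_def x tuples_def)
      show ?thesis
      proof (cases "\<forall>q\<in>?C. ?le p q \<longrightarrow> \<not> ?le (r, \<rho>) q")
        case True
        then have "p \<in> D" by (simp add: D3_def 3(2) x)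
        then show ?thesis using that(2) gle_refl by blast
      next
        case False
        then obtain s \<zeta> where q: "(s, \<zeta>) \<in> ?C" "?le (t, \<gamma>) (s, \<zeta>)" "?le (r, \<rho>) (s, \<zeta>)" by (auto simp: p)
        have s: "s \<in> tuples B (length s)" and r: "r \<in> tuples B (length r)" and \<rho>\<beta>: "\<rho> < \<beta>" and \<zeta>: "\<zeta> < \<beta>"
          using q(1) rc by (auto simp: gcond_def)
        have rs: "length r \<le> length s" "leq L \<rho> B r B (take (length r) s)" using q(3) by (auto simp: gle_def)
        have trs: "take (length r) s \<in> tuples B (length r)" using take_tuples[OF s rs(1)] .
        \<comment> \<open>A common extension \<open>s\<close> agrees with \<open>r\<close> at level
          \<open>\<rho>\<close>, so \<open>y\<close> over \<open>r\<close> is imitated by some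
          \<open>z\<close> over \<open>s\<close>. The level is then raised to at least
          \<open>\<eta>\<close>, as \<open>W\<close> demands.\<close>
        from leq_forth[OF rs(2) _ _ \<eta> y, of "length r"] r trs B(1) obtain z where
          z: "z \<in> tuples B (length y)" "leq L \<eta> B (r @ y) B (take (length r) s @ z)" by blast
        have lz: "length z = length y" using z(1) by (rule tuples_length)
        have "\<eta> < \<beta>" using \<eta>(2) \<rho>\<beta> by (meson less_osuc less_trans)
        then have mx: "\<zeta> \<le> max \<zeta> \<eta>" "max \<zeta> \<eta> < \<beta>" using \<zeta> by auto
        have e: "(s @ z, max \<zeta> \<eta>) \<in> ?C" "?le (s, \<zeta>) (s @ z, max \<zeta> \<eta>)"
          using gle_extend[OF q(1) z(1) mx] by auto
        have "map ((!) (s @ z)) [0..<length r] = take (length r) s"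
          using rs(1) map_nth_take[of "length r" "s @ z"] by simp
        moreover have "map ((!) (s @ z)) [length s..<length s + length y] = z"
          using map_nth_shift[of s "length s" z] lz by simp
        ultimately have "(s @ z, max \<zeta> \<eta>) \<in> D" unfolding 3(2) D3_def W_def x
          using z(2) rs(1) lz by (auto intro!: exI[of _ "[length s..<length s + length y]"])
        then show ?thesis unfolding p using gle_trans[OF q(2) e(2) tc q(1) e(1) B(1)] e(1) by blast
      qed
    next
      case 4
      obtain s where s: "(s, \<gamma>) \<in> ?C" "?le (t, \<gamma>) (s, \<gamma>)" "set is \<subseteq> {..<length s}" using cond_len[OF tc] by blast
      show ?thesis
      proof (cases "(s, \<gamma>) \<in> Iso T is")
        case True
        then show ?thesis using s by (auto simp: p 4(2) D4_def)
      next
        case False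
        \<comment> \<open>Failure of \<open>Iso\<close> yields a model \<open>N\<close> and a tuple
          above the condition realising a formula outside \<open>T\<close>; one disjunct of that
          formula, with its witness, is then copied into \<open>B\<close> by
          \<open>gle_jump\<close>.\<close>
        then obtain N d where N: "is_structure L N" "S N []" and d: "d \<in> tuples N (length s)" "leq L \<gamma> B s N d"
          and nsub: "\<not> Sigma_type L \<beta> N (map ((!) d) is) \<subseteq> T" using s(3) by (auto simp: Iso_def)
        have di: "map ((!) d) is \<in> tuples N (length is)"
          by (rule tuples_map_nth[OF d(1)]) (use s(3) in auto)
        obtain \<sigma> where \<sigma>: "\<sigma> \<in> formulas L (length is)" "Sigma_in \<beta> \<sigma>" "holds N (map ((!) d) is) \<sigma>" "\<sigma> \<notin> T"
          using nsub by (auto simp: Sigma_type_def)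
        from defS_decompose[OF defS_formula[OF \<sigma>(1,2)] \<beta>0] obtain n \<eta> P where
          P: "\<forall>i::nat. \<eta> i < \<beta> \<and> defP L (\<eta> i) (length is + n i) (P i)" and
          \<sigma>P: "\<forall>A. is_structure L A \<longrightarrow> (\<forall>a\<in>tuples A (length is). holds A a \<sigma> \<longleftrightarrow> (\<exists>i. \<exists>c\<in>tuples A (n i). P i A (a @ c)))"
          by blast
        obtain i y where y: "y \<in> tuples N (n i)" "P i N (map ((!) d) is @ y)" using \<sigma>P N(1) di \<sigma>(3) by blast
        have mx: "\<gamma> \<le> max \<gamma> (\<eta> i)" "max \<gamma> (\<eta> i) < \<beta>" using g\<beta> P by auto
        from gle_jump[OF s(1) B(1) N(1) d y(1) mx eq[OF N]] obtain s' z where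
          z: "s' \<in> tuples B (length s)" "z \<in> tuples B (n i)" "(s' @ z, max \<gamma> (\<eta> i)) \<in> ?C"
            "?le (s, \<gamma>) (s' @ z, max \<gamma> (\<eta> i))" "leq L (max \<gamma> (\<eta> i)) N (d @ y) B (s' @ z)" by blast
        let ?js = "[length s..<length s + n i]"
        have ls: "length d = length s" "length s' = length s" "length y = n i" "length z = n i"
          using d(1) z(1,2) y(1) by (auto simp: tuples_def)
        have l: "leq L (max \<gamma> (\<eta> i)) N (map ((!) (d @ y)) (is @ ?js)) B (map ((!) (s' @ z)) (is @ ?js))"
          by (rule leq_subst[OF z(5), of "length s + n i"])
            (use tuples_appendI[OF d(1) y(1)] tuples_appendI[OF z(1,2)] N B s(3) in auto)
        have e: "map ((!) (d @ y)) (is @ ?js) = map ((!) d) is @ y"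
        proof -
          have "map ((!) (d @ y)) is = map ((!) d) is" using s(3) ls by (auto simp: nth_append)
          then show ?thesis using map_nth_shift[of d "length s" y] ls by simp
        qed
        have "pt L (length is + n i) N (map ((!) d) is @ y)" using N tuples_appendI[OF di y(1)] by blast
        moreover have "pt L (length is + n i) B (map ((!) (s' @ z)) (is @ ?js))"
        proof -
          have "s' @ z \<in> tuples B (length s + n i)" using tuples_appendI[OF z(1,2)] .
          then have "map ((!) (s' @ z)) (is @ ?js) \<in> tuples B (length (is @ ?js))"
            by (rule tuples_map_nth) (use s(3) in auto)
          then show ?thesis using B by simp
        qed
        moreover have "defP L (max \<gamma> (\<eta> i)) (length is + n i) (P i)"
          using P defP_mono[of L "\<eta> i" _ "P i" "max \<gamma> (\<eta> i)"] by simp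
        ultimately have PB: "P i B (map ((!) (s' @ z)) (is @ ?js))"
          using leqD[OF l[unfolded e]] y(2) by blast
        have "(s' @ z, max \<gamma> (\<eta> i)) \<in> Force T is"
          unfolding Force_def mem_Collect_eq prod.case
        proof (intro bexI[OF _ \<sigma>(1)] conjI exI)
          show "defP L (\<eta> i) (length is + length ?js) (P i)" using P by simp
          show "P i B (map ((!) (s' @ z)) (is @ ?js))" by (rule PB)
          show "\<forall>N x c. is_structure L N \<and> x \<in> tuples N (length is) \<and> c \<in> tuples N (length ?js) \<and> P i N (x @ c) \<longrightarrow>
             holds N x \<sigma>"
            using \<sigma>P by simp blast
        qed (use \<sigma> s(3) ls in auto)
        then have "(s' @ z, max \<gamma> (\<eta> i)) \<in> D" by (simp add: 4(2) D4_def)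
        then show ?thesis unfolding p using gle_trans[OF s(2) z(4) tc s(1) z(3) B(1)] z(3) by blast
      qed
    next
      case 5
      obtain s where s: "(s, \<gamma>) \<in> ?C" "?le (t, \<gamma>) (s, \<gamma>)" "set is \<subseteq> {..<length s}" using cond_len[OF tc] by blast
      show ?thesis
      proof (cases "length is = m i")
        case False
        then show ?thesis using s(1,2) by (auto simp: p 5 D5_def)
      next
        case True
        have "map ((!) s) is \<in> tuples B (m i)"
          using tuples_map_nth[of s B "length s" "is"] s True by (auto simp: gcond_def)
        then obtain j c where c: "c \<in> tuples B (k i j)" "R i j B (map ((!) s) is @ c)"
          using S_iff[OF B(1)] B(2) QR[OF B(1)] by blast
        have mx: "\<gamma> \<le> max \<gamma> (\<epsilon> i j)" "max \<gamma> (\<epsilon> i j) < \<beta>" using g\<beta> R(1) by auto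
        have e: "(s @ c, max \<gamma> (\<epsilon> i j)) \<in> ?C" "?le (s, \<gamma>) (s @ c, max \<gamma> (\<epsilon> i j))"
          using gle_extend[OF s(1) c(1) mx] by auto
        let ?js = "[length s..<length s + k i j]"
        have "map ((!) (s @ c)) is = map ((!) s) is" using s(3) by (auto simp: nth_append)
        then have "map ((!) (s @ c)) (is @ ?js) = map ((!) s) is @ c"
          using map_nth_shift[of s "length s" c] tuples_length[OF c(1)] by simp
        then have "(s @ c, max \<gamma> (\<epsilon> i j)) \<in> D5 (i, is)"
          using s(3) c(2) tuples_length[OF c(1)]
          by (auto simp: D5_def simp del: map_append intro!: exI[of _ j] exI[of _ ?js])
        then show ?thesis unfolding p 5 using gle_trans[OF s(2) e(2) tc s(1) e(1) B(1)] e(1) by blast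
      qed
    qed
  qed

  have "([], osuc (osuc (osuc 0))) \<in> ?C" using \<beta> by (auto simp: gcond_def tuples_def)
  from generic_chain[where le = ?le, OF c\<D> this dense gle_refl] obtain c where
    c: "\<And>n. c n \<in> ?C" "\<And>n. ?le (c n) (c (Suc n))" and meet: "\<And>D. D \<in> \<D> \<Longrightarrow> \<exists>n. c n \<in> D" by blast
  have cle: "?le (c n) (c n')" if "n \<le> n'" for n n'
    using that by (induction n' rule: dec_induct) (use gle_refl gle_trans[OF _ c(2) c(1) c(1) c(1) B(1)] in blast)+
  define t where "t n = fst (c n)" for n
  define g where "g n = snd (c n)" for n
  have cn: "c n = (t n, g n)" for n by (simp add: t_def g_def)
  have tup: "t n \<in> tuples B (length (t n))" and g3: "osuc (osuc (osuc 0)) \<le> g n" and g\<beta>: "g n < \<beta>" for n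
    using c(1)[of n] by (auto simp: gcond_def cn)
  interpret generic_struct L B t g
  proof
    show "is_structure L B" by (rule B)
    show "t n \<in> tuples B (length (t n))" "osuc (osuc (osuc 0)) \<le> g n" for n by (fact tup g3)+
    show "g n \<le> g n' \<and> length (t n) \<le> length (t n') \<and> leq L (g n) B (t n) B (take (length (t n)) (t n'))"
      if "n \<le> n'" for n n' using cle[OF that] by (simp add: gle_def cn)
    show "\<exists>n. x \<le> length (t n)" for x
      using meet[of "D1 x"] by (auto simp: \<D>_def D1_def t_def)
    show "\<exists>n e. set is \<subseteq> {..<length (t n)} \<and> e < length (t n) \<and> t n ! e = fun_of B f (map ((!) (t n)) is)"
      if "f \<in> fun_syms L" "length is = fun_arity L f" for f "is"
    proof -
      have "(f, is) \<in> I2" using that by (simp add: I2_def)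
      then have "D2 (f, is) \<in> \<D>" by (simp add: \<D>_def)
      from meet[OF this] show ?thesis by (simp add: D2_def cn)
    qed
    show "\<exists>m js. length js = length y \<and> set js \<subseteq> {..<length (t m)} \<and> length (t n) \<le> length (t m) \<and> \<eta> \<le> g m \<and>
        leq L \<eta> B (t n @ y) B (map ((!) (t m)) ([0..<length (t n)] @ js))"
      if "set y \<subseteq> univ B" "0 < \<eta>" "osuc \<eta> < g n" for n y \<eta>
    proof -
      have "(c n, y, \<eta>) \<in> I3" using that c(1)[of n] by (simp add: I3_def g_def)
      then have "D3 (c n, y, \<eta>) \<in> \<D>" by (simp add: \<D>_def)
      from meet[OF this] obtain n' where n': "c n' \<in> D3 (c n, y, \<eta>)" by blast
      \<comment> \<open>Two members of a chain have a common extension, so the first alternative in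
        \<open>D3\<close> is excluded.\<close>
      have "?le (c n') (c (max n n'))" "?le (c n) (c (max n n'))" by (rule cle, simp)+
      then have "c n' \<in> W (t n) (g n) y \<eta>" using n' c(1)[of "max n n'"] by (auto simp: D3_def t_def g_def)
      then show ?thesis by (auto simp: W_def cn)
    qed
  qed
  have SM: "S M []"
    unfolding S_iff[OF is_structure_M]
  proof (intro allI ballI)
    fix i a assume a: "a \<in> tuples M (m i)"
    have la: "length a = m i" using a by (rule tuples_length)
    have "D5 (i, a) \<in> \<D>" by (simp add: \<D>_def)
    from meet[OF this] la obtain n j js where js: "set a \<subseteq> {..<length (t n)}" "\<epsilon> i j \<le> g n" "length js = k i j"
      "set js \<subseteq> {..<length (t n)}" "R i j B (map ((!) (t n)) (a @ js))"
      by (auto simp: D5_def cn)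
    from truth_ex[where R = "R i j" and a = a and js = js and n = n and \<epsilon> = "\<epsilon> i j" and k = "m i"]
      R(2)[of i j] js a
    have "\<exists>c\<in>tuples M (k i j). R i j M (a @ c)" by simp
    then show "Q i M a" using QR[OF is_structure_M a] by blast
  qed
  have "atomic_at L \<beta> M"
  proof (rule atomic_atI[OF is_structure_M \<beta>0])
    fix k' a assume a: "a \<in> tuples M k'"
    have la: "length a = k'" using a by (rule tuples_length)
    let ?p = "Sigma_type L \<beta> M a"
    have "?p \<in> Ty" unfolding Ty_def using is_structure_M SM a by blast
    then have "D4 (?p, a) \<in> \<D>" by (simp add: \<D>_def)
    from meet[OF this] obtain n where n: "c n \<in> D4 (?p, a)" by blast
    have "c n \<notin> Force ?p a"
    proof
      assume "c n \<in> Force ?p a"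
      then obtain \<sigma> \<eta> P js where \<sigma>: "\<sigma> \<in> formulas L (length a)" "Sigma_in \<beta> \<sigma>" "\<sigma> \<notin> ?p"
        and js: "\<eta> \<le> g n" "defP L \<eta> (length a + length js) P" "set (a @ js) \<subseteq> {..<length (t n)}"
          "P B (map ((!) (t n)) (a @ js))"
        and imp: "\<forall>N x c. is_structure L N \<and> x \<in> tuples N (length a) \<and> c \<in> tuples N (length js) \<and> P N (x @ c) \<longrightarrow>
           holds N x \<sigma>"
        unfolding Force_def cn by blast
      have "a \<in> tuples M (length a)" using a la by simp
      from truth_ex[where R = P and a = a and js = js and n = n, OF js(2) this js(3,1,4)] imp is_structure_M this have "holds M a \<sigma>" by blast
      then show False using \<sigma> by (simp add: Sigma_type_def)
    qed
    then have "c n \<in> Iso ?p a" using n by (simp add: D4_def)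
    then have sa: "set a \<subseteq> {..<length (t n)}"
      and iso: "\<And>d. d \<in> tuples M (length (t n)) \<Longrightarrow> leq L (g n) B (t n) M d \<Longrightarrow>
          Sigma_type L \<beta> M (map ((!) d) a) \<subseteq> ?p"
      using is_structure_M SM by (auto simp: Iso_def cn)
    let ?l = "length (t n)"
    let ?d = "map cls [0..<?l]"
    \<comment> \<open>The isolating predicate speaks about the positions \<open>a\<close> and about
      the whole condition \<open>t n\<close>; its witness is the generic tuple \<open>?d\<close>,
      which ties \<open>a\<close> to the condition.\<close>
    let ?w = "map ((!) (t n)) a @ t n"
    have clsa: "map cls a = a" using a by (intro map_idI) (auto simp: tuples_def univ_M)
    have w: "?w \<in> tuples B (k' + ?l)" using tuples_appendI[OF inst_tuples[OF sa la] tup] .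
    have d: "?d \<in> tuples M ?l" using cls_in_M by (auto simp: tuples_def)
    have "leq L (g n) B (map ((!) (t n)) (a @ [0..<?l])) M (map ((!) ?d) (a @ [0..<?l]))"
      by (rule leq_subst[OF leq_M_all]) (use B tup d is_structure_M sa in auto)
    moreover have "map ((!) (t n)) (a @ [0..<?l]) = ?w" by (simp add: map_nth_take)
    moreover have "map ((!) ?d) (a @ [0..<?l]) = a @ ?d"
    proof -
      have "map ((!) ?d) a = map cls a" using sa by auto
      moreover have "map ((!) ?d) [0..<?l] = ?d" by (simp add: map_nth_take)
      ultimately show ?thesis using clsa by (simp only: map_append)
    qed
    ultimately have lw: "leq L (g n) B ?w M (a @ ?d)" by (simp only:)
    have g0: "0 < g n" using g3[of n] by (meson less_le_trans zero_less_osuc)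
    obtain P where P: "defP L (g n) (k' + ?l) P" "\<And>x. x \<in> tuples M (k' + ?l) \<Longrightarrow> P M x \<longleftrightarrow> leq L (g n) B ?w M x"
      using ex_leq_formula[of L B ?w "k' + ?l" M "g n"] w B is_structure_M g0 by blast
    have "Sigma_type L \<beta> M b \<subseteq> ?p" if b: "b \<in> tuples M k'" and x: "x \<in> tuples M ?l" and Pb: "P M (b @ x)" for b x
    proof -
      have bx: "b @ x \<in> tuples M (k' + ?l)" using b x by (rule tuples_appendI)
      have l: "leq L (g n) B ?w M (b @ x)" using P(2)[OF bx] Pb by blast
      have pw: "pt L (k' + ?l) B ?w" "pt L (k' + ?l) M (b @ x)" using w bx B is_structure_M by auto
      have lb: "length b = k'" "length x = ?l" using b x by (auto simp: tuples_def)
      have "leq L (g n) B (map ((!) ?w) [k'..<k' + ?l]) M (map ((!) (b @ x)) [k'..<k' + ?l])"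
        by (rule leq_subst[OF l pw]) auto
      then have "leq L (g n) B (t n) M x"
        using map_nth_shift[of "map ((!) (t n)) a" k' "t n"] map_nth_shift[of b k' x] la lb by simp
      from iso[OF x this] have "Sigma_type L \<beta> M (map ((!) x) a) \<subseteq> ?p" .
      \<comment> \<open>In \<open>?w\<close> entry \<open>i\<close> repeats entry
        \<open>k' + a ! i\<close>. Atomic agreement preserves this equality, so \<open>b\<close> can
        be read off from \<open>x\<close>.\<close>
      moreover have "map ((!) x) a = b"
      proof (rule nth_equalityI)
        fix i assume "i < length (map ((!) x) a)"
        then have i: "i < k'" using la by simp
        have ai: "a ! i < ?l" using subsetD[OF sa nth_mem[of i a]] i la by simp
        have at: "atomic_eq L B ?w M (b @ x)" using leq_atomic_eq[OF l pw] .
        have "i < length ?w \<and> k' + a ! i < length ?w" using i ai la by simp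
        with at have "?w ! i = ?w ! (k' + a ! i) \<longleftrightarrow> (b @ x) ! i = (b @ x) ! (k' + a ! i)"
          unfolding atomic_eq_def by blast
        moreover have "?w ! i = ?w ! (k' + a ! i)" using i la by (simp add: nth_append)
        ultimately show "map ((!) x) a ! i = b ! i" using i la lb by (simp add: nth_append)
      qed (use la lb in simp)
      ultimately show ?thesis by simp
    qed
    moreover have "P M (a @ ?d)" using P(2)[OF tuples_appendI[OF a d]] lw by blast
    ultimately show "\<exists>m \<gamma> P. \<gamma> < \<beta> \<and> defP L \<gamma> (k' + m) P \<and> (\<exists>c\<in>tuples M m. P M (a @ c)) \<and>
       (\<forall>b\<in>tuples M k'. \<forall>c\<in>tuples M m. P M (b @ c) \<longrightarrow> Sigma_type L \<beta> M b \<subseteq> Sigma_type L \<beta> M a)"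
      using g\<beta>[of n] P(1) d by blast
  qed
  then show ?thesis using is_structure_M SM by blast
qed

section \<open>Computable functions, lists and pairs relative to an oracle\<close>

section \<open>A calculus of computable functions\<close>

text \<open>
  The arguments of a computable function are the first \<open>n\<close> values of an environment, so that
  binders shift environments and compositions are resolved by unification.
\<close>

definition cf :: "nat set \<Rightarrow> nat \<Rightarrow> ((nat \<Rightarrow> nat) \<Rightarrow> nat) \<Rightarrow> bool" where
  "cf X n F \<longleftrightarrow> (\<exists>p. \<forall>e. computes X p (map e [0..<n]) (F e))"

definition cp :: "nat set \<Rightarrow> nat \<Rightarrow> ((nat \<Rightarrow> nat) \<Rightarrow> bool) \<Rightarrow> bool" where
  "cp X n P \<longleftrightarrow> cf X n (\<lambda>e. if P e then 1 else 0)"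

lemma cf_var: "i < n \<Longrightarrow> cf X n (\<lambda>e. e i)"
  unfolding cf_def
  using computes.intros(3)[of i "map e [0..<n]" X for e] by (intro exI[of _ "Proj i"]) simp

lemma cf_comp:
  assumes "cf X k G" "\<And>i. i < k \<Longrightarrow> cf X n (F i)"
  shows "cf X n (\<lambda>e. G (\<lambda>i. F i e))"
proof -
  obtain p where p: "\<And>e. computes X p (map e [0..<k]) (G e)" using assms(1) by (auto simp: cf_def)
  obtain q where q: "\<And>i e. i < k \<Longrightarrow> computes X (q i) (map e [0..<n]) (F i e)"
    using assms(2) unfolding cf_def by metis
  have "computes X (Comp p (map q [0..<k])) (map e [0..<n]) (G (\<lambda>i. F i e))" for e
    by (rule computes.intros(5)[OF _ p]) (simp add: list_all2_conv_all_nth q)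
  then show ?thesis unfolding cf_def by blast
qed

lemma cf_comp1: "cf X 1 (\<lambda>e. f (e 0)) \<Longrightarrow> cf X n a \<Longrightarrow> cf X n (\<lambda>e. f (a e))"
  using cf_comp[of X 1 "\<lambda>e. f (e 0)" n "\<lambda>_. a"] by simp

lemma cf_lift: "cf X n a \<Longrightarrow> cf X (Suc n) (\<lambda>e. a (\<lambda>i. e (Suc i)))"
  by (rule cf_comp) (auto intro: cf_var)

lemma cf_const: "cf X n (\<lambda>e. c)"
proof (induction c)
  case 0
  show ?case unfolding cf_def by (intro exI[of _ Zero]) (simp add: computes.intros)
next
  case (Suc c)
  have "cf X 1 (\<lambda>e. Suc (e 0))"
    unfolding cf_def by (intro exI[of _ Succ]) (simp add: computes.intros)
  from cf_comp1[OF this Suc] show ?case .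
qed

lemma cf_Suc:
  assumes "cf X n a" shows "cf X n (\<lambda>e. Suc (a e))"
proof -
  have "cf X 1 (\<lambda>e. Suc (e 0))"
    unfolding cf_def by (intro exI[of _ Succ]) (simp add: computes.intros)
  from cf_comp1[OF this assms] show ?thesis .
qed

lemma map_env_Suc: "map e [0..<Suc n] = e 0 # map (\<lambda>i. e (Suc i)) [0..<n]"
  by (simp add: map_upt_Suc del: upt_Suc)

lemma cf_rec:
  assumes "cf X n a" "cf X (Suc (Suc n)) (\<lambda>e. h (e 0) (e (Suc 0)) (\<lambda>i. e (Suc (Suc i))))" "cf X n b"
  shows "cf X n (\<lambda>e. rec_nat (a e) (\<lambda>m y. h m y e) (b e))"
proof -
  obtain p where p: "\<And>e. computes X p (map e [0..<n]) (a e)" using assms(1) by (auto simp: cf_def)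
  obtain q where q: "\<And>e. computes X q (map e [0..<Suc (Suc n)]) (h (e 0) (e (Suc 0)) (\<lambda>i. e (Suc (Suc i))))"
    using assms(2) by (auto simp: cf_def simp del: upt_Suc)
  have q': "computes X q (m # y # map e [0..<n]) (h m y e)" for m y e
  proof -
    have "computes X q (map (case_nat m (case_nat y e)) [0..<Suc (Suc n)]) (h m y e)"
      using q[of "case_nat m (case_nat y e)"] by simp
    then show ?thesis unfolding map_env_Suc by simp
  qed
  have step: "computes X (PrimRec p q) (k # map e [0..<n]) (rec_nat (a e) (\<lambda>m y. h m y e) k)" for k e
  proof (induction k)
    case 0
    show ?case by (simp add: computes.intros(6) p)
  next
    case (Suc k)
    show ?case using computes.intros(7)[OF Suc q'] by simp
  qed
  have "cf X (Suc n) (\<lambda>e. rec_nat (a (\<lambda>i. e (Suc i))) (\<lambda>m y. h m y (\<lambda>i. e (Suc i))) (e 0))"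
    unfolding cf_def map_env_Suc using step by blast
  moreover have "cf X n (\<lambda>e. case_nat (b e) e i)" if "i < Suc n" for i
    using that assms(3) by (cases i) (simp_all add: cf_var)
  ultimately show ?thesis using cf_comp[of X "Suc n" _ n "\<lambda>i e. case_nat (b e) e i"] by fastforce
qed

lemma cp_cf: "cp X n P \<Longrightarrow> cf X n (\<lambda>e. if P e then 1 else 0)"
  by (simp add: cp_def)

lemma cf_if:
  assumes "cp X n P" "cf X n a" "cf X n b"
  shows "cf X n (\<lambda>e. if P e then a e else b e)"
proof -
  have "cf X n (\<lambda>e. rec_nat (b e) (\<lambda>m y. a e) (if P e then 1 else 0))"
    by (rule cf_rec[OF assms(3) _ cp_cf[OF assms(1)]]) (rule cf_lift[OF cf_lift[OF assms(2)]])
  moreover have "rec_nat (b e) (\<lambda>m y. a e) (if P e then 1 else 0) = (if P e then a e else b e)" for e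
    by simp
  ultimately show ?thesis by simp
qed

lemma cp_const: "cp X n (\<lambda>e. c)"
  unfolding cp_def by (rule cf_const)

lemma cp_not:
  assumes "cp X n P" shows "cp X n (\<lambda>e. \<not> P e)"
proof -
  have "cf X n (\<lambda>e. if P e then 0 else 1)"
    by (intro cf_if cf_const assms)
  moreover have "(if P e then 0 else 1) = (if \<not> P e then 1 else (0::nat))" for e by simp
  ultimately show ?thesis unfolding cp_def by (simp only:)
qed

lemma cp_conj: "cp X n P \<Longrightarrow> cp X n Q \<Longrightarrow> cp X n (\<lambda>e. P e \<and> Q e)"
proof -
  assume a: "cp X n P" "cp X n Q"
  have "cf X n (\<lambda>e. if P e then (if Q e then 1 else 0) else 0)"
    by (intro cf_if a cf_const)
  moreover have "(if P e then (if Q e then 1 else 0) else 0) = (if P e \<and> Q e then 1 else (0::nat))" for e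
    by simp
  ultimately show ?thesis by (simp add: cp_def)
qed

lemma cp_disj:
  assumes "cp X n P" "cp X n Q" shows "cp X n (\<lambda>e. P e \<or> Q e)"
proof -
  have "cp X n (\<lambda>e. \<not> (\<not> P e \<and> \<not> Q e))" by (rule cp_not cp_conj assms)+
  then show ?thesis by simp
qed

lemma cp_imp:
  assumes "cp X n P" "cp X n Q" shows "cp X n (\<lambda>e. P e \<longrightarrow> Q e)"
proof -
  have "cp X n (\<lambda>e. \<not> P e \<or> Q e)" by (rule cp_not cp_disj assms)+
  then show ?thesis by (simp only: imp_conv_disj)
qed

lemma cp_iff:
  assumes "cp X n P" "cp X n Q" shows "cp X n (\<lambda>e. P e \<longleftrightarrow> Q e)"
proof -
  have "cp X n (\<lambda>e. (P e \<longrightarrow> Q e) \<and> (Q e \<longrightarrow> P e))" by (rule cp_conj cp_imp assms)+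
  then show ?thesis by (simp only: iff_conv_conj_imp)
qed

lemma cf_add:
  assumes "cf X n a" "cf X n b" shows "cf X n (\<lambda>e. a e + b e)"
proof -
  have "cf X n (\<lambda>e. rec_nat (a e) (\<lambda>m y. Suc y) (b e))"
    by (rule cf_rec[OF assms(1) _ assms(2)]) (intro cf_Suc cf_var, simp)
  moreover have "rec_nat x (\<lambda>m y. Suc y) y = x + y" for x y :: nat by (induction y) auto
  ultimately show ?thesis by simp
qed

lemma cf_pred:
  assumes "cf X n a" shows "cf X n (\<lambda>e. a e - 1)"
proof -
  have "cf X n (\<lambda>e. rec_nat 0 (\<lambda>m y. m) (a e))"
    by (rule cf_rec[OF cf_const _ assms]) (rule cf_var, simp)
  moreover have "rec_nat 0 (\<lambda>m y. m) x = x - 1" for x :: nat by (cases x) auto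
  ultimately show ?thesis by simp
qed

lemma cf_diff:
  assumes "cf X n a" "cf X n b" shows "cf X n (\<lambda>e. a e - b e)"
proof -
  have "cf X n (\<lambda>e. rec_nat (a e) (\<lambda>m y. y - 1) (b e))"
    by (rule cf_rec[OF assms(1) _ assms(2)]) (intro cf_pred cf_var, simp)
  moreover have "rec_nat x (\<lambda>m y. y - 1) y = x - y" for x y :: nat by (induction y) auto
  ultimately show ?thesis by simp
qed

lemma cp_eq0:
  assumes "cf X n a" shows "cp X n (\<lambda>e. a e = 0)"
proof -
  have "cf X n (\<lambda>e. rec_nat 1 (\<lambda>m y. 0) (a e))"
    by (rule cf_rec[OF cf_const _ assms]) (rule cf_const)
  moreover have "rec_nat 1 (\<lambda>m y. 0) x = (if x = 0 then 1 else (0::nat))" for x :: nat by (cases x) auto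
  ultimately show ?thesis by (simp add: cp_def del: One_nat_def)
qed

lemma cp_le: "cf X n a \<Longrightarrow> cf X n b \<Longrightarrow> cp X n (\<lambda>e. a e \<le> b e)"
  using cp_eq0[OF cf_diff[of X n a b]] by simp

lemma cp_less: "cf X n a \<Longrightarrow> cf X n b \<Longrightarrow> cp X n (\<lambda>e. a e < b e)"
  using cp_le[OF cf_Suc[of X n a], of b] by (simp add: Suc_le_eq)

lemma cp_eq: "cf X n a \<Longrightarrow> cf X n b \<Longrightarrow> cp X n (\<lambda>e. a e = b e)"
  using cp_conj[OF cp_le[of X n a b] cp_le[of X n b a]] by (simp add: eq_iff)

lemma cp_all_less:
  assumes P: "cp X (Suc n) (\<lambda>e. P (e 0) (\<lambda>i. e (Suc i)))" and b: "cf X n b"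
  shows "cp X n (\<lambda>e. \<forall>m<b e. P m e)"
proof -
  have "cp X (Suc (Suc n)) (\<lambda>e. P (e 0) (\<lambda>i. e (Suc (Suc i))))"
    unfolding cp_def
  proof -
    have "cf X (Suc (Suc n)) (\<lambda>e. case i of 0 \<Rightarrow> e 0 | Suc j \<Rightarrow> e (Suc (Suc j)))" if "i < Suc n" for i
      using that by (cases i) (simp_all add: cf_var)
    from cf_comp[where F = "\<lambda>i e. case i of 0 \<Rightarrow> e 0 | Suc j \<Rightarrow> e (Suc (Suc j))", OF P[unfolded cp_def] this]
    show "cf X (Suc (Suc n)) (\<lambda>e. if P (e 0) (\<lambda>i. e (Suc (Suc i))) then 1 else 0)" by simp
  qed
  then have "cf X n (\<lambda>e. rec_nat 1 (\<lambda>m y. if P m e then y else 0) (b e))"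
    by (intro cf_rec cf_if cf_const b cf_var) auto
  moreover have "rec_nat 1 (\<lambda>m y. if P m e then y else 0) k = (if \<forall>m<k. P m e then 1 else (0::nat))" for k e
    by (induction k) (auto simp: less_Suc_eq)
  ultimately show ?thesis by (simp add: cp_def del: One_nat_def)
qed

lemma cp_ex_less:
  assumes "cp X (Suc n) (\<lambda>e. P (e 0) (\<lambda>i. e (Suc i)))" "cf X n b"
  shows "cp X n (\<lambda>e. \<exists>m<b e. P m e)"
proof -
  have "cp X n (\<lambda>e. \<not> (\<forall>m<b e. \<not> P m e))"
    by (rule cp_not[OF cp_all_less[OF cp_not[OF assms(1)] assms(2)]])
  then show ?thesis by simp
qed

lemma cf_Least:
  assumes P: "cp X (Suc n) (\<lambda>e. P (e 0) (\<lambda>i. e (Suc i)))" and ex: "\<And>e. \<exists>m. P m e"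
  shows "cf X n (\<lambda>e. LEAST m. P m e)"
proof -
  have "cf X (Suc n) (\<lambda>e. if P (e 0) (\<lambda>i. e (Suc i)) then 0 else 1)"
    by (intro cf_if P cf_const)
  then obtain p where p: "\<And>e. computes X p (map e [0..<Suc n]) (if P (e 0) (\<lambda>i. e (Suc i)) then 0 else 1)"
    by (auto simp: cf_def simp del: upt_Suc)
  have p': "computes X p (m # map e [0..<n]) (if P m e then 0 else 1)" for m e
    using p[of "case_nat m e"] unfolding map_env_Suc by simp
  have "computes X (Mu p) (map e [0..<n]) (LEAST m. P m e)" for e
  proof (rule computes.intros(8))
    show "computes X p ((LEAST m. P m e) # map e [0..<n]) 0"
      using p'[of "LEAST m. P m e" e] LeastI_ex[OF ex[of e]] by simp
    fix m assume "m < (LEAST m. P m e)"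
    then have "\<not> P m e" by (rule not_less_Least)
    then show "\<exists>y>0. computes X p (m # map e [0..<n]) y" using p'[of m e] by auto
  qed
  then show ?thesis unfolding cf_def by blast
qed

definition pfst :: "nat \<Rightarrow> nat" where "pfst n = fst (prod_decode n)"
definition psnd :: "nat \<Rightarrow> nat" where "psnd n = snd (prod_decode n)"

lemma pfst_encode [simp]: "pfst (prod_encode (x, y)) = x"
  by (simp add: pfst_def)

lemma psnd_encode [simp]: "psnd (prod_encode (x, y)) = y"
  by (simp add: psnd_def)

lemma prod_encode_pfst_psnd [simp]: "prod_encode (pfst n, psnd n) = n"
  by (simp add: pfst_def psnd_def)

lemma prod_encode_iff: "prod_encode (x, y) = n \<longleftrightarrow> x = pfst n \<and> y = psnd n"
  by (metis pfst_encode prod_encode_pfst_psnd psnd_encode)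

lemma cf_prod_encode:
  assumes "cf X n a" "cf X n b" shows "cf X n (\<lambda>e. prod_encode (a e, b e))"
proof -
  have "cf X 1 (\<lambda>e. rec_nat 0 (\<lambda>m y. y + Suc m) (e 0))"
    by (rule cf_rec[OF cf_const]) (intro cf_add cf_Suc cf_var, simp_all add: cf_var)
  moreover have "rec_nat 0 (\<lambda>m y. y + Suc m) x = triangle x" for x
    by (induction x) (auto simp: triangle_Suc)
  ultimately have "cf X 1 (\<lambda>e. triangle (e 0))" by simp
  from cf_add[OF cf_comp1[OF this cf_add[OF assms]] assms(1)]
  show ?thesis by (simp add: prod_encode_def)
qed

lemma cf_pfst:
  assumes "cf X n a" shows "cf X n (\<lambda>e. pfst (a e))"
proof -
  have "cf X 1 (\<lambda>e. LEAST m. \<exists>y<Suc (e 0). prod_encode (m, y) = e 0)"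
  proof (rule cf_Least)
    show "\<exists>m. \<exists>y<Suc (e 0). prod_encode (m, y) = e 0" for e :: "nat \<Rightarrow> nat"
      using le_prod_encode_2[of "psnd (e 0)" "pfst (e 0)"]
      by (intro exI[of _ "pfst (e 0)"] exI[of _ "psnd (e 0)"]) simp
  qed (intro cp_ex_less cp_eq cf_prod_encode cf_var cf_Suc; simp)
  moreover have "(LEAST m. \<exists>y<Suc x. prod_encode (m, y) = x) = pfst x" for x
    using le_prod_encode_2[of "psnd x" "pfst x"]
    by (intro Least_equality) (auto simp: prod_encode_iff intro!: exI[of _ "psnd x"])
  ultimately have "cf X 1 (\<lambda>e. pfst (e 0))" by simp
  from cf_comp1[OF this assms] show ?thesis .
qed

lemma cf_psnd:
  assumes "cf X n a" shows "cf X n (\<lambda>e. psnd (a e))"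
proof -
  have "cf X 1 (\<lambda>e. LEAST m. prod_encode (pfst (e 0), m) = e 0)"
  proof (rule cf_Least)
    show "\<exists>m. prod_encode (pfst (e 0), m) = e 0" for e :: "nat \<Rightarrow> nat"
      by (intro exI[of _ "psnd (e 0)"]) simp
  qed (intro cp_eq cf_prod_encode cf_pfst cf_var; simp)
  moreover have "(LEAST m. prod_encode (pfst x, m) = x) = psnd x" for x
    by (intro Least_equality) (auto simp: prod_encode_iff)
  ultimately have "cf X 1 (\<lambda>e. psnd (e 0))" by simp
  from cf_comp1[OF this assms] show ?thesis .
qed

text \<open>A nonempty list is coded as the successor of the pair of its head and the code of its
  tail, hence \<open>psnd (y - 1)\<close>. On the code 0 of the empty list this stays at 0, as
  \<open>prod_decode 0 = (0, 0)\<close>; so dropping too much is harmless, and the length is the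
  first \<open>k\<close> with value 0.\<close>

definition dropc :: "nat \<Rightarrow> nat \<Rightarrow> nat" where
  "dropc c k = rec_nat c (\<lambda>_ y. psnd (y - 1)) k"

definition lenc :: "nat \<Rightarrow> nat" where "lenc c = length (list_decode c)"
definition elc :: "nat \<Rightarrow> nat \<Rightarrow> nat" where "elc c k = pfst (dropc c k - 1)"

lemma list_decode_psnd: "list_decode (psnd (c - 1)) = tl (list_decode c)"
proof (cases c)
  case 0
  have "prod_decode 0 = (0, 0)" by (simp add: prod_decode_def prod_decode_aux.simps)
  then show ?thesis using 0 by (simp add: psnd_def)
next
  case (Suc n)
  then show ?thesis by (simp add: psnd_def split: prod.splits)
qed

lemma list_decode_dropc: "list_decode (dropc c k) = drop k (list_decode c)"
proof (induction k)
  case (Suc k)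
  have "dropc c (Suc k) = psnd (dropc c k - 1)" by (simp add: dropc_def)
  then show ?case using list_decode_psnd[of "dropc c k"] Suc by (simp add: drop_Suc tl_drop)
qed (simp add: dropc_def)

lemma list_decode_eq_Nil: "list_decode c = [] \<longleftrightarrow> c = 0"
  by (cases c) (auto split: prod.splits)

lemma elc_nth: "k < lenc c \<Longrightarrow> elc c k = list_decode c ! k"
proof -
  assume k: "k < lenc c"
  then have "list_decode (dropc c k) \<noteq> []"
    using list_decode_dropc[of c k] by (simp add: lenc_def)
  then have "dropc c k \<noteq> 0" unfolding list_decode_eq_Nil .
  then obtain d where d: "dropc c k = Suc d" by (cases "dropc c k") auto
  have "hd (list_decode (Suc d)) = pfst d" by (simp add: pfst_def split: prod.splits)
  then show ?thesis
    using list_decode_dropc[of c k] k by (simp add: elc_def d lenc_def hd_drop_conv_nth)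
qed

lemma cf_dropc: "cf X n a \<Longrightarrow> cf X n b \<Longrightarrow> cf X n (\<lambda>e. dropc (a e) (b e))"
  unfolding dropc_def by (intro cf_rec cf_psnd cf_pred cf_var) auto

lemma cf_elc: "cf X n a \<Longrightarrow> cf X n b \<Longrightarrow> cf X n (\<lambda>e. elc (a e) (b e))"
  unfolding elc_def by (intro cf_pfst cf_pred cf_dropc)

lemma cf_lenc:
  assumes "cf X n a" shows "cf X n (\<lambda>e. lenc (a e))"
proof -
  have eq: "dropc x m = 0 \<longleftrightarrow> lenc x \<le> m" for x m
    using list_decode_dropc[of x m] list_decode_eq_Nil[of "dropc x m"] by (simp add: lenc_def)
  have "cf X 1 (\<lambda>e. LEAST m. dropc (e 0) m = 0)"
  proof (rule cf_Least)
    show "\<exists>m. dropc (e 0) m = 0" for e :: "nat \<Rightarrow> nat" unfolding eq by blast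
  qed (intro cp_eq0 cf_dropc cf_var; simp)
  moreover have "(LEAST m. dropc x m = 0) = lenc x" for x
    unfolding eq by (intro Least_equality) auto
  ultimately have "cf X 1 (\<lambda>e. lenc (e 0))" by simp
  from cf_comp1[OF this assms] show ?thesis .
qed

lemma cp_finite: "finite S \<Longrightarrow> cf X n a \<Longrightarrow> cp X n (\<lambda>e. a e \<in> S)"
  by (induction rule: finite_induct) (simp_all add: cp_const cp_disj cp_eq cf_const)

lemma computable_in_iff: "computable_in X Y \<longleftrightarrow> cp X 1 (\<lambda>e. e 0 \<in> Y)"
proof
  assume "computable_in X Y"
  then obtain p where p: "\<And>n. computes X p [n] (if n \<in> Y then 1 else 0)"
    by (auto simp only: computable_in_def)
  have "computes X p (map e [0..<1]) (if e 0 \<in> Y then 1 else 0)" for e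
    using p[of "e 0"] by simp
  then show "cp X 1 (\<lambda>e. e 0 \<in> Y)" unfolding cp_def cf_def by blast
next
  assume "cp X 1 (\<lambda>e. e 0 \<in> Y)"
  then obtain p where p: "\<And>e. computes X p (map e [0..<1]) (if e 0 \<in> Y then 1 else 0)"
    unfolding cp_def cf_def by blast
  have "computes X p [n] (if n \<in> Y then 1 else 0)" for n
    using p[of "\<lambda>_. n"] by simp
  then show "computable_in X Y" unfolding computable_in_def by blast
qed

lemma cp_in: "computable_in X Y \<Longrightarrow> cf X n a \<Longrightarrow> cp X n (\<lambda>e. a e \<in> Y)"
  unfolding computable_in_iff cp_def by (rule cf_comp1[where f = "\<lambda>x. if x \<in> Y then 1 else 0"])

lemma computable_in_rel:
  "computable_in X (prod_encode ` R) \<longleftrightarrow> cp X 1 (\<lambda>e. (pfst (e 0), psnd (e 0)) \<in> R)"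
proof -
  have "n \<in> prod_encode ` R \<longleftrightarrow> (pfst n, psnd n) \<in> R" for n
    by (metis image_iff prod_encode_pfst_psnd prod_encode_inverse)
  then show ?thesis by (simp add: computable_in_iff)
qed

section \<open>The bound \<open>omega1_oracle X\<close> for computable well-orders\<close>

section \<open>Computable ordinals\<close>

instance prog :: countable by countable_datatype

lemma computes_deterministic:
  "computes X p xs y \<Longrightarrow> computes X p xs z \<Longrightarrow> y = z"
proof (induction arbitrary: z rule: computes.induct)
  case (5 xs gs ys f z')
  from 5(4) obtain ys' where ys': "list_all2 (\<lambda>g y. computes X g xs y) gs ys'" "computes X f ys' z"
    by (cases rule: computes.cases) auto
  have "ys = ys'"
    using 5(1) ys'(1) by (auto simp: list_all2_conv_all_nth intro!: nth_equalityI)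
  then show ?case using 5 ys'(2) by blast
next
  case (6 f xs z' g)
  from 6(3) show ?case by (cases rule: computes.cases) (use 6(2) in auto)
next
  case (7 f g n xs y z')
  from 7(5) obtain w where w: "computes X (PrimRec f g) (n # xs) w" "computes X g (n # w # xs) z"
    by (cases rule: computes.cases) auto
  have "y = w" using "7.IH"(1)[OF w(1)] .
  then have "computes X g (n # y # xs) z" using w(2) by (simp only:)
  from "7.IH"(2)[OF this] show ?case .
next
  case (8 f n xs)
  have z: "computes X f (z # xs) 0" "\<And>m. m < z \<Longrightarrow> \<exists>y>0. computes X f (m # xs) y"
    using 8(4) by (cases rule: computes.cases; blast)+
  have "\<not> n < z"
  proof
    assume "n < z"
    then obtain y where "y > 0" "computes X f (n # xs) y" using z(2) by blast
    from 8(2)[OF this(2)] this(1) show False by simp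
  qed
  moreover have "\<not> z < n"
  proof
    assume "z < n"
    with 8(3) obtain y where y: "y > 0" "\<And>w. computes X f (z # xs) w \<Longrightarrow> y = w" by blast
    from y(2)[OF z(1)] y(1) show False by simp
  qed
  ultimately show ?case by simp
next
  case (1 xs)
  then show ?case by (cases rule: computes.cases) auto
next
  case (2 x xs)
  then show ?case by (cases rule: computes.cases) auto
next
  case (3 i xs)
  from 3(2) show ?case by (cases rule: computes.cases) auto
next
  case (4 x xs)
  then show ?case by (cases rule: computes.cases) auto
qed

lemma Field_ordinal_rel: "Field (ordinal_rel \<alpha>) = {\<beta>. \<beta> < \<alpha>}"
  by (auto simp: ordinal_rel_def Field_def)

lemma Well_order_ordinal_rel: "Well_order (ordinal_rel \<alpha>)"
proof -
  have "wf {(x, y). x < (y :: omega1)}"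
    unfolding wf_def by (auto intro: less_induct)
  moreover have "ordinal_rel \<alpha> - Id \<subseteq> {(x, y). x < y}"
    by (auto simp: ordinal_rel_def)
  ultimately have "wf (ordinal_rel \<alpha> - Id)" by (rule wf_subset)
  then show ?thesis
    unfolding well_order_on_def linear_order_on_def partial_order_on_def preorder_on_def Field_ordinal_rel
    by (auto simp: ordinal_rel_def refl_on_def trans_def antisym_def total_on_def)
qed

lemma ordinal_rel_less:
  assumes "\<alpha> < \<beta>" shows "(ordinal_rel \<alpha>, ordinal_rel \<beta>) \<in> ordLess"
proof -
  have "Restr (ordinal_rel \<beta>) (underS (ordinal_rel \<beta>) \<alpha>) = ordinal_rel \<alpha>"
    using assms by (auto simp: ordinal_rel_def underS_def)
  moreover have "Field (ordinal_rel \<beta>) \<noteq> {}" using assms by (auto simp: Field_ordinal_rel)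
  ultimately show ?thesis
    using underS_Restr_ordLess[OF Well_order_ordinal_rel, of \<beta> \<alpha>] by simp
qed

lemma ordinal_rel_inj: "(ordinal_rel \<alpha>, ordinal_rel \<beta>) \<in> ordIso \<Longrightarrow> \<alpha> = \<beta>"
  using ordinal_rel_less not_ordLess_ordIso ordIso_symmetric by (metis linorder_neqE)

text \<open>Otherwise every countable ordinal is assigned a program, injectively, since the program
  determines the relation and the relation determines the ordinal; but there are only countably many
  programs.\<close>

lemma not_computable_omega1_oracle: "\<not> computable_ordinal X (omega1_oracle X)"
proof -
  have "\<exists>\<alpha>. \<not> computable_ordinal X \<alpha>"
  proof (rule ccontr)
    assume "\<nexists>\<alpha>. \<not> computable_ordinal X \<alpha>"
    then have "\<forall>\<alpha>. \<exists>R. computable_in X (prod_encode ` R) \<and> (R, ordinal_rel \<alpha>) \<in> ordIso"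
      unfolding computable_ordinal_def by simp
    from choice[OF this] obtain R where R1: "\<And>\<alpha>. computable_in X (prod_encode ` R \<alpha>)"
      and R2: "\<And>\<alpha>. (R \<alpha>, ordinal_rel \<alpha>) \<in> ordIso"
      by blast
    have "\<forall>\<alpha>. \<exists>p. \<forall>n. computes X p [n] (if n \<in> prod_encode ` R \<alpha> then 1 else 0)"
      using R1 unfolding computable_in_def by (rule allI)
    from choice[OF this] obtain p where
      p0: "\<forall>\<alpha>. \<forall>n. computes X (p \<alpha>) [n] (if n \<in> prod_encode ` R \<alpha> then 1 else 0)" by (elim exE)
    note p = p0[rule_format]
    have "\<alpha> = \<beta>" if eq: "p \<alpha> = p \<beta>" for \<alpha> \<beta>
    proof -
      have "n \<in> prod_encode ` R \<alpha> \<longleftrightarrow> n \<in> prod_encode ` R \<beta>" for n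
      proof -
        have "(if n \<in> prod_encode ` R \<alpha> then 1 else 0) = (if n \<in> prod_encode ` R \<beta> then 1 else (0::nat))"
          by (rule computes_deterministic[OF p[of \<alpha> n] p[of \<beta> n, folded eq]])
        then show ?thesis by (cases "n \<in> prod_encode ` R \<alpha>"; cases "n \<in> prod_encode ` R \<beta>") simp_all
      qed
      then have "prod_encode ` R \<alpha> = prod_encode ` R \<beta>" by blast
      then have "R \<alpha> = R \<beta>" using inj_image_eq_iff[OF inj_prod_encode] by blast
      then have "(ordinal_rel \<alpha>, ordinal_rel \<beta>) \<in> ordIso"
        using R2[of \<alpha>] R2[of \<beta>] ordIso_symmetric ordIso_transitive by metis
      then show ?thesis by (rule ordinal_rel_inj)
    qed
    then have "inj p" by (rule injI)
    then have "inj (\<lambda>\<alpha>. to_nat (p \<alpha>))" by (simp add: inj_def)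
    then show False using uncountable_omega1 countableI by blast
  qed
  then show ?thesis unfolding omega1_oracle_def by (rule LeastI_ex)
qed

lemma cp_comp1: "cp X 1 (\<lambda>e. P (e 0)) \<Longrightarrow> cf X n a \<Longrightarrow> cp X n (\<lambda>e. P (a e))"
  unfolding cp_def by (rule cf_comp1[where f = "\<lambda>x. if P x then 1 else 0"])

text \<open>If \<open>R\<close> were not shorter, the ordinal \<open>omega1_oracle X\<close> would
  be isomorphic to \<open>R\<close> or to one of its proper initial segments. The latter are
  computable from \<open>X\<close> as well, with their endpoint as a parameter.\<close>

lemma ordLess_omega1_oracle:
  assumes c: "computable_in X (prod_encode ` R)" and wo: "Well_order R"
  shows "(R, ordinal_rel (omega1_oracle X)) \<in> ordLess"
proof (rule ccontr)
  let ?l = "omega1_oracle X"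
  assume "\<not> ?thesis"
  then have "(ordinal_rel ?l, R) \<in> ordLeq"
    using ordLess_or_ordLeq[OF wo Well_order_ordinal_rel] by blast
  then consider "(ordinal_rel ?l, R) \<in> ordIso" | "(ordinal_rel ?l, R) \<in> ordLess"
    using ordLeq_iff_ordLess_or_ordIso by blast
  then have "computable_ordinal X ?l"
  proof cases
    case 1
    then show ?thesis using c ordIso_symmetric unfolding computable_ordinal_def by blast
  next
    case 2
    then obtain a where a: "(ordinal_rel ?l, Restr R (underS R a)) \<in> ordIso"
      using ordLess_iff_ordIso_Restr[OF wo Well_order_ordinal_rel] by blast
    have R: "cp X n (\<lambda>e. (f e, g e) \<in> R)" if "cf X n f" "cf X n g" for n f g
    proof -
      have "cp X n (\<lambda>e. prod_encode (f e, g e) \<in> prod_encode ` R)"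
        by (rule cp_in[OF c cf_prod_encode[OF that]])
      then show ?thesis by (simp add: inj_image_mem_iff[OF inj_prod_encode])
    qed
    have "cp X 1 (\<lambda>e. (pfst (e 0), psnd (e 0)) \<in> R \<and> (pfst (e 0) \<noteq> a \<and> (pfst (e 0), a) \<in> R) \<and>
       (psnd (e 0) \<noteq> a \<and> (psnd (e 0), a) \<in> R))"
      by (intro cp_conj cp_not cp_eq R cf_pfst cf_psnd cf_var cf_const) auto
    then have "cp X 1 (\<lambda>e. (pfst (e 0), psnd (e 0)) \<in> Restr R (underS R a))"
      by (simp add: underS_def)
    then have "computable_in X (prod_encode ` Restr R (underS R a))"
      by (simp add: computable_in_rel)
    then show ?thesis using a ordIso_symmetric unfolding computable_ordinal_def by blast
  qed
  then show False using not_computable_omega1_oracle by blast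
qed

lemma ordLess_rank:
  assumes "(R, ordinal_rel l) \<in> ordLess"
  shows "\<exists>f. (\<forall>x\<in>Field R. f x < l) \<and> (\<forall>x y. (x, y) \<in> R \<longrightarrow> x \<noteq> y \<longrightarrow> f x < f y)"
proof -
  obtain f where f: "embedS R (ordinal_rel l) f" and wo: "Well_order R"
    using assms by (auto simp: ordLess_def)
  then have e: "embed R (ordinal_rel l) f" by (simp add: embedS_def)
  have inj: "inj_on f (Field R)" using embed_inj_on[OF wo e] .
  have compat: "(f x, f y) \<in> ordinal_rel l" if "(x, y) \<in> R" for x y
    using embed_compat[OF e] that by (auto simp: compat_def)
  have "f x < l" if "x \<in> Field R" for x
    using embed_in_Field[OF e that] by (simp add: Field_ordinal_rel)
  moreover have "f x < f y" if "(x, y) \<in> R" "x \<noteq> y" for x y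
  proof -
    have "x \<in> Field R" "y \<in> Field R" using that(1) by (auto simp: Field_def)
    then have "f x \<noteq> f y" using inj that(2) by (auto simp: inj_on_def)
    moreover have "f x \<le> f y" using compat[OF that(1)] by (simp add: ordinal_rel_def)
    ultimately show ?thesis by simp
  qed
  ultimately show ?thesis by blast
qed

section \<open>The Kleene-Brouwer ordering\<close>

fun kb :: "nat list \<Rightarrow> nat list \<Rightarrow> bool" where
  "kb [] t = False"
| "kb (x # s) [] = True"
| "kb (x # s) (y # t) = (x < y \<or> (x = y \<and> kb s t))"

lemma kb_irrefl: "\<not> kb s s"
  by (induction s) auto

lemma kb_trans: "kb s t \<Longrightarrow> kb t u \<Longrightarrow> kb s u"
proof (induction s t arbitrary: u rule: kb.induct)
  case (3 x s y t)
  then show ?case by (cases u) auto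
qed auto

lemma kb_total: "s \<noteq> t \<Longrightarrow> kb s t \<or> kb t s"
proof (induction s t rule: kb.induct)
  case (1 t)
  then show ?case by (cases t) auto
qed auto

lemma kb_append: "kb (s @ a) (s @ b) = kb a b"
  by (induction s) auto

lemma kb_snoc: "kb (s @ [x]) s"
  using kb_append[of s "[x]" "[]"] by simp

text \<open>Comparison at the first place of difference, with all quantifiers bounded by lengths;
  this form is computable and is copied by \<open>kbc\<close> on codes.\<close>

lemma kb_iff:
  "kb s t \<longleftrightarrow> (\<exists>k<Suc (length s). k \<le> length t \<and> (\<forall>i<k. s ! i = t ! i) \<and>
     ((k < length s \<and> k < length t \<and> s ! k < t ! k) \<or> (k = length t \<and> k < length s)))"
proof (induction s t rule: kb.induct)
  case (3 x s y t)
  show ?case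
    unfolding kb.simps 3 Ex_less_Suc2[of "length (x # s)"] All_less_Suc2
    by (cases "x = y") auto
qed auto

text \<open>Without an infinite path, proper extension inside \<open>T\<close> is well-founded, and
  minima are found by induction along it: among the nodes extending \<open>s\<close> choose the
  least possible next entry and continue above it.\<close>

lemma wf_kb:
  assumes pre: "\<And>s x. T (s @ [x]) \<Longrightarrow> T s" and nopath: "\<And>z. \<exists>k. \<not> T (map z [0..<k])"
  shows "wf {(s, t). T s \<and> T t \<and> kb s t}"
proof -
  have pres: "T s" if "T (s @ v)" for s v
    using that
  proof (induction v rule: rev_induct)
    case (snoc x v)
    then show ?case using pre[of "s @ v" x] by simp
  qed simp
  define E where "E = {(s @ [x], s) | s x. T (s @ [x])}"
  have "\<not> (\<exists>f. \<forall>i. (f (Suc i), f i) \<in> E)"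
  proof
    assume "\<exists>f. \<forall>i. (f (Suc i), f i) \<in> E"
    then obtain f where f: "\<And>i. (f (Suc i), f i) \<in> E" by blast
    have f1: "\<exists>x. f (Suc i) = f i @ [x]" "T (f (Suc i))" for i
      using f[of i] unfolding E_def by auto
    have ext: "\<exists>v. f j = f i @ v" if "i \<le> j" for i j
      using that
    proof (induction j rule: dec_induct)
      case (step j)
      then show ?case using f1(1)[of j] by force
    qed simp
    have len: "i \<le> length (f i)" for i
    proof (induction i)
      case (Suc i)
      then show ?case using f1(1)[of i] by auto
    qed simp
    \<comment> \<open>The chain may start at a nonempty node, so \<open>f (Suc j)\<close> is only
      known to be longer than \<open>j\<close>; that fixes the entry at \<open>j\<close>.\<close>
    define z where "z j = f (Suc j) ! j" for j
    have "map z [0..<k] = take k (f k)" for k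
    proof (rule nth_equalityI)
      show "length (map z [0..<k]) = length (take k (f k))" using len[of k] by simp
      fix j assume "j < length (map z [0..<k])"
      then have j: "j < k" by simp
      then obtain v where "f k = f (Suc j) @ v" using ext[of "Suc j" k] by auto
      moreover have "j < length (f (Suc j))" using len[of "Suc j"] by simp
      ultimately show "map z [0..<k] ! j = take k (f k) ! j" using j by (simp add: z_def nth_append)
    qed
    moreover have "T (take k (f k))" for k
    proof -
      obtain x where "f (Suc k) = f k @ [x]" using f1(1) by blast
      then have "f (Suc k) = take k (f k) @ (drop k (f k) @ [x])" by simp
      then show ?thesis using f1(2)[of k] pres by metis
    qed
    ultimately show False using nopath[of z] by simp
  qed
  then have wfE: "wf E" by (simp add: wf_iff_no_infinite_down_chain)
  have min: "\<exists>m\<in>Q. \<forall>y\<in>Q. \<not> kb y m" if "Q \<noteq> {}" "\<forall>u\<in>Q. T u \<and> (\<exists>v. u = s @ v)" for s Q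
    using wfE that
  proof (induction s arbitrary: Q rule: wf_induct_rule)
    case (less s)
    show ?case
    proof (cases "\<exists>x v. s @ x # v \<in> Q")
      case True
      \<comment> \<open>Nodes of \<open>Q\<close> through another entry, as well as \<open>s\<close>
        itself, come later in the Kleene-Brouwer ordering than the nodes through
        \<open>x\<close>.\<close>
      define x where "x = (LEAST x. \<exists>v. s @ x # v \<in> Q)"
      have x: "\<exists>v. s @ x # v \<in> Q" unfolding x_def using True by (rule LeastI_ex)
      let ?Q = "{u \<in> Q. \<exists>v. u = (s @ [x]) @ v}"
      obtain v where v: "s @ x # v \<in> Q" using x by blast
      then have "T ((s @ [x]) @ v)" using less.prems(2) by simp
      then have "(s @ [x], s) \<in> E" using pres by (auto simp: E_def)
      moreover have "?Q \<noteq> {}" using v by auto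
      ultimately obtain m where m: "m \<in> ?Q" "\<forall>y\<in>?Q. \<not> kb y m"
        using less.IH[of "s @ [x]" ?Q] less.prems(2) by blast
      have "\<not> kb y m" if y: "y \<in> Q" for y
      proof
        assume k: "kb y m"
        obtain w where w: "y = s @ w" using less.prems(2) y by blast
        obtain w' where w': "m = s @ x # w'" using m(1) by auto
        have kw: "kb w (x # w')" using k kb_append unfolding w w' by blast
        then obtain x' w'' where x': "w = x' # w''" by (cases w) auto
        then have "x' \<le> x" using kw by auto
        moreover have "x \<le> x'" unfolding x_def by (rule Least_le) (use y w x' in auto)
        ultimately have "y \<in> ?Q" using y w x' by auto
        then show False using m(2) k by blast
      qed
      then show ?thesis using m(1) by blast
    next
      case False
      have "Q = {s}"
      proof -
        have "u = s" if u: "u \<in> Q" for u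
        proof -
          obtain v where "u = s @ v" using less.prems(2) u by blast
          then show ?thesis using False u by (cases v) auto
        qed
        then show ?thesis using less.prems(1) by blast
      qed
      then show ?thesis using kb_irrefl by blast
    qed
  qed
  show ?thesis
  proof (rule wfI_min)
    fix x Q assume x: "x \<in> (Q :: nat list set)"
    show "\<exists>z\<in>Q. \<forall>y. (y, z) \<in> {(s, t). T s \<and> T t \<and> kb s t} \<longrightarrow> y \<notin> Q"
    proof (cases "{u \<in> Q. T u} = {}")
      case True
      then show ?thesis using x by blast
    next
      case False
      from min[OF this, of "[]"] show ?thesis by auto
    qed
  qed
qed

section \<open>A computable tree whose infinite branches are automorphisms\<close>

section \<open>The tree of attempts to build an automorphism\<close>

text \<open>
  A node is a finite sequence \<open>f 0, \<dots>, f (n - 1)\<close> of coded pairs, which together with the pairs in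
  \<open>V\<close> is to become part of the graph of an automorphism of the structure with diagram \<open>D\<close>.  The
  entries at \<open>2 j\<close> and \<open>2 j + 1\<close> put \<open>j\<close> into the domain and into the range.  Only codes below \<open>n\<close> are
  checked at a node, which makes the tree computable; on an infinite branch everything is checked.
\<close>

definition in_graph :: "nat set \<Rightarrow> nat \<Rightarrow> (nat \<Rightarrow> nat) \<Rightarrow> nat \<Rightarrow> bool" where
  "in_graph V n f q \<longleftrightarrow> q \<in> V \<or> (\<exists>j<n. f j = q)"

definition steps_ok :: "nat set \<Rightarrow> nat \<Rightarrow> (nat \<Rightarrow> nat) \<Rightarrow> bool" where
  "steps_ok D n f \<longleftrightarrow> (\<forall>i<n. prod_encode (0, pfst (f i)) \<in> D \<and> prod_encode (0, psnd (f i)) \<in> D \<and>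
     (\<forall>j<Suc i. (i = j + j \<and> prod_encode (0, j) \<in> D \<longrightarrow> pfst (f i) = j) \<and>
                (i = Suc (j + j) \<and> prod_encode (0, j) \<in> D \<longrightarrow> psnd (f i) = j)))"

text \<open>Tag 0 codes membership in the universe and is left to \<open>steps_ok\<close>. For the
  other tags, facts with matched entries are what an automorphism has to respect; a function fact
  carries its value as first entry.\<close>

definition related :: "nat set \<Rightarrow> nat \<Rightarrow> (nat \<Rightarrow> nat) \<Rightarrow> nat \<Rightarrow> nat \<Rightarrow> bool" where
  "related V n f q q' \<longleftrightarrow> pfst q \<noteq> 0 \<and> pfst q = pfst q' \<and> pfst (psnd q) = pfst (psnd q') \<and>
     lenc (psnd (psnd q)) = lenc (psnd (psnd q')) \<and>
     (\<forall>i<lenc (psnd (psnd q)). in_graph V n f (prod_encode (elc (psnd (psnd q)) i, elc (psnd (psnd q')) i)))"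

definition checked :: "nat set \<Rightarrow> nat set \<Rightarrow> nat \<Rightarrow> (nat \<Rightarrow> nat) \<Rightarrow> bool" where
  "checked D V n f \<longleftrightarrow> (\<forall>q<n. \<forall>q'<n.
     (in_graph V n f q \<and> in_graph V n f q' \<longrightarrow> (pfst q = pfst q' \<longleftrightarrow> psnd q = psnd q')) \<and>
     (related V n f q q' \<longrightarrow> (q \<in> D \<longleftrightarrow> q' \<in> D)))"

definition node :: "nat set \<Rightarrow> nat set \<Rightarrow> nat \<Rightarrow> (nat \<Rightarrow> nat) \<Rightarrow> bool" where
  "node D V n f \<longleftrightarrow> steps_ok D n f \<and> checked D V n f"

lemma in_graph_cong: "(\<And>i. i < n \<Longrightarrow> f i = g i) \<Longrightarrow> in_graph V n f q = in_graph V n g q"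
  by (auto simp: in_graph_def)

lemma node_cong:
  assumes "\<And>i. i < n \<Longrightarrow> f i = g i"
  shows "node D V n f = node D V n g"
proof -
  have "in_graph V n f = in_graph V n g" using in_graph_cong[OF assms] by (auto simp: fun_eq_iff)
  then have "checked D V n f = checked D V n g" by (simp only: checked_def related_def)
  moreover have "steps_ok D n f = steps_ok D n g" using assms by (simp add: steps_ok_def)
  ultimately show ?thesis by (simp add: node_def)
qed

text \<open>The graph only grows with \<open>n\<close>, and in \<open>checked\<close> it occurs only
  in hypotheses, so a shorter node has less to satisfy.\<close>

lemma node_Suc: "node D V (Suc n) f \<Longrightarrow> node D V n f"
proof -
  assume a: "node D V (Suc n) f"
  have g: "in_graph V n f q \<Longrightarrow> in_graph V (Suc n) f q" for q
    unfolding in_graph_def using less_SucI by blast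
  have r: "related V n f q q' \<Longrightarrow> related V (Suc n) f q q'" for q q'
    unfolding related_def using g by blast
  have "steps_ok D n f" using a unfolding node_def steps_ok_def using less_SucI by blast
  moreover have "checked D V n f"
    unfolding checked_def
  proof (intro allI impI)
    fix q q' assume "q < n" "q' < n"
    then have "(in_graph V (Suc n) f q \<and> in_graph V (Suc n) f q' \<longrightarrow> (pfst q = pfst q' \<longleftrightarrow> psnd q = psnd q')) \<and>
     (related V (Suc n) f q q' \<longrightarrow> (q \<in> D \<longleftrightarrow> q' \<in> D))"
      using a unfolding node_def checked_def using less_SucI by blast
    then show "(in_graph V n f q \<and> in_graph V n f q' \<longrightarrow> (pfst q = pfst q' \<longleftrightarrow> psnd q = psnd q')) \<and>
     (related V n f q q' \<longrightarrow> (q \<in> D \<longleftrightarrow> q' \<in> D))"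
      using g r by blast
  qed
  ultimately show ?thesis by (simp add: node_def)
qed

lemma cp_node:
  assumes D: "computable_in X D" and V: "finite V"
  shows "cp X 1 (\<lambda>e. node D V (lenc (e 0)) (elc (e 0)))"
  unfolding node_def steps_ok_def checked_def related_def in_graph_def
  by (intro cp_conj cp_all_less cp_ex_less cp_imp cp_iff cp_disj cp_not cp_eq cp_in[OF D] cp_finite[OF V]
      cf_prod_encode cf_pfst cf_psnd cf_elc cf_lenc cf_Suc cf_add cf_const cf_var; simp)

definition kbc :: "nat \<Rightarrow> nat \<Rightarrow> bool" where
  "kbc c d \<longleftrightarrow> (\<exists>k<Suc (lenc c). k \<le> lenc d \<and> (\<forall>i<k. elc c i = elc d i) \<and>
     ((k < lenc c \<and> k < lenc d \<and> elc c k < elc d k) \<or> (k = lenc d \<and> k < lenc c)))"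

lemma kbc_iff: "kbc c d \<longleftrightarrow> kb (list_decode c) (list_decode d)"
proof -
  have "(\<forall>i<k. elc c i = elc d i) \<longleftrightarrow> (\<forall>i<k. list_decode c ! i = list_decode d ! i)"
    if "k < Suc (lenc c)" "k \<le> lenc d" for k
    using that by (auto simp: elc_nth)
  then show ?thesis
    unfolding kbc_def kb_iff lenc_def[symmetric] by (auto simp: elc_nth)
qed

lemma cp_kbc: "cf X n a \<Longrightarrow> cf X n b \<Longrightarrow> cp X n (\<lambda>e. kbc (a e) (b e))"
proof -
  have "cp X 1 (\<lambda>e. kbc (pfst (e 0)) (psnd (e 0)))"
    unfolding kbc_def
    by (intro cp_conj cp_all_less cp_ex_less cp_disj cp_eq cp_less cp_le
      cf_pfst cf_psnd cf_elc cf_lenc cf_Suc cf_var; simp)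
  moreover assume "cf X n a" "cf X n b"
  ultimately have "cp X n (\<lambda>e. kbc (pfst (prod_encode (a e, b e))) (psnd (prod_encode (a e, b e))))"
    using cp_comp1[of X "\<lambda>x. kbc (pfst x) (psnd x)" n "\<lambda>e. prod_encode (a e, b e)"] cf_prod_encode
    by blast
  then show ?thesis by simp
qed

definition tree_order :: "nat set \<Rightarrow> nat set \<Rightarrow> nat rel" where
  "tree_order D V = {(c, d). node D V (lenc c) (elc c) \<and> node D V (lenc d) (elc d) \<and> (c = d \<or> kbc c d)}"

lemma computable_tree_order:
  assumes "computable_in X D" "finite V"
  shows "computable_in X (prod_encode ` tree_order D V)"
proof -
  have nd: "cp X n (\<lambda>e. node D V (lenc (a e)) (elc (a e)))" if "cf X n a" for n a
    using cp_comp1[of X "\<lambda>x. node D V (lenc x) (elc x)", OF cp_node[OF assms] that] .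
  show ?thesis
    unfolding computable_in_rel tree_order_def mem_Collect_eq prod.case
    by (intro cp_conj nd cp_disj cp_eq cp_kbc cf_pfst cf_psnd cf_var; simp)
qed

lemma list_decode_inj: "list_decode c = list_decode d \<Longrightarrow> c = d"
  by (metis list_decode_inverse)

lemma node_code: "node D V (lenc c) (elc c) \<longleftrightarrow> node D V (length (list_decode c)) ((!) (list_decode c))"
  using node_cong[of "lenc c" "elc c" "(!) (list_decode c)" D V] elc_nth by (simp add: lenc_def)

lemma Well_order_tree_order:
  assumes nopath: "\<And>z. \<exists>k. \<not> node D V k z"
  shows "Well_order (tree_order D V)"
proof -
  let ?R = "tree_order D V"
  define T where "T s = node D V (length s) ((!) s)" for s
  have R: "?R = {(c, d). T (list_decode c) \<and> T (list_decode d) \<and> (c = d \<or> kb (list_decode c) (list_decode d))}"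
    by (simp add: tree_order_def T_def node_code kbc_iff)
  have F: "Field ?R = {c. T (list_decode c)}"
  proof (intro equalityI subsetI)
    fix x assume "x \<in> Field ?R"
    then obtain y where "(x, y) \<in> ?R \<or> (y, x) \<in> ?R" unfolding Field_def by blast
    then show "x \<in> {c. T (list_decode c)}" unfolding R by blast
  next
    fix x assume "x \<in> {c. T (list_decode c)}"
    then have "(x, x) \<in> ?R" unfolding R by blast
    then show "x \<in> Field ?R" by (rule FieldI1)
  qed
  have "wf {(s, t). T s \<and> T t \<and> kb s t}"
  proof (rule wf_kb)
    fix s x assume "T (s @ [x])"
    then have "node D V (Suc (length s)) ((!) (s @ [x]))" by (simp add: T_def)
    from node_Suc[OF this] show "T s"
      unfolding T_def by (subst node_cong[of _ _ "(!) (s @ [x])"]) (auto simp: nth_append)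
  next
    fix z :: "nat \<Rightarrow> nat"
    obtain k where "\<not> node D V k z" using nopath by blast
    then have "\<not> node D V k ((!) (map z [0..<k]))"
      by (subst node_cong[of _ _ z]) auto
    then show "\<exists>k. \<not> T (map z [0..<k])" by (auto simp: T_def)
  qed
  from wf_inv_image[OF this, of list_decode]
  have "wf {(c, d). T (list_decode c) \<and> T (list_decode d) \<and> kb (list_decode c) (list_decode d)}"
    by (simp add: inv_image_def)
  then have "wf (?R - Id)" by (rule wf_subset) (auto simp: R)
  moreover have "refl_on (Field ?R) ?R" unfolding F refl_on_def unfolding R by blast
  moreover have "trans ?R"
    unfolding R trans_def using kb_trans by blast
  moreover have "antisym ?R"
    unfolding R antisym_def using kb_trans kb_irrefl by blast
  moreover have "total_on (Field ?R) ?R"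
    unfolding total_on_def F unfolding R using kb_total list_decode_inj by blast
  moreover have "?R \<subseteq> Field ?R \<times> Field ?R" by (auto simp: Field_def)
  ultimately show ?thesis
    unfolding well_order_on_def linear_order_on_def partial_order_on_def preorder_on_def by blast
qed

lemma diagram_univ: "prod_encode (0, x) \<in> diagram L B \<longleftrightarrow> x \<in> univ B"
  by (auto simp: diagram_def)

lemma diagram_iff:
  assumes "pfst q \<noteq> 0"
  shows "q \<in> diagram L B \<longleftrightarrow>
    (let s = pfst (psnd q); l = list_decode (psnd (psnd q)) in
      pfst q = 1 \<and> s \<in> rel_syms L \<and> l \<in> tuples B (rel_arity L s) \<and> rel_of B s l \<or>
      pfst q = 2 \<and> s \<in> fun_syms L \<and> (\<exists>y c. l = y # c \<and> c \<in> tuples B (fun_arity L s) \<and> fun_of B s c = y))"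
proof -
  obtain t s l where q: "q = prod_encode (t, prod_encode (s, list_encode l))"
    by (metis prod_encode_pfst_psnd list_decode_inverse)
  have "t \<noteq> 0" using assms by (simp add: q)
  then show ?thesis
    by (auto simp: q diagram_def Let_def list_encode_eq simp del: list_encode.simps)
qed

definition left :: "nat list \<Rightarrow> nat \<Rightarrow> (nat \<Rightarrow> nat) \<Rightarrow> nat list" where
  "left a n f = a @ map (\<lambda>i. pfst (f i)) [0..<n]"

definition right :: "nat list \<Rightarrow> nat \<Rightarrow> (nat \<Rightarrow> nat) \<Rightarrow> nat list" where
  "right b n f = b @ map (\<lambda>i. psnd (f i)) [0..<n]"

definition graph_codes :: "nat list \<Rightarrow> nat list \<Rightarrow> nat set" where
  "graph_codes a b = (\<lambda>i. prod_encode (a ! i, b ! i)) ` {..<length a}"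

lemma finite_graph_codes: "finite (graph_codes a b)"
  by (simp add: graph_codes_def)

lemma in_graph_iff:
  assumes "length a = length b"
  shows "in_graph (graph_codes a b) n f q \<longleftrightarrow>
    (\<exists>i<length (left a n f). q = prod_encode (left a n f ! i, right b n f ! i))"
proof
  assume "in_graph (graph_codes a b) n f q"
  then consider i where "i < length a" "q = prod_encode (a ! i, b ! i)" | j where "j < n" "f j = q"
    unfolding in_graph_def graph_codes_def by blast
  then show "\<exists>i<length (left a n f). q = prod_encode (left a n f ! i, right b n f ! i)"
  proof cases
    case 1
    then show ?thesis using assms by (intro exI[of _ i]) (simp add: left_def right_def nth_append)
  next
    case 2
    then show ?thesis using assms by (intro exI[of _ "length a + j"]) (simp add: left_def right_def nth_append)
  qed
next
  assume "\<exists>i<length (left a n f). q = prod_encode (left a n f ! i, right b n f ! i)"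
  then obtain i where i: "i < length a + n" "q = prod_encode (left a n f ! i, right b n f ! i)"
    by (auto simp: left_def)
  show "in_graph (graph_codes a b) n f q"
  proof (cases "i < length a")
    case True
    then show ?thesis using i assms by (auto simp: in_graph_def graph_codes_def left_def right_def nth_append)
  next
    case False
    then have "f (i - length a) = q" "i - length a < n"
      using i assms by (auto simp: left_def right_def nth_append)
    then show ?thesis unfolding in_graph_def by blast
  qed
qed

lemma diagram_transfer:
  assumes at: "atomic_eq L B xs B ys" and xs: "xs \<in> tuples B k" and ys: "ys \<in> tuples B k"
    and q: "pfst q \<noteq> 0" "pfst q = pfst q'" "pfst (psnd q) = pfst (psnd q')"
    and js: "set js \<subseteq> {..<k}" "list_decode (psnd (psnd q)) = map ((!) xs) js"
      "list_decode (psnd (psnd q')) = map ((!) ys) js"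
  shows "q \<in> diagram L B \<longleftrightarrow> q' \<in> diagram L B"
proof -
  define s where "s = pfst (psnd q)"
  have lx: "length xs = k" "length ys = k" using xs ys tuples_length by auto
  have tx: "map ((!) xs) i \<in> tuples B m \<longleftrightarrow> length i = m" "map ((!) ys) i \<in> tuples B m \<longleftrightarrow> length i = m"
    if "set i \<subseteq> {..<k}" for i m
    using that tuples_map_nth[OF xs, of i] tuples_map_nth[OF ys, of i] tuples_length by fastforce+
  have rel: "rel_of B s (map ((!) xs) js) \<longleftrightarrow> rel_of B s (map ((!) ys) js)"
    if "s \<in> rel_syms L" "length js = rel_arity L s"
    using at that js(1) lx unfolding atomic_eq_def by blast
  have fn: "(\<exists>y c. map ((!) xs) js = y # c \<and> c \<in> tuples B (fun_arity L s) \<and> fun_of B s c = y) \<longleftrightarrow>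
    (\<exists>y c. map ((!) ys) js = y # c \<and> c \<in> tuples B (fun_arity L s) \<and> fun_of B s c = y)"
    if s: "s \<in> fun_syms L"
  proof (cases js)
    case (Cons j "is")
    then have i: "set is \<subseteq> {..<k}" "j < k" using js(1) by auto
    then have "fun_of B s (map ((!) xs) is) = xs ! j \<longleftrightarrow> fun_of B s (map ((!) ys) is) = ys ! j"
      if "length is = fun_arity L s"
      using at that s lx unfolding atomic_eq_def by blast
    then show ?thesis using tx[OF i(1)] by (auto simp: Cons)
  qed simp
  have q': "pfst q' \<noteq> 0" using q by simp
  show ?thesis
    unfolding diagram_iff[OF q(1)] diagram_iff[OF q'] Let_def js q(2)[symmetric] q(3)[symmetric] s_def[symmetric]
      tx[OF js(1)]
    by (intro arg_cong2[where f = "(\<or>)"] conj_cong refl) (simp_all only: rel fn)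
qed

text \<open>Back-and-forth steps produce atomically equivalent tuples; this turns them into nodes of
  the tree.\<close>

lemma checked_of_atomic_eq:
  assumes at: "atomic_eq L B (left a n f) B (right b n f)" and len: "length a = length b"
    and xs: "left a n f \<in> tuples B k" and ys: "right b n f \<in> tuples B k"
  shows "checked (diagram L B) (graph_codes a b) n f"
  unfolding checked_def
proof (intro allI impI conjI)
  let ?x = "left a n f" and ?y = "right b n f"
  note g = in_graph_iff[OF len, of n f]
  have k: "length ?x = k" using xs by (rule tuples_length)
  fix q q'
  {
    assume "in_graph (graph_codes a b) n f q \<and> in_graph (graph_codes a b) n f q'"
    then obtain i j where "i < length ?x" "q = prod_encode (?x ! i, ?y ! i)"
      "j < length ?x" "q' = prod_encode (?x ! j, ?y ! j)" unfolding g by blast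
    then show "pfst q = pfst q' \<longleftrightarrow> psnd q = psnd q'"
      using at by (simp add: atomic_eq_def)
  next
    assume r: "related (graph_codes a b) n f q q'"
    let ?l = "list_decode (psnd (psnd q))" and ?l' = "list_decode (psnd (psnd q'))"
    have l: "length ?l = length ?l'" using r by (simp add: related_def lenc_def)
    have "\<forall>i<length ?l. \<exists>j<k. ?l ! i = ?x ! j \<and> ?l' ! i = ?y ! j"
    proof (intro allI impI)
      fix i assume i: "i < length ?l"
      then have "in_graph (graph_codes a b) n f (prod_encode (elc (psnd (psnd q)) i, elc (psnd (psnd q')) i))"
        using r by (simp add: related_def lenc_def)
      then show "\<exists>j<k. ?l ! i = ?x ! j \<and> ?l' ! i = ?y ! j"
        unfolding g k using i l elc_nth[of i "psnd (psnd q)"] elc_nth[of i "psnd (psnd q')"]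
        by (auto simp: lenc_def)
    qed
    then obtain h where h: "\<And>i. i < length ?l \<Longrightarrow> h i < k \<and> ?l ! i = ?x ! h i \<and> ?l' ! i = ?y ! h i"
      by metis
    let ?js = "map h [0..<length ?l]"
    have "?l = map ((!) ?x) ?js" "?l' = map ((!) ?y) ?js"
      using h l by (auto intro!: nth_equalityI)
    moreover have "set ?js \<subseteq> {..<k}" using h by auto
    ultimately show "q \<in> diagram L B \<longleftrightarrow> q' \<in> diagram L B"
      using diagram_transfer[OF at xs ys _ _ _, of q q' ?js] r by (simp add: related_def)
  }
qed

text \<open>The converse on an infinite branch, where any given code is checked at every
  sufficiently late stage.\<close>

lemma atomic_eq_of_path:
  assumes path: "\<And>k. node (diagram L B) (graph_codes a b) k z" and len: "length a = length b"
    and xs: "left a k z \<in> tuples B m" and ys: "right b k z \<in> tuples B m"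
  shows "atomic_eq L B (left a k z) B (right b k z)"
proof -
  let ?x = "left a k z" and ?y = "right b k z"
  let ?D = "diagram L B" and ?W = "graph_codes a b"
  have lx: "length ?x = m" "length ?y = m" using xs ys tuples_length by auto
  have g: "in_graph ?W n z (prod_encode (?x ! i, ?y ! i))" if "i < m" "k \<le> n" for i n
  proof -
    have "in_graph ?W k z (prod_encode (?x ! i, ?y ! i))"
      unfolding in_graph_iff[OF len] using that lx by blast
    then show ?thesis using that(2) unfolding in_graph_def by (meson less_le_trans)
  qed
  have eq: "(?x ! i = ?x ! j) \<longleftrightarrow> (?y ! i = ?y ! j)" if "i < m" "j < m" for i j
  proof -
    let ?q = "prod_encode (?x ! i, ?y ! i)" and ?q' = "prod_encode (?x ! j, ?y ! j)"
    \<comment> \<open>Beyond \<open>k\<close>, so that the pairs are in the graph, and beyond both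
      codes, so that they are checked.\<close>
    let ?n = "Suc (k + ?q + ?q')"
    have "checked ?D ?W ?n z" using path by (simp add: node_def)
    moreover have "?q < ?n" "?q' < ?n" by auto
    moreover have "in_graph ?W ?n z ?q" "in_graph ?W ?n z ?q'" using g that by auto
    ultimately have "pfst ?q = pfst ?q' \<longleftrightarrow> psnd ?q = psnd ?q'" unfolding checked_def by blast
    then show ?thesis by simp
  qed
  have tr: "prod_encode (t, prod_encode (s, list_encode (map ((!) ?x) js))) \<in> ?D \<longleftrightarrow>
      prod_encode (t, prod_encode (s, list_encode (map ((!) ?y) js))) \<in> ?D"
    if "set js \<subseteq> {..<m}" "t \<noteq> 0" for t s js
  proof -
    let ?q = "prod_encode (t, prod_encode (s, list_encode (map ((!) ?x) js)))"
    let ?q' = "prod_encode (t, prod_encode (s, list_encode (map ((!) ?y) js)))"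
    let ?n = "Suc (k + ?q + ?q')"
    have "checked ?D ?W ?n z" using path by (simp add: node_def)
    moreover have "?q < ?n" "?q' < ?n" by auto
    moreover have "related ?W ?n z ?q ?q'"
    proof -
      have "in_graph ?W ?n z (prod_encode (elc (list_encode (map ((!) ?x) js)) i, elc (list_encode (map ((!) ?y) js)) i))"
        if i: "i < length js" for i
      proof -
        have "js ! i < m" using \<open>set js \<subseteq> {..<m}\<close> nth_mem[OF i] by auto
        then show ?thesis using g[of "js ! i" ?n] i by (simp add: elc_nth lenc_def)
      qed
      then show ?thesis using that(2) by (simp add: related_def lenc_def)
    qed
    ultimately show ?thesis unfolding checked_def by blast
  qed
  have tx: "map ((!) ?x) i \<in> tuples B l" "map ((!) ?y) i \<in> tuples B l"
    if "set i \<subseteq> {..<m}" "length i = l" for i l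
    using that tuples_map_nth[OF xs, of i] tuples_map_nth[OF ys, of i] by auto
  show ?thesis
    unfolding atomic_eq_def lx
  proof (intro conjI allI impI refl)
    fix i j assume "i < m \<and> j < m"
    then show "(?x ! i = ?x ! j) \<longleftrightarrow> (?y ! i = ?y ! j)" using eq by blast
  next
    fix r js assume r: "r \<in> rel_syms L \<and> length js = rel_arity L r \<and> set js \<subseteq> {..<m}"
    then show "rel_of B r (map ((!) ?x) js) \<longleftrightarrow> rel_of B r (map ((!) ?y) js)"
      using tr[of js 1 r] tx[of js "rel_arity L r"] by (simp add: diagram_iff)
  next
    fix f js j assume f: "f \<in> fun_syms L \<and> length js = fun_arity L f \<and> set js \<subseteq> {..<m} \<and> j < m"
    then show "fun_of B f (map ((!) ?x) js) = ?x ! j \<longleftrightarrow> fun_of B f (map ((!) ?y) js) = ?y ! j"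
      using tr[of "j # js" 2 f] tx[of js "fun_arity L f"] by (auto simp: diagram_iff)
  qed
qed

lemma atomic_eq_sym: "atomic_eq L A a B b \<Longrightarrow> atomic_eq L B b A a"
  unfolding atomic_eq_def by (elim conjE, intro conjI) simp_all

lemma steps_ok_univ:
  assumes "steps_ok (diagram L B) n f" "i < n"
  shows "pfst (f i) \<in> univ B" "psnd (f i) \<in> univ B"
  using assms by (auto simp: steps_ok_def diagram_univ)

lemma left_right_tuples:
  assumes "steps_ok (diagram L B) n f" "a \<in> tuples B m" "b \<in> tuples B m"
  shows "left a n f \<in> tuples B (m + n)" "right b n f \<in> tuples B (m + n)"
  using assms(2,3) steps_ok_univ[OF assms(1)] by (auto simp: left_def right_def tuples_def)

lemma iso_of_path:
  assumes path: "\<And>k. node (diagram L B) (graph_codes a b) k z" and B: "is_structure L B"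
    and a: "a \<in> tuples B m" and b: "b \<in> tuples B m"
  shows "\<exists>h. iso_map L h B B \<and> map h a = b"
proof -
  have st: "steps_ok (diagram L B) k z" for k using path by (simp add: node_def)
  have t: "left a k z \<in> tuples B (m + k)" "right b k z \<in> tuples B (m + k)" for k
    using left_right_tuples[OF st a b] by auto
  have l: "length (left a k z) = m + k" "length (right b k z) = m + k" for k
    using t tuples_length by blast+
  have len: "length a = length b" using a b by (simp add: tuples_def)
  have "\<exists>h. iso_map L h B B \<and> (\<forall>n. map h (left a n z) = right b n z)"
  proof (rule iso_of_chain[OF B B])
    show "left a n z \<in> tuples B (length (left a n z))" "right b n z \<in> tuples B (length (right b n z))" for n
      unfolding l by (rule t)+
    show "atomic_eq L B (left a n z) B (right b n z)" for n
      using atomic_eq_of_path[OF path len t] .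
    show "\<exists>x. left a (Suc n) z = left a n z @ x" "\<exists>x. right b (Suc n) z = right b n z @ x" for n
      by (auto simp: left_def right_def)
  next
    fix x assume x: "x \<in> univ B"
    have "pfst (z (x + x)) = x"
      using st[of "Suc (x + x)"] x unfolding steps_ok_def diagram_univ by (metis lessI less_Suc_eq_le trans_le_add2 order_refl le_add2)
    then show "\<exists>n. x \<in> set (left a n z)"
      by (intro exI[of _ "Suc (x + x)"]) (simp add: left_def)
  next
    fix x assume x: "x \<in> univ B"
    have "psnd (z (Suc (x + x))) = x"
      using st[of "Suc (Suc (x + x))"] x unfolding steps_ok_def diagram_univ
      by (metis lessI less_Suc_eq_le le_add2 le_SucI)
    then show "\<exists>n. x \<in> set (right b n z)"
      by (intro exI[of _ "Suc (Suc (x + x))"]) (simp add: right_def)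
  qed
  then obtain h where "iso_map L h B B" "map h (left a 0 z) = right b 0 z" by blast
  then show ?thesis by (auto simp: left_def right_def)
qed

text \<open>
  Otherwise the tree of attempts is well-founded, hence of
  rank below \<open>\<omega>\<^sub>1\<^sup>X\<close>, whereas the back-and-forth property bounds that rank from below.
\<close>

theorem leq_below_omega1_oracle:
  assumes c: "computable_in X (diagram L B)" and B: "is_structure L B"
    and l: "limit_ordinal (omega1_oracle X)"
    and a: "a \<in> tuples B m" and b: "b \<in> tuples B m"
    and leq: "\<And>\<alpha>. \<alpha> < omega1_oracle X \<Longrightarrow> leq L \<alpha> B a B b"
  shows "\<exists>h. iso_map L h B B \<and> map h a = b"
proof (rule ccontr)
  let ?D = "diagram L B" and ?W = "graph_codes a b" and ?l = "omega1_oracle X"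
  assume neg: "\<not> ?thesis"
  have len: "length a = length b" using a b by (simp add: tuples_def)
  have "\<exists>k. \<not> node ?D ?W k z" for z
    using iso_of_path[OF _ B a b, of z] neg by blast
  then have wo: "Well_order (tree_order ?D ?W)" by (rule Well_order_tree_order)
  \<comment> \<open>In the Kleene-Brouwer ordering a child precedes its parent, so the embedding of
    this order into the ordinals below \<open>omega1_oracle X\<close> ranks the tree.\<close>
  from ordLess_rank[OF ordLess_omega1_oracle[OF computable_tree_order[OF c finite_graph_codes] wo]]
  obtain r0 where r0: "\<And>x. x \<in> Field (tree_order ?D ?W) \<Longrightarrow> r0 x < ?l"
    "\<And>x y. (x, y) \<in> tree_order ?D ?W \<Longrightarrow> x \<noteq> y \<Longrightarrow> r0 x < r0 y" by blast
  define T where "T s = node ?D ?W (length s) ((!) s)" for s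
  define rk where "rk s = r0 (list_encode s)" for s
  have nc: "node ?D ?W (lenc (list_encode s)) (elc (list_encode s)) = T s" for s
    by (simp add: node_code T_def)
  have rk_lt: "rk s < ?l" if "T s" for s
  proof -
    have "(list_encode s, list_encode s) \<in> tree_order ?D ?W"
      using that by (simp add: tree_order_def nc)
    then show ?thesis unfolding rk_def by (intro r0(1) FieldI1)
  qed
  have rk_child: "rk (s @ [x]) < rk s" if "T (s @ [x])" "T s" for s x
  proof -
    have "(list_encode (s @ [x]), list_encode s) \<in> tree_order ?D ?W"
      using that kb_snoc by (simp add: tree_order_def nc kbc_iff)
    moreover have "list_encode (s @ [x]) \<noteq> list_encode s" by (simp add: list_encode_eq)
    ultimately show ?thesis unfolding rk_def by (rule r0(2))
  qed
  define xs where "xs s = a @ map pfst s" for s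
  define ys where "ys s = b @ map psnd s" for s
  have map_nth_self: "map (\<lambda>i. h (s ! i)) [0..<length s] = map h s" for h :: "nat \<Rightarrow> nat" and s
    by (intro nth_equalityI) auto
  have lr: "left a (length s) ((!) s) = xs s" "right b (length s) ((!) s) = ys s" for s
    by (simp_all add: left_def right_def xs_def ys_def map_nth_self)
  \<comment> \<open>Every back step exchanges the sides. Even positions have to answer an element of
    the domain, so there the relation must go from \<open>ys s\<close> to \<open>xs s\<close>; at
    odd positions it goes the other way round.\<close>
  define Dir where "Dir s \<alpha> \<longleftrightarrow> (if even (length s) then leq L \<alpha> B (ys s) B (xs s) else leq L \<alpha> B (xs s) B (ys s))" for s \<alpha>
  obtain u where u: "u \<in> univ B" using B by (auto simp: is_structure_def)
  have tup: "xs s \<in> tuples B (m + length s)" "ys s \<in> tuples B (m + length s)" if "T s" for s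
    using left_right_tuples[OF _ a b, of L "length s" "(!) s"] that unfolding T_def node_def lr by auto
  have child: "\<exists>q. T (s @ [q]) \<and> Dir (s @ [q]) \<beta>" if Ts: "T s" and D: "Dir s \<alpha>" and \<beta>: "0 < \<beta>" "\<beta> < \<alpha>" for s \<alpha> \<beta>
  proof -
    have px: "pt L (m + length s) B (xs s)" and py: "pt L (m + length s) B (ys s)"
      using tup[OF Ts] B by auto
    have ok: "T (s @ [prod_encode (x, y)]) \<and> Dir (s @ [prod_encode (x, y)]) \<beta>"
      if x: "x \<in> univ B" and y: "y \<in> univ B"
        and d: "if even (length s) then leq L \<beta> B (xs s @ [x]) B (ys s @ [y]) else leq L \<beta> B (ys s @ [y]) B (xs s @ [x])"
        and st: "\<And>j. length s = j + j \<Longrightarrow> j \<in> univ B \<Longrightarrow> x = j" "\<And>j. length s = Suc (j + j) \<Longrightarrow> j \<in> univ B \<Longrightarrow> y = j"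
      for x y
    proof -
      let ?s = "s @ [prod_encode (x, y)]"
      have xy: "xs ?s = xs s @ [x]" "ys ?s = ys s @ [y]" by (simp_all add: xs_def ys_def)
      have t: "xs ?s \<in> tuples B (m + length s + 1)" "ys ?s \<in> tuples B (m + length s + 1)"
        unfolding xy using tup[OF Ts] x y by (auto simp: tuples_def)
      have at: "atomic_eq L B (xs ?s) B (ys ?s)"
      proof (cases "even (length s)")
        case True
        then show ?thesis using d leq_atomic_eq[of L \<beta> B "xs ?s" B "ys ?s" "m + length s + 1"] t B by (simp add: xy)
      next
        case False
        then have "atomic_eq L B (ys ?s) B (xs ?s)"
          using d leq_atomic_eq[of L \<beta> B "ys ?s" B "xs ?s" "m + length s + 1"] t B by (simp add: xy)
        then show ?thesis by (rule atomic_eq_sym)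
      qed
      have so: "steps_ok ?D (length s) ((!) s)" using Ts by (simp add: T_def node_def)
      have "steps_ok ?D (length ?s) ((!) ?s)"
        unfolding steps_ok_def diagram_univ
      proof (intro allI impI)
        fix i assume i: "i < length ?s"
        show "pfst (?s ! i) \<in> univ B \<and> psnd (?s ! i) \<in> univ B \<and>
          (\<forall>j<Suc i. (i = j + j \<and> j \<in> univ B \<longrightarrow> pfst (?s ! i) = j) \<and>
             (i = Suc (j + j) \<and> j \<in> univ B \<longrightarrow> psnd (?s ! i) = j))"
        proof (cases "i < length s")
          case True
          then show ?thesis using so by (simp add: steps_ok_def diagram_univ nth_append)
        next
          case False
          then have il: "i = length s" using i by simp
          then have e: "?s ! i = prod_encode (x, y)" by simp
          show ?thesis unfolding e pfst_encode psnd_encode unfolding il using x y st by blast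
        qed
      qed
      moreover have "checked ?D ?W (length ?s) ((!) ?s)"
        by (rule checked_of_atomic_eq[OF _ len]) (unfold lr, rule at, rule t, rule t)
      ultimately have "T ?s" by (simp add: T_def node_def)
      moreover have "Dir ?s \<beta>" using d by (simp add: Dir_def xy)
      ultimately show ?thesis by blast
    qed
    show ?thesis
    proof (cases "even (length s)")
      case True
      then obtain j where j: "length s = j + j" by (metis evenE mult_2)
      \<comment> \<open>If \<open>j\<close> is not in the universe the position carries no
        obligation, and \<open>u\<close> fills it.\<close>
      define x where "x = (if j \<in> univ B then j else u)"
      have x: "x \<in> univ B" using u by (simp add: x_def)
      then have x1: "[x] \<in> tuples B (Suc 0)" by (simp add: tuples_1)
      have "leq L \<alpha> B (ys s) B (xs s)" using D True by (simp add: Dir_def)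
      from leq_back[OF this py px \<beta> x1] obtain y where y: "y \<in> univ B" "leq L \<beta> B (xs s @ [x]) B (ys s @ [y])"
        unfolding tuples_1 by auto
      have "x = i" if "length s = i + i" "i \<in> univ B" for i
      proof -
        have "i = j" using that(1) j by linarith
        then show ?thesis using that(2) by (simp add: x_def)
      qed
      moreover have "length s \<noteq> Suc (i + i)" for i using j by presburger
      ultimately show ?thesis using ok[OF x y(1)] y(2) True by auto
    next
      case False
      then obtain j where j: "length s = Suc (j + j)" by (metis oddE mult_2 Suc_eq_plus1)
      define y where "y = (if j \<in> univ B then j else u)"
      have y: "y \<in> univ B" using u by (simp add: y_def)
      then have y1: "[y] \<in> tuples B (Suc 0)" by (simp add: tuples_1)
      have "leq L \<alpha> B (xs s) B (ys s)" using D False by (simp add: Dir_def)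
      from leq_back[OF this px py \<beta> y1] obtain x where x: "x \<in> univ B" "leq L \<beta> B (ys s @ [y]) B (xs s @ [x])"
        unfolding tuples_1 by auto
      have "y = i" if "length s = Suc (i + i)" "i \<in> univ B" for i
      proof -
        have "i = j" using that(1) j by linarith
        then show ?thesis using that(2) by (simp add: y_def)
      qed
      moreover have "length s \<noteq> i + i" for i using j by presburger
      ultimately show ?thesis using ok[OF x(1) y] x(2) False by auto
    qed
  qed
  \<comment> \<open>Every positive \<open>\<beta> < \<alpha>\<close> passes to a child of smaller
    rank, so \<open>\<beta> \<le> rk s\<close>; the bound for \<open>\<alpha>\<close> itself is one
    more.\<close>
  have claim: "T s \<Longrightarrow> Dir s \<alpha> \<Longrightarrow> 0 < \<alpha> \<Longrightarrow> \<alpha> \<le> osuc (rk s)" for s \<alpha>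
  proof (induction \<alpha> arbitrary: s rule: less_induct)
    case (less \<alpha>)
    have below: "\<beta> \<le> rk s" if \<beta>: "0 < \<beta>" "\<beta> < \<alpha>" for \<beta>
    proof -
      obtain q where q: "T (s @ [q])" "Dir (s @ [q]) \<beta>" using child[OF less.prems(1,2) \<beta>] by blast
      have "\<beta> \<le> osuc (rk (s @ [q]))" using less.IH[OF \<beta>(2) q \<beta>(1)] .
      also have "\<dots> \<le> rk s" using rk_child[OF q(1) less.prems(1)] by (rule osuc_least)
      finally show ?thesis .
    qed
    show ?case
    proof (rule ccontr)
      assume "\<not> \<alpha> \<le> osuc (rk s)"
      then have "osuc (rk s) < \<alpha>" by simp
      from below[OF zero_less_osuc this] show False by simp
    qed
  qed
  have T0: "T []" by (simp add: T_def node_def steps_ok_def checked_def)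
  \<comment> \<open>One more than the bound of \<open>claim\<close> at the root, and still below the
    limit. One further level pays for the reversal that \<open>Dir\<close> demands at the
    root.\<close>
  let ?\<alpha> = "osuc (osuc (rk []))"
  have "?\<alpha> < ?l" using rk_lt[OF T0] limit_ordinal_osuc_less[OF l] by blast
  then have "leq L (osuc ?\<alpha>) B a B b" using leq limit_ordinal_osuc_less[OF l] by blast
  from leq_rev[OF this less_osuc, of m] have "leq L ?\<alpha> B b B a" using a b B by blast
  then have "Dir [] ?\<alpha>" by (simp add: Dir_def xs_def ys_def)
  from claim[OF T0 this zero_less_osuc] show False by simp
qed

section \<open>Ranks of a single structure: invariance, the computable bound, and
  \<open>scott_R\<close> at a limit\<close>

section \<open>Invariance under isomorphism\<close>

lemma cSR_copies: "copies L A = copies L B \<Longrightarrow> cSR L A = cSR L B"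
  by (simp add: cSR_def scott_sentence_def)

lemma cSR_iso: "isomorphic L A B \<Longrightarrow> is_structure L A \<Longrightarrow> cSR L A = cSR L B"
  using copies_eq cSR_copies by blast

lemma omega1_struct_iso: "isomorphic L A B \<Longrightarrow> is_structure L A \<Longrightarrow> omega1_struct L A = omega1_struct L B"
  using copies_eq by (simp add: omega1_struct_def)

lemma defP_iso:
  assumes "defP L \<gamma> n P" "iso_map L h A B" "is_structure L A" "is_structure L B" "a \<in> tuples A n"
  shows "P B (map h a) \<longleftrightarrow> P A a"
proof -
  obtain p where "p \<in> formulas L n"
    "\<And>A a. is_structure L A \<Longrightarrow> a \<in> tuples A n \<Longrightarrow> holds A a p \<longleftrightarrow> P A a"
    using assms(1) unfolding defP_def by blast
  then show ?thesis
    using holds_iso[OF assms(2,3,5)] iso_map_tuples[OF assms(2,5)] assms(3-5) by blast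
qed

lemma atomic_at_transfer:
  assumes M: "atomic_at L \<beta> M" "is_structure L M" and A: "is_structure L A" and iso: "isomorphic L A M"
  shows "atomic_at L \<beta> A"
  unfolding atomic_at_def
proof (intro allI ballI)
  fix n a assume a: "a \<in> tuples A n"
  obtain h where h: "iso_map L h A M" using iso by (auto simp: isomorphic_iff)
  have sur: "\<exists>x\<in>tuples A k. map h x = y" if "y \<in> tuples M k" for y k
  proof -
    have bij: "bij_betw h (univ A) (univ M)" using h by (simp add: iso_map_def)
    let ?x = "map (inv_into (univ A) h) y"
    have y: "set y \<subseteq> h ` univ A" "length y = k" using that bij by (auto simp: tuples_def bij_betw_def)
    then have "map h ?x = y" by (auto simp: f_inv_into_f subset_iff intro!: map_idI)
    moreover have "?x \<in> tuples A k" using y by (auto simp: tuples_def intro!: inv_into_into)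
    ultimately show ?thesis by blast
  qed
  have ha: "map h a \<in> tuples M n" using iso_map_tuples[OF h a] .
  obtain m \<gamma> P where P: "\<gamma> < \<beta>" "defP L \<gamma> (n + m) P" "\<exists>c\<in>tuples M m. P M (map h a @ c)"
     "\<forall>b\<in>tuples M n. \<forall>c\<in>tuples M m. P M (b @ c) \<longrightarrow> Sigma_type L \<beta> M b = Sigma_type L \<beta> M (map h a)"
    using M(1) ha unfolding atomic_at_def by blast
  have PA: "P A (x @ c) \<longleftrightarrow> P M (map h x @ map h c)" if "x \<in> tuples A n" "c \<in> tuples A m" for x c
    using defP_iso[OF P(2) h A M(2) tuples_appendI[OF that]] by simp
  have "\<exists>c\<in>tuples A m. P A (a @ c)"
    using P(3) sur PA[OF a] by metis
  moreover have "Sigma_type L \<beta> A b = Sigma_type L \<beta> A a"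
    if "b \<in> tuples A n" "c \<in> tuples A m" "P A (b @ c)" for b c
  proof -
    have "P M (map h b @ map h c)" using PA that by blast
    then have "Sigma_type L \<beta> M (map h b) = Sigma_type L \<beta> M (map h a)"
      using P(4) iso_map_tuples[OF h that(1)] iso_map_tuples[OF h that(2)] by blast
    then show ?thesis using Sigma_type_iso[OF h A that(1)] Sigma_type_iso[OF h A a] by simp
  qed
  ultimately show "\<exists>m \<gamma> P. \<gamma> < \<beta> \<and> defP L \<gamma> (n + m) P \<and> (\<exists>c\<in>tuples A m. P A (a @ c)) \<and>
     (\<forall>b\<in>tuples A n. \<forall>c\<in>tuples A m. P A (b @ c) \<longrightarrow> Sigma_type L \<beta> A b = Sigma_type L \<beta> A a)"
    using P(1,2) by blast
qed

section \<open>Scott ranks of a single structure\<close>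

text \<open>
  The generic model of the Scott sentence is atomic, and isomorphic to \<open>A\<close>.
\<close>

theorem atomic_at_of_scott_sentence:
  assumes A: "is_structure L A" and S: "scott_sentence L A S" "Pi_in (osuc \<beta>) S"
    and \<beta>: "osuc (osuc (osuc 0)) < \<beta>"
  shows "atomic_at L \<beta> A"
proof -
  have Ss: "S \<in> sentences L" and mod: "models L S = copies L A" using S(1) by (auto simp: scott_sentence_def)
  have iso: "isomorphic L A N" if "is_structure L N" "holds N [] S" for N
    using that mod by (auto simp: models_def copies_def)
  have "A \<in> models L S" using mod A isomorphic_refl by (auto simp: copies_def)
  then have AS: "holds A [] S" by (simp add: models_def)
  have "\<exists>M. is_structure L M \<and> holds M [] S \<and> atomic_at L \<beta> M"
  proof (rule ex_atomic_model[where S = "\<lambda>N a. holds N [] S" and B = A, OF \<beta> _ A AS])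
    have "defP L (osuc \<beta>) 0 (\<lambda>N a. holds N a S)" using defP_formula[OF Ss S(2)] .
    then show "defP L (osuc \<beta>) 0 (\<lambda>N a. holds N [] S)" by (rule defP_congI) (simp add: tuples_0)
  next
    fix N assume "is_structure L N" "holds N [] S"
    then have "isomorphic L A N" by (rule iso)
    then show "leq L \<beta> A [] N []"
      unfolding leq_def using holds_sentence_iso[OF _ A] by simp
  next
    \<comment> \<open>Every model of \<open>S\<close> is a copy of \<open>A\<close>, so only types
      of the countably many tuples of \<open>A\<close> occur.\<close>
    have "{Sigma_type L \<beta> N a | N a n. is_structure L N \<and> holds N [] S \<and> a \<in> tuples N n} \<subseteq> range (Sigma_type L \<beta> A)"
    proof (rule subsetI, elim CollectE exE conjE)
      fix T N a n assume N: "is_structure L N" "holds N [] S" and a: "a \<in> tuples N n" and T: "T = Sigma_type L \<beta> N a"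
      obtain h where "iso_map L h N A" using isomorphic_sym[OF iso[OF N] A] by (auto simp: isomorphic_iff)
      from Sigma_type_iso[OF this N(1) a, of \<beta>] show "T \<in> range (Sigma_type L \<beta> A)" unfolding T by (metis rangeI)
    qed
    then show "countable {Sigma_type L \<beta> N a | N a n. is_structure L N \<and> holds N [] S \<and> a \<in> tuples N n}"
      by (rule countable_subset) simp
  qed
  then obtain M where "is_structure L M" "holds M [] S" "atomic_at L \<beta> M" by blast
  then show ?thesis using atomic_at_transfer[of L \<beta> M A] A iso by blast
qed

lemma limit_ordinal_3: "limit_ordinal l \<Longrightarrow> osuc (osuc (osuc 0)) < l"
  by (intro limit_ordinal_osuc_less limit_ordinal_pos)

lemma cSR_le_atomic: "atomic_at L \<beta> M \<Longrightarrow> is_structure L M \<Longrightarrow> osuc 0 < \<beta> \<Longrightarrow> cSR L M \<le> \<beta>"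
  using atomic_at_scott cSR_le by blast

text \<open>The least value is attained by an oracle that computes a copy \<open>B\<close>.
  Agreement in \<open>B\<close> at this level includes agreement at all levels below it, hence
  yields an automorphism; so \<open>B\<close> is atomic one level higher.\<close>

theorem cSR_le_osuc_omega1:
  assumes A: "is_structure L A" and l: "limit_ordinal (omega1_struct L A)"
  shows "cSR L A \<le> osuc (omega1_struct L A)"
proof -
  let ?l = "omega1_struct L A"
  let ?Q = "\<lambda>\<alpha>. \<exists>X. (\<exists>B\<in>copies L A. computable_in X (diagram L B)) \<and> \<alpha> = omega1_oracle X"
  \<comment> \<open>A structure is computable from its own diagram, so the set whose least element
    defines \<open>omega1_struct\<close> is nonempty.\<close>
  have "computable_in X X" for X
    unfolding computable_in_def by (rule exI[of _ Oracle]) (simp add: computes.intros(4)[of X _ "[]", simplified])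
  moreover have "A \<in> copies L A" using A isomorphic_refl by (simp add: copies_def)
  ultimately have "\<exists>\<alpha>. ?Q \<alpha>" by blast
  then have "?Q ?l" unfolding omega1_struct_def by (rule LeastI_ex)
  then obtain X B where B: "B \<in> copies L A" and c: "computable_in X (diagram L B)" and X: "?l = omega1_oracle X"
    by blast
  have sB: "is_structure L B" and iso: "isomorphic L A B" using B by (auto simp: copies_def)
  have "atomic_at L (osuc ?l) B"
  proof (rule atomic_at_osucI[OF sB limit_ordinal_pos[OF l]])
    fix n a b p assume a: "a \<in> tuples B n" and b: "b \<in> tuples B n" and leq: "leq L ?l B a B b"
      and p: "p \<in> formulas L n"
    have "\<exists>h. iso_map L h B B \<and> map h a = b"
    proof (rule leq_below_omega1_oracle[OF c sB _ a b])
      show "limit_ordinal (omega1_oracle X)" using l X by simp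
      fix \<alpha> assume "\<alpha> < omega1_oracle X"
      then have "\<alpha> \<le> ?l" using X by simp
      then show "leq L \<alpha> B a B b" by (rule leq_mono[OF leq, of _ n]) (use a b sB in simp_all)
    qed
    then show "holds B a p \<longleftrightarrow> holds B b p" using holds_iso[OF _ sB a p] by blast
  qed
  then have "cSR L B \<le> osuc ?l"
    by (rule cSR_le_atomic[OF _ sB]) (use limit_ordinal_pos[OF l] in simp)
  then show ?thesis using cSR_iso[OF iso A] by simp
qed

text \<open>Upper bound: an isolating matrix of level \<open>\<gamma>\<close> below the limit bounds
  \<open>rho\<close> by \<open>osuc (osuc \<gamma>)\<close>. Lower bound: were the supremum below
  the limit, agreement at some \<open>\<delta> < l\<close> would determine complete types, making
  \<open>A\<close> atomic at \<open>osuc \<delta>\<close> and its \<open>cSR\<close> smaller than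
  \<open>l\<close>.\<close>

lemma scott_R_eq_limit:
  assumes A: "is_structure L A" and c: "cSR L A = l" and l: "limit_ordinal l"
  shows "scott_R L A = l"
proof -
  obtain S where "scott_sentence L A S" "Pi_in (osuc l) S" using ex_scott_sentence[OF A] c by blast
  then have at: "atomic_at L l A" using atomic_at_of_scott_sentence[OF A _ _ limit_ordinal_3[OF l]] by blast
  have l0: "0 < l" using limit_ordinal_pos[OF l] .
  define good where "good a \<alpha> \<longleftrightarrow> (\<forall>b\<in>tuples A (length a).
     (\<forall>p\<in>formulas L (length a). Pi_in \<alpha> p \<and> holds A a p \<longrightarrow> holds A b p) \<longrightarrow>
     (\<forall>p\<in>formulas L (length a). holds A a p \<longrightarrow> holds A b p))" for a \<alpha>
  have rho: "rho L A a = (LEAST \<alpha>. good a \<alpha>)" for a by (simp add: rho_def good_def)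
  have ex: "\<exists>\<alpha><l. good a \<alpha>" if a: "a \<in> tuples A n" for a n
  proof -
    obtain m \<gamma> P where P: "\<gamma> < l" "defP L \<gamma> (n + m) P" "\<exists>c\<in>tuples A m. P A (a @ c)"
     "\<And>b c. b \<in> tuples A n \<Longrightarrow> c \<in> tuples A m \<Longrightarrow> P A (b @ c) \<Longrightarrow> Sigma_type L l A b = Sigma_type L l A a"
      using at a unfolding atomic_at_def by blast
    have D: "defS L (osuc \<gamma>) n (\<lambda>N b. \<exists>c\<in>tuples N m. P N (b @ c))"
      using defS_Ex[OF defS_of_defP[OF P(2) less_osuc] zero_less_osuc] .
    have la: "length a = n" using a by (rule tuples_length)
    \<comment> \<open>The isolating formula is \<Sigma> of level \<open>osuc \<gamma>\<close>; one
      more level lets inclusion of \<Pi> types transfer it.\<close>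
    have "good a (osuc (osuc \<gamma>))"
      unfolding good_def la
    proof (intro ballI impI)
      fix b p assume b: "b \<in> tuples A n" and imp: "\<forall>p\<in>formulas L n. Pi_in (osuc (osuc \<gamma>)) p \<and> holds A a p \<longrightarrow> holds A b p"
        and p: "p \<in> formulas L n" "holds A a p"
      have "leq L (osuc (osuc \<gamma>)) A a A b" using imp la by (simp add: leq_def)
      from leq_D_S[OF this less_osuc _ _ D] a b A P(3) have "\<exists>c\<in>tuples A m. P A (b @ c)" by blast
      then have "Sigma_type L l A b = Sigma_type L l A a" using P(4)[OF b] by blast
      from atomic_at_aut[OF at A b a this l0 p(1)] p(2) show "holds A b p" by blast
    qed
    moreover have "osuc (osuc \<gamma>) < l" using P(1) limit_ordinal_osuc_less[OF l] by blast
    ultimately show ?thesis by blast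
  qed
  have rho_good: "good a (rho L A a)" and rho_less: "rho L A a < l" if a: "a \<in> tuples A n" for a n
  proof -
    obtain \<alpha> where \<alpha>: "\<alpha> < l" "good a \<alpha>" using ex[OF a] by blast
    show "good a (rho L A a)" unfolding rho using \<alpha>(2) by (rule LeastI)
    have "rho L A a \<le> \<alpha>" unfolding rho using \<alpha>(2) by (rule Least_le)
    then show "rho L A a < l" using \<alpha>(1) by simp
  qed
  have bound: "\<forall>n. \<forall>a\<in>tuples A n. osuc (rho L A a) \<le> l" using rho_less by simp
  then have le: "scott_R L A \<le> l" unfolding scott_R_def by (rule Least_le)
  have R: "\<forall>n. \<forall>a\<in>tuples A n. osuc (rho L A a) \<le> scott_R L A"
    unfolding scott_R_def by (rule LeastI[of "\<lambda>\<beta>. \<forall>n. \<forall>a\<in>tuples A n. osuc (rho L A a) \<le> \<beta>", OF bound])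
  have "\<not> scott_R L A < l"
  proof
    assume lt: "scott_R L A < l"
    define \<delta> where "\<delta> = max (scott_R L A) (osuc 0)"
    have \<delta>: "\<delta> < l" "0 < \<delta>" "scott_R L A \<le> \<delta>"
      using lt limit_ordinal_osuc_less[OF l l0] by (auto simp: \<delta>_def less_max_iff_disj)
    have "atomic_at L (osuc \<delta>) A"
    proof (rule atomic_at_osucI[OF A \<delta>(2)])
      fix n a b p assume a: "a \<in> tuples A n" and b: "b \<in> tuples A n" and leq: "leq L \<delta> A a A b"
        and p: "p \<in> formulas L n"
      have la: "length a = n" using a by (rule tuples_length)
      have "osuc (rho L A a) \<le> scott_R L A" using R a by blast
      then have "rho L A a \<le> \<delta>" using \<delta>(3) by simp
      from leq_mono[OF leq this, of n] have "leq L (rho L A a) A a A b" using a b A by blast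
      then have imp: "holds A b q" if "q \<in> formulas L n" "holds A a q" for q
        using rho_good[OF a] b that unfolding good_def leq_def la by blast
      \<comment> \<open>\<open>imp\<close> gives implications in one direction; applying it to the
        negation gives the other.\<close>
      have "NegF p \<in> formulas L n" using p by (simp add: formulas_def)
      from imp[OF this] imp[OF p] show "holds A a p \<longleftrightarrow> holds A b p" by (auto simp: holds_def)
    qed
    from cSR_le_atomic[OF this A] \<delta>(2) have "cSR L A \<le> osuc \<delta>" by simp
    moreover have "osuc \<delta> < l" using limit_ordinal_osuc_less[OF l \<delta>(1)] .
    ultimately show False using c by simp
  qed
  then show ?thesis using le by simp
qed

section \<open>The uncountable classes of a minimal counterexample and their labels\<close>

section \<open>Minimal counterexamples\<close>

lemma equiv_at_defP:
  assumes "equiv_at L \<alpha> A B" "defP L \<alpha> 0 P" "is_structure L A" "is_structure L B"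
  shows "P A [] \<longleftrightarrow> P B []"
  using assms unfolding equiv_at_def defP_def by (auto simp: tuples_0)

lemma equiv_at_Sigma_type:
  assumes "equiv_at L \<alpha> A B" "is_structure L A" "is_structure L B"
  shows "Sigma_type L \<alpha> A [] = Sigma_type L \<alpha> B []"
proof (rule Sigma_type_eqI[where n = 0])
  fix P assume "defS L \<alpha> 0 P"
  then have "defP L \<alpha> 0 (\<lambda>A a. \<not> P A a)" by (simp add: defP_neg)
  from equiv_at_defP[OF assms(1) this assms(2,3)] show "P A [] \<longleftrightarrow> P B []" by blast
qed (use assms in \<open>auto simp: tuples_0\<close>)

lemma equiv_at_refl: "equiv_at L \<alpha> A A"
  by (simp add: equiv_at_def)

lemma equiv_at_sym: "equiv_at L \<alpha> A B \<Longrightarrow> equiv_at L \<alpha> B A"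
  by (simp add: equiv_at_def)

lemma equiv_at_trans: "equiv_at L \<alpha> A B \<Longrightarrow> equiv_at L \<alpha> B C \<Longrightarrow> equiv_at L \<alpha> A C"
  by (simp add: equiv_at_def)

lemma equiv_at_iso: "isomorphic L A B \<Longrightarrow> is_structure L A \<Longrightarrow> equiv_at L \<alpha> A B"
  using holds_sentence_iso by (simp add: equiv_at_def)

lemma models_structure: "A \<in> models L p \<Longrightarrow> is_structure L A"
  by (simp add: models_def)

lemma models_iso:
  "A \<in> models L p \<Longrightarrow> isomorphic L A B \<Longrightarrow> is_structure L B \<Longrightarrow> p \<in> sentences L \<Longrightarrow> B \<in> models L p"
  using holds_sentence_iso[of L A B p] by (simp add: models_def)

lemma iso_types_mono: "C \<subseteq> D \<Longrightarrow> countable (iso_types L D) \<Longrightarrow> countable (iso_types L C)"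
  unfolding iso_types_def by (meson countable_subset image_mono)

locale minimal_counterexample_sentence =
  fixes L :: vocabulary and \<phi> :: fm
  assumes mc: "minimal_counterexample L \<phi>"
begin

lemma phi: "\<phi> \<in> sentences L"
  using mc by (simp add: minimal_counterexample_def)

lemma uncountable_models: "\<not> countable (iso_types L (models L \<phi>))"
proof
  assume "countable (iso_types L (models L \<phi>))"
  then have "(card_of (iso_types L (models L \<phi>)), natLeq) \<in> ordLeq"
    by (simp add: countable_card_le_natLeq)
  moreover have "(card_of (iso_types L (models L \<phi>)), cardSuc natLeq) \<in> ordIso"
    using mc by (simp add: minimal_counterexample_def)
  ultimately have "(cardSuc natLeq, natLeq) \<in> ordLeq"
    using ordIso_ordLeq_trans ordIso_symmetric by blast
  then show False using cardSuc_greater[OF natLeq_Card_order] not_ordLess_ordLeq by blast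
qed

lemma countable_classes: "countable (equiv_classes L \<phi> \<beta>)"
  using mc by (simp add: minimal_counterexample_def scattered_def)

lemma class_cases:
  assumes "C \<in> equiv_classes L \<phi> \<beta>"
  obtains A where "A \<in> models L \<phi>" "C = {B \<in> models L \<phi>. equiv_at L \<beta> A B}"
  using assms by (auto simp: equiv_classes_def)

lemma class_eq:
  assumes "C \<in> equiv_classes L \<phi> \<beta>" "A \<in> C"
  shows "C = {B \<in> models L \<phi>. equiv_at L \<beta> A B}"
  using assms(1)
proof (rule class_cases)
  fix A' assume "A' \<in> models L \<phi>" and C: "C = {B \<in> models L \<phi>. equiv_at L \<beta> A' B}"
  then have "equiv_at L \<beta> A' A" using assms(2) by blast
  then show ?thesis unfolding C using equiv_at_trans equiv_at_sym by blast
qed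

text \<open>Scatteredness leaves countably many classes, so one of them has uncountably many
  isomorphism types. Two such classes would be separated by a sentence, and this sentence would
  split \<open>\<phi>\<close> into two parts with uncountably many models each, against
  minimality.\<close>

lemma big_class_unique:
  "\<exists>!C. C \<in> equiv_classes L \<phi> \<beta> \<and> \<not> countable (iso_types L C)"
proof (rule ex_ex1I)
  show "\<exists>C. C \<in> equiv_classes L \<phi> \<beta> \<and> \<not> countable (iso_types L C)"
  proof (rule ccontr)
    assume "\<not> ?thesis"
    then have "countable (\<Union>C\<in>equiv_classes L \<phi> \<beta>. iso_types L C)"
      using countable_classes by auto
    moreover have "iso_types L (models L \<phi>) \<subseteq> (\<Union>C\<in>equiv_classes L \<phi> \<beta>. iso_types L C)"
      unfolding iso_types_def equiv_classes_def using equiv_at_refl by fastforce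
    ultimately show False using uncountable_models countable_subset by blast
  qed
next
  fix C D assume C: "C \<in> equiv_classes L \<phi> \<beta> \<and> \<not> countable (iso_types L C)"
    and D: "D \<in> equiv_classes L \<phi> \<beta> \<and> \<not> countable (iso_types L D)"
  obtain A where A: "A \<in> models L \<phi>" "C = {N \<in> models L \<phi>. equiv_at L \<beta> A N}" using C class_cases by blast
  obtain B where B: "B \<in> models L \<phi>" "D = {N \<in> models L \<phi>. equiv_at L \<beta> B N}" using D class_cases by blast
  show "C = D"
  proof (cases "equiv_at L \<beta> A B")
    case True
    then show ?thesis using A B equiv_at_trans equiv_at_sym by blast
  next
    case False
    then obtain p where p: "p \<in> sentences L" "Pi_in \<beta> p" "holds A [] p \<noteq> holds B [] p"
      by (auto simp: equiv_at_def)
    have cd: "holds N [] p \<longleftrightarrow> holds A [] p" if "N \<in> C" for N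
      using that A p unfolding equiv_at_def by blast
    have dd: "holds N [] p \<longleftrightarrow> holds B [] p" if "N \<in> D" for N
      using that B p unfolding equiv_at_def by blast
    have sub: "C \<subseteq> models L \<phi>" "D \<subseteq> models L \<phi>" using A B by auto
    have m1: "models L (AndF \<phi> p) = {N \<in> models L \<phi>. holds N [] p}"
      and m2: "models L (AndF \<phi> (NegF p)) = {N \<in> models L \<phi>. \<not> holds N [] p}"
      by (auto simp: models_def holds_def)
    have CD: "\<not> countable (iso_types L C)" "\<not> countable (iso_types L D)" using C D by simp_all
    have "\<not> countable (iso_types L (models L (AndF \<phi> p))) \<and>
      \<not> countable (iso_types L (models L (AndF \<phi> (NegF p))))"
    proof (cases "holds A [] p")
      case True
      then have "C \<subseteq> models L (AndF \<phi> p)" "D \<subseteq> models L (AndF \<phi> (NegF p))"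
        unfolding m1 m2 using cd dd sub p(3) by blast+
      then show ?thesis using CD iso_types_mono by metis
    next
      case False
      then have "D \<subseteq> models L (AndF \<phi> p)" "C \<subseteq> models L (AndF \<phi> (NegF p))"
        unfolding m1 m2 using cd dd sub p(3) by blast+
      then show ?thesis using CD iso_types_mono by metis
    qed
    then show ?thesis using mc p(1) unfolding minimal_counterexample_def by blast
  qed
qed

lemma big_class: "big_class L \<phi> \<beta> \<in> equiv_classes L \<phi> \<beta>" "\<not> countable (iso_types L (big_class L \<phi> \<beta>))"
  using theI'[OF big_class_unique[of \<beta>]] by (simp_all add: big_class_def)

lemma big_class_models: "A \<in> big_class L \<phi> \<beta> \<Longrightarrow> A \<in> models L \<phi>"
  using big_class(1)[of \<beta>] by (auto simp: equiv_classes_def)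

lemma big_class_structure: "A \<in> big_class L \<phi> \<beta> \<Longrightarrow> is_structure L A"
  using big_class_models models_structure by blast

lemma big_class_equiv: "A \<in> big_class L \<phi> \<beta> \<Longrightarrow> B \<in> big_class L \<phi> \<beta> \<Longrightarrow> equiv_at L \<beta> A B"
  using class_eq[OF big_class(1)] by blast

lemma big_classI: "A \<in> big_class L \<phi> \<beta> \<Longrightarrow> B \<in> models L \<phi> \<Longrightarrow> equiv_at L \<beta> A B \<Longrightarrow> B \<in> big_class L \<phi> \<beta>"
  using class_eq[OF big_class(1)] by blast

lemma big_class_iso:
  assumes "A \<in> big_class L \<phi> \<beta>" "isomorphic L A B" "is_structure L B"
  shows "B \<in> big_class L \<phi> \<beta>"
  using assms big_classI models_iso[OF big_class_models[OF assms(1)] assms(2,3) phi]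
    equiv_at_iso[OF assms(2) big_class_structure[OF assms(1)]] by blast

text \<open>A Scott sentence of level at most \<open>\<beta>\<close> is shared by the whole class,
  which would then consist of copies of \<open>M\<close>.\<close>

lemma le_cSR_big_class:
  assumes M: "M \<in> big_class L \<phi> \<beta>"
  shows "\<beta> \<le> cSR L M"
proof (rule ccontr)
  assume "\<not> \<beta> \<le> cSR L M"
  then have lt: "osuc (cSR L M) \<le> \<beta>" by simp
  have sM: "is_structure L M" using big_class_structure[OF M] .
  obtain S where S: "scott_sentence L M S" "Pi_in (osuc (cSR L M)) S" using ex_scott_sentence[OF sM] by blast
  then have Ss: "S \<in> sentences L" and mod: "models L S = copies L M" by (auto simp: scott_sentence_def)
  have "M \<in> models L S" using mod sM isomorphic_refl by (auto simp: copies_def)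
  then have MS: "holds M [] S" by (simp add: models_def)
  have d: "defP L \<beta> 0 (\<lambda>N a. holds N a S)" using defP_mono[OF defP_formula[OF Ss S(2)] lt] .
  have "copies L N = copies L M" if N: "N \<in> big_class L \<phi> \<beta>" for N
  proof -
    have sN: "is_structure L N" using big_class_structure[OF N] .
    have "holds N [] S" using equiv_at_defP[OF big_class_equiv[OF M N] d sM sN] MS by blast
    then have "N \<in> copies L M" using mod sN by (auto simp: models_def)
    then have "isomorphic L M N" by (simp add: copies_def)
    from copies_eq[OF this sM] show ?thesis by simp
  qed
  then have "iso_types L (big_class L \<phi> \<beta>) \<subseteq> {copies L M}" by (auto simp: iso_types_def)
  from countable_subset[OF this] show False using big_class(2) by simp
qed

text \<open>Outside the big class only countably many isomorphism types remain, so their ranks are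
  bounded and the least bound \<open>f_bound\<close> is really a bound.\<close>

lemma cSR_less_Fset:
  assumes l: "l \<in> Fset L \<phi>" and M: "M \<in> models L \<phi>" "M \<notin> big_class L \<phi> l"
  shows "cSR L M < l"
proof -
  let ?S = "models L \<phi> - big_class L \<phi> l"
  have "?S \<subseteq> \<Union> (equiv_classes L \<phi> l - {big_class L \<phi> l})"
  proof
    fix N assume N: "N \<in> ?S"
    let ?C = "{B \<in> models L \<phi>. equiv_at L l N B}"
    have "?C \<in> equiv_classes L \<phi> l" "N \<in> ?C" using N equiv_at_refl by (auto simp: equiv_classes_def)
    moreover from this(2) have "?C \<noteq> big_class L \<phi> l" using N by blast
    ultimately show "N \<in> \<Union> (equiv_classes L \<phi> l - {big_class L \<phi> l})" by blast
  qed
  then have "iso_types L ?S \<subseteq> (\<Union>C\<in>equiv_classes L \<phi> l - {big_class L \<phi> l}. iso_types L C)"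
    unfolding iso_types_def by blast
  moreover have "countable (\<Union>C\<in>equiv_classes L \<phi> l - {big_class L \<phi> l}. iso_types L C)"
  proof (intro countable_UN)
    show "countable (equiv_classes L \<phi> l - {big_class L \<phi> l})" using countable_classes by simp
    fix C assume "C \<in> equiv_classes L \<phi> l - {big_class L \<phi> l}"
    then show "countable (iso_types L C)" using big_class_unique[of l] big_class[of l] by blast
  qed
  ultimately have c: "countable (iso_types L ?S)" by (rule countable_subset)
  \<comment> \<open>\<open>cSR\<close> depends only on the isomorphism type, so the ranks form an
    image of a countable set of types.\<close>
  have "cSR L ` ?S \<subseteq> (\<lambda>T. cSR L (SOME A. copies L A = T)) ` iso_types L ?S"
  proof
    fix \<alpha> assume "\<alpha> \<in> cSR L ` ?S"
    then obtain A where A: "A \<in> ?S" "\<alpha> = cSR L A" by blast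
    have "copies L (SOME B. copies L B = copies L A) = copies L A" by (rule someI) (rule refl)
    then have "\<alpha> = cSR L (SOME B. copies L B = copies L A)" using cSR_copies A(2) by metis
    then show "\<alpha> \<in> (\<lambda>T. cSR L (SOME A. copies L A = T)) ` iso_types L ?S"
      using A(1) unfolding iso_types_def by blast
  qed
  from countable_subset[OF this countable_image[OF c]] have "countable (cSR L ` ?S)" .
  then obtain \<beta> where "\<forall>\<alpha>\<in>cSR L ` ?S. \<alpha> < \<beta>" using countable_imp_bounded_omega1 by blast
  then have "\<exists>\<beta>. \<forall>M\<in>models L \<phi>. M \<notin> big_class L \<phi> l \<longrightarrow> cSR L M < \<beta>" by blast
  then have "\<forall>M\<in>models L \<phi>. M \<notin> big_class L \<phi> l \<longrightarrow> cSR L M < f_bound L \<phi> l"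
    unfolding f_bound_def by (rule LeastI_ex)
  then have "cSR L M < f_bound L \<phi> l" using M by blast
  also have "\<dots> \<le> l" using l by (simp add: Fset_def)
  finally show ?thesis .
qed

lemma label:
  "label L \<phi> \<beta> \<in> big_class L \<phi> \<beta>" "M \<in> big_class L \<phi> \<beta> \<Longrightarrow> cSR L (label L \<phi> \<beta>) \<le> cSR L M"
proof -
  have "big_class L \<phi> \<beta> \<noteq> {}"
  proof
    assume "big_class L \<phi> \<beta> = {}"
    then show False using big_class(2)[of \<beta>] by (simp add: iso_types_def)
  qed
  then have "\<exists>\<alpha>. \<alpha> \<in> cSR L ` big_class L \<phi> \<beta>" by blast
  then have "(LEAST \<alpha>. \<alpha> \<in> cSR L ` big_class L \<phi> \<beta>) \<in> cSR L ` big_class L \<phi> \<beta>" by (rule LeastI_ex)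
  then obtain K where K: "K \<in> big_class L \<phi> \<beta>" "cSR L K = (LEAST \<alpha>. \<alpha> \<in> cSR L ` big_class L \<phi> \<beta>)" by force
  have "\<forall>M\<in>big_class L \<phi> \<beta>. cSR L K \<le> cSR L M" unfolding K(2) by (intro ballI Least_le) blast
  then have "\<exists>K. K \<in> big_class L \<phi> \<beta> \<and> (\<forall>M\<in>big_class L \<phi> \<beta>. cSR L K \<le> cSR L M)" using K(1) by blast
  then have "label L \<phi> \<beta> \<in> big_class L \<phi> \<beta> \<and> (\<forall>M\<in>big_class L \<phi> \<beta>. cSR L (label L \<phi> \<beta>) \<le> cSR L M)"
    unfolding label_def by (rule someI_ex)
  then show "label L \<phi> \<beta> \<in> big_class L \<phi> \<beta>"
    "M \<in> big_class L \<phi> \<beta> \<Longrightarrow> cSR L (label L \<phi> \<beta>) \<le> cSR L M" by blast+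
qed

text \<open>Rank \<open>\<beta>\<close>, the least possible in the class, makes both structures
  atomic at \<open>\<beta>\<close>, and membership in one class gives the empty tuples the same
  type; \<open>atomic_at_iso\<close> then applies.\<close>

lemma isomorphic_label:
  assumes A: "A \<in> big_class L \<phi> \<beta>" "cSR L A = \<beta>" and \<beta>: "osuc (osuc (osuc 0)) < \<beta>"
  shows "isomorphic L A (label L \<phi> \<beta>)" "cSR L (label L \<phi> \<beta>) = \<beta>"
proof -
  let ?K = "label L \<phi> \<beta>"
  have K: "?K \<in> big_class L \<phi> \<beta>" by (rule label(1))
  show cK: "cSR L ?K = \<beta>" using label(2)[OF A(1)] le_cSR_big_class[OF K] A(2) by simp
  have at: "atomic_at L \<beta> N" if "N \<in> big_class L \<phi> \<beta>" "cSR L N = \<beta>" for N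
    using ex_scott_sentence[OF big_class_structure[OF that(1)]] that(2)
      atomic_at_of_scott_sentence[OF big_class_structure[OF that(1)] _ _ \<beta>] by auto
  have eq: "Sigma_type L \<beta> A [] = Sigma_type L \<beta> ?K []"
    using equiv_at_Sigma_type[OF big_class_equiv[OF A(1) K]] big_class_structure A(1) K by blast
  have "0 < \<beta>" using \<beta> by (meson less_trans zero_less_osuc)
  from atomic_at_iso[OF at[OF A] big_class_structure[OF A(1)] at[OF K cK] big_class_structure[OF K],
      where n = 0, OF _ _ eq this]
  show "isomorphic L A ?K" by (auto simp: tuples_0 isomorphic_iff)
qed

text \<open>\<open>qr\<close> is attained only up to logical equivalence and possibly by a \<Sigma>
  sentence; the strict inequality turns either kind into a \<Pi> predicate of level
  \<open>\<alpha>\<close>.\<close>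

lemma qr_defP:
  assumes "qr L \<phi> < \<alpha>"
  shows "defP L \<alpha> 0 (\<lambda>N a. holds N [] \<phi>)"
proof -
  let ?Q = "\<lambda>\<beta>. \<exists>S\<in>sentences L. models L S = models L \<phi> \<and> (Pi_in \<beta> S \<or> Sigma_in \<beta> S)"
  obtain \<beta> where "defS L \<beta> 0 (\<lambda>A a. holds A a \<phi>)" using ex_defS_formula[OF phi] by blast
  then obtain p where p: "p \<in> sentences L" "Sigma_in \<beta> p" "\<And>A. is_structure L A \<Longrightarrow> holds A [] p \<longleftrightarrow> holds A [] \<phi>"
    unfolding defS_def by (auto simp: tuples_0)
  then have "models L p = models L \<phi>" by (auto simp: models_def)
  then have "\<exists>\<beta>. ?Q \<beta>" using p(1,2) by blast
  then have "?Q (qr L \<phi>)" unfolding qr_def by (rule LeastI_ex)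
  then obtain S where S: "S \<in> sentences L" "models L S = models L \<phi>" "Pi_in (qr L \<phi>) S \<or> Sigma_in (qr L \<phi>) S" by blast
  have "defP L \<alpha> 0 (\<lambda>N a. holds N a S)"
    using S(3) defP_mono[OF defP_formula[OF S(1)]] defP_of_defS[OF defS_formula[OF S(1)] assms] assms by auto
  then show ?thesis
  proof (rule defP_congI)
    fix A a assume A: "is_structure L A" "a \<in> tuples A 0"
    then have "a = []" by (simp add: tuples_0)
    moreover have "A \<in> models L S \<longleftrightarrow> A \<in> models L \<phi>" using S(2) by simp
    ultimately show "holds A a S \<longleftrightarrow> holds A [] \<phi>" using A(1) by (simp add: models_def)
  qed
qed

text \<open>\<open>\<phi>\<close> together with the correct answer to one separating sentence for
  each other class axiomatises the big class, by a \<Pi> sentence of level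
  \<open>osuc \<beta>\<close>. Its atomic model has rank at most \<open>\<beta>\<close>, and by
  \<open>le_cSR_big_class\<close> no member has less.\<close>

lemma cSR_label:
  assumes \<beta>: "osuc (osuc (osuc 0)) < \<beta>" and qr: "qr L \<phi> < \<beta>"
  shows "cSR L (label L \<phi> \<beta>) = \<beta>"
proof -
  obtain A where A: "A \<in> big_class L \<phi> \<beta>" using label(1) by blast
  have sA: "is_structure L A" using big_class_structure[OF A] .
  let ?E = "equiv_classes L \<phi> \<beta>"
  \<comment> \<open>One sentence separates the whole of \<open>C\<close> from \<open>A\<close>,
    since the members of \<open>C\<close> agree on sentences of level \<open>\<beta>\<close>; so
    countably many sentences suffice.\<close>
  have "\<forall>C. C \<in> ?E \<and> C \<noteq> big_class L \<phi> \<beta> \<longrightarrow> (\<exists>p. p \<in> sentences L \<and> Pi_in \<beta> p \<and>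
      (\<forall>N\<in>C. holds N [] p \<noteq> holds A [] p))"
  proof (intro allI impI)
    fix C assume C: "C \<in> ?E \<and> C \<noteq> big_class L \<phi> \<beta>"
    then obtain B where B: "B \<in> models L \<phi>" "C = {N \<in> models L \<phi>. equiv_at L \<beta> B N}" using class_cases by blast
    have "\<not> equiv_at L \<beta> A B"
    proof
      assume "equiv_at L \<beta> A B"
      then have "B \<in> big_class L \<phi> \<beta>" using big_classI[OF A B(1)] by blast
      then show False using class_eq[OF big_class(1)] B C by blast
    qed
    then obtain p where p: "p \<in> sentences L" "Pi_in \<beta> p" "holds A [] p \<noteq> holds B [] p" by (auto simp: equiv_at_def)
    then have "\<forall>N\<in>C. holds N [] p \<noteq> holds A [] p" using B unfolding equiv_at_def by blast
    then show "\<exists>p. p \<in> sentences L \<and> Pi_in \<beta> p \<and> (\<forall>N\<in>C. holds N [] p \<noteq> holds A [] p)" using p by blast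
  qed
  then obtain s where s: "\<And>C. C \<in> ?E \<and> C \<noteq> big_class L \<phi> \<beta> \<Longrightarrow> s C \<in> sentences L \<and> Pi_in \<beta> (s C) \<and>
      (\<forall>N\<in>C. holds N [] (s C) \<noteq> holds A [] (s C))"
    unfolding choice_iff' by blast
  let ?c = "from_nat_into ?E"
  define S where "S N (x :: nat list) \<longleftrightarrow> holds N [] \<phi> \<and>
    (\<forall>i. ?c i \<in> ?E \<and> ?c i \<noteq> big_class L \<phi> \<beta> \<longrightarrow> (holds N [] (s (?c i)) \<longleftrightarrow> holds A [] (s (?c i))))" for N x
  \<comment> \<open>\<open>A\<close> may satisfy the separating sentence or refute it; level
    \<open>osuc \<beta>\<close> accommodates both \<Pi> and \<Sigma> of level
    \<open>\<beta>\<close>.\<close>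
  have sep: "defP L (osuc \<beta>) 0 (\<lambda>N x. holds N [] p \<longleftrightarrow> holds A [] p)" if p: "p \<in> sentences L" "Pi_in \<beta> p" for p
  proof -
    have d: "defP L \<beta> 0 (\<lambda>N x. holds N [] p)"
      by (rule defP_congI[OF defP_formula[OF p]]) (simp add: tuples_0)
    then have "defS L \<beta> 0 (\<lambda>N x. \<not> holds N [] p)" by (simp add: defS_neg)
    then have n: "defP L (osuc \<beta>) 0 (\<lambda>N x. \<not> holds N [] p)" by (rule defP_of_defS) simp
    have "defP L (osuc \<beta>) 0 (\<lambda>N x. holds N [] p)" using defP_mono[OF d] less_osuc less_imp_le by blast
    then show ?thesis using n by (cases "holds A [] p") simp_all
  qed
  have "qr L \<phi> < osuc \<beta>" using qr by simp
  then have dS: "defP L (osuc \<beta>) 0 S"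
    unfolding S_def by (intro defP_conj qr_defP defP_all_nat defP_imp sep zero_less_osuc) (use s in blast)+
  have big: "N \<in> big_class L \<phi> \<beta>" if N: "is_structure L N" "S N []" for N
  proof (rule ccontr)
    assume nb: "N \<notin> big_class L \<phi> \<beta>"
    have Nm: "N \<in> models L \<phi>" using N by (simp add: S_def models_def)
    let ?C = "{B \<in> models L \<phi>. equiv_at L \<beta> N B}"
    have C: "?C \<in> ?E" using Nm by (auto simp: equiv_classes_def)
    have NC: "N \<in> ?C" using Nm equiv_at_refl by blast
    then have ne: "?C \<noteq> big_class L \<phi> \<beta>" using nb by blast
    obtain i where i: "?c i = ?C" using from_nat_into_surj[OF countable_classes C] by blast
    have "holds N [] (s ?C) \<longleftrightarrow> holds A [] (s ?C)" using N(2) C ne unfolding S_def i[symmetric] by blast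
    then show False using s[of ?C] C ne NC by blast
  qed
  have AS: "S A []" using big_class_models[OF A] by (simp add: S_def models_def)
  have "\<exists>M. is_structure L M \<and> S M [] \<and> atomic_at L \<beta> M"
  proof (rule ex_atomic_model[OF \<beta> dS sA AS])
    fix N assume "is_structure L N" "S N []"
    then have "equiv_at L \<beta> A N" using big big_class_equiv[OF A] by blast
    then show "leq L \<beta> A [] N []" by (simp add: leq_def equiv_at_def)
  next
    have "countable {Sigma_type L \<beta> N a | N a n. N \<in> models L \<phi> \<and> a \<in> tuples N n}"
      using mc by (simp add: minimal_counterexample_def)
    then show "countable {Sigma_type L \<beta> N a | N a n. is_structure L N \<and> S N [] \<and> a \<in> tuples N n}"
      by (rule countable_subset[rotated]) (use big big_class_models in blast)
  qed
  then obtain M where M: "is_structure L M" "S M []" "atomic_at L \<beta> M" by blast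
  have "osuc 0 < \<beta>" using \<beta> by (meson less_osuc less_trans)
  then have "cSR L M \<le> \<beta>" using cSR_le_atomic M by blast
  moreover have "cSR L (label L \<phi> \<beta>) \<le> cSR L M" using label(2) big M by blast
  ultimately show ?thesis using le_cSR_big_class[OF label(1)] by (meson antisym order_trans)
qed

end

theorem mainTheorem1:
  fixes L :: vocabulary and \<phi> :: fm and l :: omega1 and A :: struct
  assumes "minimal_counterexample L \<phi>"
    and "limit_ordinal l" and "l \<in> Fset L \<phi>" and "qr L \<phi> < l"
    and "A \<in> W L \<phi> l"
  shows
    "let case_I = (cSR L A = l);
         case_II = (cSR L A = osuc l \<and> A \<notin> big_class L \<phi> (osuc l));
         case_III = (cSR L A = osuc l \<and> A \<in> big_class L \<phi> (osuc l))
     in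
     ((case_I \<and> \<not> case_II \<and> \<not> case_III) \<or>
      (\<not> case_I \<and> case_II \<and> \<not> case_III) \<or>
      (\<not> case_I \<and> \<not> case_II \<and> case_III)) \<and>
     (case_I \<longrightarrow>
        isomorphic L A (label L \<phi> l) \<and>
        omega1_struct L (label L \<phi> l) = l \<and>
        scott_R L (label L \<phi> l) = l \<and>
        scott_R L (label L \<phi> l) = omega1_struct L (label L \<phi> l)) \<and>
     (case_II \<longrightarrow>
        big_class L \<phi> (osuc l) \<subset> HIGH L \<phi> l \<and>
        label L \<phi> (osuc l) \<in> models L \<phi> \<and>
        cSR L (label L \<phi> (osuc l)) = osuc l \<and>
        \<not> isomorphic L A (label L \<phi> (osuc l)) \<and>
        osuc l \<notin> Fset L \<phi>) \<and>
     (case_III \<longrightarrow>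
        isomorphic L A (label L \<phi> (osuc l)) \<and>
        omega1_struct L (label L \<phi> (osuc l)) = l \<and>
        cSR L (label L \<phi> (osuc l)) = osuc l \<and>
        cSR L (label L \<phi> (osuc l)) = osuc (omega1_struct L (label L \<phi> (osuc l))))"
proof -
  interpret mc: minimal_counterexample_sentence L \<phi> by unfold_locales (rule assms(1))
  have Am: "A \<in> models L \<phi>" and om: "omega1_struct L A = l" and ge: "l \<le> cSR L A"
    using assms(5) by (auto simp: W_def)
  have sA: "is_structure L A" using models_structure[OF Am] .
  have "cSR L A \<le> osuc l" using cSR_le_osuc_omega1[OF sA] om assms(2) by simp
  then have alt: "cSR L A = l \<or> cSR L A = osuc l" using ge by (metis less_osuc_iff le_less antisym)
  have ne: "osuc l \<noteq> l" using less_osuc[of l] by force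
  have three: "osuc (osuc (osuc 0)) < l" using limit_ordinal_3[OF assms(2)] .
  then have three': "osuc (osuc (osuc 0)) < osuc l" using less_osuc by (rule less_trans)
  have I: "isomorphic L A (label L \<phi> l) \<and> omega1_struct L (label L \<phi> l) = l \<and> scott_R L (label L \<phi> l) = l"
    if c: "cSR L A = l"
  proof -
    \<comment> \<open>A model outside this class would have rank below \<open>l\<close>, because
      \<open>l\<close> belongs to \<open>Fset\<close>.\<close>
    have "A \<in> big_class L \<phi> l" using mc.cSR_less_Fset[OF assms(3) Am] c by auto
    note K = mc.isomorphic_label[OF this c three]
    have "omega1_struct L (label L \<phi> l) = l" using omega1_struct_iso[OF K(1) sA] om by simp
    then show ?thesis using K scott_R_eq_limit[OF mc.big_class_structure[OF mc.label(1)] K(2) assms(2)] by blast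
  qed
  have II: "big_class L \<phi> (osuc l) \<subset> HIGH L \<phi> l \<and> label L \<phi> (osuc l) \<in> models L \<phi> \<and>
        cSR L (label L \<phi> (osuc l)) = osuc l \<and> \<not> isomorphic L A (label L \<phi> (osuc l)) \<and> osuc l \<notin> Fset L \<phi>"
    if c: "cSR L A = osuc l" and n: "A \<notin> big_class L \<phi> (osuc l)"
  proof (intro conjI)
    have "A \<in> HIGH L \<phi> l" using Am c by (simp add: HIGH_def)
    moreover have "big_class L \<phi> (osuc l) \<subseteq> HIGH L \<phi> l"
      using mc.big_class_models mc.le_cSR_big_class unfolding HIGH_def by blast
    ultimately show "big_class L \<phi> (osuc l) \<subset> HIGH L \<phi> l" using n by blast
    show "label L \<phi> (osuc l) \<in> models L \<phi>" using mc.big_class_models mc.label(1) by blast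
    show "cSR L (label L \<phi> (osuc l)) = osuc l"
      using mc.cSR_label[OF three'] assms(4) by (simp add: less_imp_le)
    show "\<not> isomorphic L A (label L \<phi> (osuc l))"
      using mc.big_class_iso[OF mc.label(1) _ sA] isomorphic_sym[OF _ sA] n by blast
    \<comment> \<open>Membership in \<open>Fset\<close> would force the rank of every model outside
      the class, in particular of \<open>A\<close>, below \<open>osuc l\<close>.\<close>
    show "osuc l \<notin> Fset L \<phi>" using mc.cSR_less_Fset[OF _ Am n] c by auto
  qed
  have III: "isomorphic L A (label L \<phi> (osuc l)) \<and> omega1_struct L (label L \<phi> (osuc l)) = l \<and>
        cSR L (label L \<phi> (osuc l)) = osuc l"
    if c: "cSR L A = osuc l" and b: "A \<in> big_class L \<phi> (osuc l)"
  proof -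
    note K = mc.isomorphic_label[OF b c three']
    have "omega1_struct L (label L \<phi> (osuc l)) = l" using omega1_struct_iso[OF K(1) sA] om by simp
    then show ?thesis using K by blast
  qed
  show ?thesis
    unfolding Let_def
    apply (intro conjI)
    subgoal using alt ne by auto
    subgoal using I by simp
    subgoal using II by blast
    subgoal using III by simp
    done
qed

end
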